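(* Let $\delta_1,\delta_2>0$ with $\delta_1=M\delta_2$ for a positive integer $M$. The quasinonlocal diffusion operator $\mathcal{L}^{\mathsf{qnl}}$ (defined in the context) is a self-adjoint operator, and it is consistent in the sense that $\mathcal{L}^{\mathsf{qnl}}u=0$ for any affine function $u$ (that is, $u(x)=Fx+u_0$ with constants $F,u_0$).
   Context: One space dimension. Kernel: $\gamma$ is a nonnegative radially symmetric kernel, $\gamma(x,y)=\gamma(|y-x|)\ge0$, with $\gamma(s)=0$ for $s\ge1$ and finite second moment $\int s^2\gamma(s)\,ds<\infty$. For $\delta>0$, $\gamma_\delta(s)=\delta^{-3}\gamma(s/\delta)$. Operator $\mathcal{L}^{\mathsf{qnl}}$: - if $x\le 0$: $\mathcal{L}^{\mathsf{qnl}}u(x)=\int_{\mathbb{R}}(u(y)-u(x))\gamma_{\delta_1}(|y-x|)\,dy$; - if $0<x<\delta_1$: $$\mathcal{L}^{\mathsf{qnl}}u(x)=\int_{x-\delta_1<y<0}(u(y)-u(x))\gamma_{\delta_1}(|y-x|)\,dy+\frac1M\sum_{j=1}^{M-1}\int_{x-\frac1j x<y<x+\frac1j x}(u(y)-u(x))\gamma_{\delta_2}(|y-x|)\,dy+\frac1M\int_{y>x-\frac1M x}(u(y)-u(x))\gamma_{\delta_2}(|y-x|)\,dy;$$ - if $x\ge\delta_1$: $\mathcal{L}^{\mathsf{qnl}}u(x)=\int_{\mathbb{R}}(u(y)-u(x))\gamma_{\delta_2}(|y-x|)\,dy$. This operator arises as $\mathcal{L}^{\mathsf{qnl}}=-\delta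 E^{\mathsf{tot},\mathsf{qnl}}/\delta u$, the negative first variation of the energy $$E^{\mathsf{tot},\mathsf{qnl}}(u)=\frac14\int_{x,y\in\mathbb{R},\,x\le0\text{ or }y\le0}\gamma_{\delta_1}(|y-x|)(u(y)-u(x))^2\,dx\,dy$$ $$+\frac14\int_{x,y\in\mathbb{R},\,x>0\text{ and }y>0}\gamma_{\delta_1}(|y-x|)\,\frac1M\sum_{j=0}^{M-1}\Big(u\big(x+\tfrac{j+1}{M}(y-x)\big)-u\big(x+\tfrac jM(y-x)\big)\Big)^2M^2\,dx\,dy.$$ *)

theory Defs
  imports "HOL-Analysis.Analysis"
begin

definition scaled_kernel :: "(real \<Rightarrow> real) \<Rightarrow> real \<Rightarrow> real \<Rightarrow> real" where
  "scaled_kernel \<gamma> \<delta> s = \<gamma> (s / \<delta>) / \<delta> ^ 3"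

(* A kernel with finite second moment need not have a finite first moment, so the integrals
   in the operator are principal values at y = x.  If the integrand is Lebesgue integrable on S,
   the principal value is the Lebesgue integral over S. *)

definition pv_integrable :: "real set \<Rightarrow> real \<Rightarrow> (real \<Rightarrow> real) \<Rightarrow> bool" where
  "pv_integrable S x g \<longleftrightarrow>
     (\<forall>\<epsilon>>0. set_integrable lborel {y\<in>S. \<epsilon> < \<bar>y - x\<bar>} g) \<and>
     (\<exists>I. ((\<lambda>\<epsilon>. LINT y:{y\<in>S. \<epsilon> < \<bar>y - x\<bar>}|lborel. g y) \<longlongrightarrow> I) (at_right 0))"

definition pv_integral :: "real set \<Rightarrow> real \<Rightarrow> (real \<Rightarrow> real) \<Rightarrow> real" where
  "pv_integral S x g = Lim (at_right 0) (\<lambda>\<epsilon>. LINT y:{y\<in>S. \<epsilon> < \<bar>y - x\<bar>}|lborel. g y)"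

definition diff_term :: "(real \<Rightarrow> real) \<Rightarrow> real \<Rightarrow> (real \<Rightarrow> real) \<Rightarrow> real \<Rightarrow> real \<Rightarrow> real" where
  "diff_term \<gamma> \<delta> u x y = (u y - u x) * scaled_kernel \<gamma> \<delta> \<bar>y - x\<bar>"

definition L_qnl ::
  "(real \<Rightarrow> real) \<Rightarrow> real \<Rightarrow> real \<Rightarrow> nat \<Rightarrow> (real \<Rightarrow> real) \<Rightarrow> real \<Rightarrow> real" where
  "L_qnl \<gamma> \<delta>1 \<delta>2 M u x =
     (if x \<le> 0 then pv_integral UNIV x (diff_term \<gamma> \<delta>1 u x)
      else if x < \<delta>1 then
        pv_integral {x - \<delta>1<..<0} x (diff_term \<gamma> \<delta>1 u x)
        + 1 / real M * (\<Sum>j=1..M - 1.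
            pv_integral {x - 1 / real j * x<..<x + 1 / real j * x} x (diff_term \<gamma> \<delta>2 u x))
        + 1 / real M * pv_integral {x - 1 / real M * x<..} x (diff_term \<gamma> \<delta>2 u x)
      else pv_integral UNIV x (diff_term \<gamma> \<delta>2 u x))"

(* All integrals entering the value of L_qnl at x exist. *)
definition L_qnl_defined ::
  "(real \<Rightarrow> real) \<Rightarrow> real \<Rightarrow> real \<Rightarrow> nat \<Rightarrow> (real \<Rightarrow> real) \<Rightarrow> real \<Rightarrow> bool" where
  "L_qnl_defined \<gamma> \<delta>1 \<delta>2 M u x \<longleftrightarrow>
     (if x \<le> 0 then pv_integrable UNIV x (diff_term \<gamma> \<delta>1 u x)
      else if x < \<delta>1 then
        pv_integrable {x - \<delta>1<..<0} x (diff_term \<gamma> \<delta>1 u x)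
        \<and> (\<forall>j\<in>{1..M - 1}.
            pv_integrable {x - 1 / real j * x<..<x + 1 / real j * x} x (diff_term \<gamma> \<delta>2 u x))
        \<and> pv_integrable {x - 1 / real M * x<..} x (diff_term \<gamma> \<delta>2 u x)
      else pv_integrable UNIV x (diff_term \<gamma> \<delta>2 u x))"

definition E_qnl :: "(real \<Rightarrow> real) \<Rightarrow> real \<Rightarrow> nat \<Rightarrow> (real \<Rightarrow> real) \<Rightarrow> ennreal" where
  "E_qnl \<gamma> \<delta>1 M u =
     ennreal (1 / 4) * (\<integral>\<^sup>+ (x, y). (if x \<le> 0 \<or> y \<le> 0
        then ennreal (scaled_kernel \<gamma> \<delta>1 \<bar>y - x\<bar> * (u y - u x)\<^sup>2) else 0)
        \<partial>(lborel \<Otimes>\<^sub>M lborel))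
     + ennreal (1 / 4) * (\<integral>\<^sup>+ (x, y). (if x > 0 \<and> y > 0
        then ennreal (scaled_kernel \<gamma> \<delta>1 \<bar>y - x\<bar> * (1 / real M * (\<Sum>j=0..M - 1.
          (u (x + real (j + 1) / real M * (y - x)) - u (x + real j / real M * (y - x)))\<^sup>2
            * (real M)\<^sup>2))) else 0)
        \<partial>(lborel \<Otimes>\<^sub>M lborel))"

(* Elements of the real Hilbert space L^2(R) are represented by square-integrable Borel functions;
   equality in L^2 is equality almost everywhere. *)

definition L2 :: "(real \<Rightarrow> real) set" where
  "L2 = {u \<in> borel_measurable lborel. integrable lborel (\<lambda>x. (u x)\<^sup>2)}"

definition l2_inner :: "(real \<Rightarrow> real) \<Rightarrow> (real \<Rightarrow> real) \<Rightarrow> real" where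
  "l2_inner u v = (LINT x|lborel. u x * v x)"

(* Possibly unbounded operators in L^2 are given by their graphs.  The graphs are closed under
   changes on null sets, so "single-valued" means "up to almost everywhere equality"; that follows
   from adjoint_L2 G = G when the domain is dense, as does linearity. *)

definition adjoint_L2 ::
  "((real \<Rightarrow> real) \<times> (real \<Rightarrow> real)) set \<Rightarrow> ((real \<Rightarrow> real) \<times> (real \<Rightarrow> real)) set" where
  "adjoint_L2 G = {(v, g). v \<in> L2 \<and> g \<in> L2 \<and> (\<forall>(u, f)\<in>G. l2_inner f v = l2_inner u g)}"

definition self_adjoint_L2 :: "((real \<Rightarrow> real) \<times> (real \<Rightarrow> real)) set \<Rightarrow> bool" where
  "self_adjoint_L2 G \<longleftrightarrow>
     G \<subseteq> L2 \<times> L2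
     \<and> (\<forall>w\<in>L2. \<forall>e>0. \<exists>u\<in>Domain G. (LINT x|lborel. (w x - u x)\<^sup>2) < e)
     \<and> adjoint_L2 G = G"

(* The operator in L^2(R) given by the negative first variation of the energy: u is mapped to f if
   u has finite energy and the derivative of E_qnl at u is - <f, v> in every direction v of
   finite energy. *)
definition L_qnl_graph ::
  "(real \<Rightarrow> real) \<Rightarrow> real \<Rightarrow> nat \<Rightarrow> ((real \<Rightarrow> real) \<times> (real \<Rightarrow> real)) set" where
  "L_qnl_graph \<gamma> \<delta>1 M = {(u, f). u \<in> L2 \<and> f \<in> L2 \<and> E_qnl \<gamma> \<delta>1 M u < \<infinity> \<and>
     (\<forall>v\<in>L2. E_qnl \<gamma> \<delta>1 M v < \<infinity> \<longrightarrow>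
        ((\<lambda>t. enn2real (E_qnl \<gamma> \<delta>1 M (\<lambda>x. u x + t * v x)))
           has_real_derivative - l2_inner f v) (at 0))}"

definition C2_compact :: "(real \<Rightarrow> real) set" where
  "C2_compact = {u. (\<exists>u' u''. (\<forall>x. (u has_real_derivative u' x) (at x)) \<and>
       (\<forall>x. (u' has_real_derivative u'' x) (at x)) \<and> continuous_on UNIV u'') \<and>
     (\<exists>R. \<forall>x. \<bar>x\<bar> > R \<longrightarrow> u x = 0)}"

end

theory Submission
  imports Defs
begin

text \<open>
  Substituting the end points of the sub-bonds turns the energy into
  \<open>1/2 \<Sum>i\<le>M. \<integral>\<integral> c i * \<kappa> r * m i r a * (u (a + h i * r) - u a)^2\<close> over bond lengths \<open>r > 0\<close>
  and left end points \<open>a\<close>, where \<open>\<kappa>\<close> is the kernel of range \<open>\<delta>2\<close> and the \<open>m i r\<close> are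
  indicators of half lines.  For a fixed \<open>r\<close>, summation by parts gives a finite combination
  \<open>L r\<close> of translations, and the masks telescope, so \<open>L r\<close> annihilates affine functions exactly.
  Hence \<open>L r u = O(r^2)\<close> uniformly for a compactly supported \<open>u\<close> of class C2, and
  \<open>\<integral> \<kappa> r * L r u x\<close> converges absolutely although the separate terms of the operator are only
  principal values.

  Self-adjointness is the form method: the form domain is complete by Fatou's lemma, Riesz
  representation solves \<open>u - f = h\<close> in the graph for every \<open>h\<close> in \<open>L2\<close>, and a symmetric densely
  defined operator with this range property equals its adjoint.
\<close>

subsection \<open>Hilbert space preliminaries\<close>

text \<open>The graph is defined through the energy because a second moment alone gives the integral
  formula no meaning for a general element of \<open>L2\<close>; the formula is tied to the graph
  afterwards, on \<open>C2_compact\<close> and, for integrable kernels, on all of \<open>L2\<close>.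
  Since \<delta>1 = M \<delta>2, a long bond of length M r and a sub-bond of length r carry the same
  factor \<kappa> r, so one variable r indexes all bonds. Near the interface a single index i
  contributes a term of first order in r, for which the second moment gives no bound uniform in x;
  only the sum over i at fixed r has one. So \<open>qnl_op\<close> integrates that sum, and the
  pieces of \<open>L_qnl\<close> come from regrouping it into windows around x. Functions equal
  almost everywhere are not identified. The forms are therefore only semidefinite, and Riesz
  representation is stated for a set of functions closed under linear combinations, with
  completeness asked only of sequences with rate (1/4)^n. It is used twice: for the resolvent and
  for the density of \<open>C2_compact\<close>.\<close>

lemma discriminant_bound:
  fixes \<alpha> b \<beta> :: real
  assumes nonneg: "\<And>t. \<alpha> + 2 * t * b + t\<^sup>2 * \<beta> \<ge> 0" and "\<beta> \<ge> 0"
  shows "b\<^sup>2 \<le> \<alpha> * (\<beta> + 1)\<^sup>2"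
proof -
  define c where "c = \<beta> + 1"
  have c: "c > 0" "\<beta> = c - 1" using assms(2) by (auto simp: c_def)
  \<comment> \<open>Cauchy-Schwarz with t = -b/c instead of -b/\<beta>: since c = \<beta> + 1 is
    positive, \<beta> = 0 needs no separate case. The price is the factor c^2, harmless in all uses,
    where \<alpha> is small or only a constant depending on \<beta> is wanted.\<close>
  have "0 \<le> (\<alpha> + 2 * (- b / c) * b + (- b / c)\<^sup>2 * \<beta>) * c\<^sup>2"
    using nonneg[of "- b / c"] by (intro mult_nonneg_nonneg) auto
  also have "\<dots> = \<alpha> * c\<^sup>2 - 2 * b\<^sup>2 * c + b\<^sup>2 * \<beta>"
    using c(1) by (simp add: field_simps power2_eq_square)
  also have "\<dots> = \<alpha> * c\<^sup>2 - b\<^sup>2 - b\<^sup>2 * c" unfolding c(2) by (simp add: algebra_simps)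
  also have "\<dots> \<le> \<alpha> * c\<^sup>2 - b\<^sup>2" using c(1) by simp
  finally show ?thesis by (simp add: c_def)
qed

text \<open>A minimising sequence of \<open>B v v - 2 l v\<close> is Cauchy by the parallelogram law.\<close>

lemma riesz_representation:
  fixes V :: "('a \<Rightarrow> real) set" and B :: "('a \<Rightarrow> real) \<Rightarrow> ('a \<Rightarrow> real) \<Rightarrow> real"
  assumes V0: "u0 \<in> V"
    and V_lin: "\<And>u v c. u \<in> V \<Longrightarrow> v \<in> V \<Longrightarrow> (\<lambda>x. u x + c * v x) \<in> V"
    and B_lin: "\<And>u v w c. u \<in> V \<Longrightarrow> v \<in> V \<Longrightarrow> w \<in> V \<Longrightarrow>
                  B (\<lambda>x. u x + c * v x) w = B u w + c * B v w"
    and B_sym: "\<And>u v. u \<in> V \<Longrightarrow> v \<in> V \<Longrightarrow> B u v = B v u"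
    and B_nonneg: "\<And>u. u \<in> V \<Longrightarrow> B u u \<ge> 0"
    and l_lin: "\<And>u v c. u \<in> V \<Longrightarrow> v \<in> V \<Longrightarrow> l (\<lambda>x. u x + c * v x) = l u + c * l v"
    and l_bound: "\<And>v. v \<in> V \<Longrightarrow> (l v)\<^sup>2 \<le> C * B v v" and "C \<ge> 0"
    and complete: "\<And>U. (\<And>n. U n \<in> V) \<Longrightarrow>
        (\<And>n m. n \<le> m \<Longrightarrow> B (\<lambda>x. U m x - U n x) (\<lambda>x. U m x - U n x) \<le> (1/4) ^ n) \<Longrightarrow>
        \<exists>u\<in>V. (\<lambda>n. B (\<lambda>x. U n x - u x) (\<lambda>x. U n x - u x)) \<longlonglongrightarrow> 0"
  shows "\<exists>u\<in>V. \<forall>v\<in>V. B u v = l v"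
proof -
  have V_diff: "(\<lambda>x. u x - v x) \<in> V" if "u \<in> V" "v \<in> V" for u v
    using V_lin[OF that, of "-1"] by simp
  have B_lin2: "B w (\<lambda>x. u x + c * v x) = B w u + c * B w v"
    if "u \<in> V" "v \<in> V" "w \<in> V" for u v w c
    using that B_lin[OF that] by (simp add: B_sym V_lin)
  have B_quad: "B (\<lambda>x. u x + c * v x) (\<lambda>x. u x + c * v x) = B u u + 2 * c * B u v + c\<^sup>2 * B v v"
    if "u \<in> V" "v \<in> V" for u v c
    using that
    by (simp add: B_lin B_lin2 V_lin B_sym[of v u] algebra_simps power2_eq_square)
  have B_diff: "B (\<lambda>x. u x - v x) w = B u w - B v w" if "u \<in> V" "v \<in> V" "w \<in> V" for u v w
    using B_lin[OF that, of "-1"] by simp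
  define J where "J v = B v v - 2 * l v" for v
  have J_lower: "J v \<ge> - C" if v: "v \<in> V" for v
  proof -
    have "(2 * l v)\<^sup>2 \<le> 4 * (C * B v v)" using l_bound[OF v] by (simp add: power_mult_distrib)
    also have "\<dots> \<le> (C + B v v)\<^sup>2"
      using sum_squares_bound[of C "B v v"] by (simp add: power2_sum)
    finally have "2 * l v \<le> C + B v v"
      using B_nonneg[OF v] \<open>C \<ge> 0\<close> by (meson abs_le_square_iff abs_ge_self add_nonneg_nonneg order_trans power2_le_imp_le)
    then show ?thesis by (simp add: J_def)
  qed
  define I where "I = Inf (J ` V)"
  have bdd: "bdd_below (J ` V)" using J_lower by (intro bdd_belowI2[of _ "- C"])
  have I_le: "I \<le> J v" if "v \<in> V" for v
    unfolding I_def using that bdd by (auto intro: cInf_lower)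
  \<comment> \<open>The excess (1/4)^n / 4 over the infimum is fitted to the rate in
    \<open>complete\<close>: the parallelogram law bounds half the squared distance by the sum of
    two excesses.\<close>
  have "\<exists>v\<in>V. J v < I + (1/4) ^ n / 4" for n :: nat
  proof -
    have "Inf (J ` V) < I + (1/4) ^ n / 4" by (simp add: I_def)
    then show ?thesis using cInf_less_iff[OF _ bdd] V0 by auto
  qed
  then obtain U where U: "\<And>n. U n \<in> V" and J_U: "\<And>n. J (U n) < I + (1/4) ^ n / 4"
    by metis
  have cauchy: "B (\<lambda>x. U m x - U n x) (\<lambda>x. U m x - U n x) \<le> (1/4) ^ n" if "n \<le> m" for m n
  proof -
    define w where "w = (\<lambda>x. U m x - U n x)"
    have w: "w \<in> V" unfolding w_def by (intro V_diff U)
    have mid: "(\<lambda>x. U n x + (1/2) * w x) \<in> V" by (intro V_lin U w)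
    have 1: "J (\<lambda>x. U n x + (1/2) * w x) = J (U n) + B (U n) w + B w w / 4 - l w"
      unfolding J_def using U[of n] w
      by (subst B_quad, simp, simp, subst l_lin) (auto simp: power2_eq_square)
    have "U m = (\<lambda>x. U n x + 1 * w x)" by (auto simp: w_def)
    then have 2: "J (U m) = J (U n) + 2 * B (U n) w + B w w - 2 * l w"
      unfolding J_def using U[of n] w B_quad[of "U n" w 1] l_lin[of "U n" w 1] by simp
    have "B w w / 2 = J (U m) + J (U n) - 2 * J (\<lambda>x. U n x + (1/2) * w x)"
      unfolding 1 2 by simp
    also have "\<dots> \<le> (1/4) ^ m / 4 + (1/4) ^ n / 4"
      using J_U[of m] J_U[of n] I_le[OF mid] by simp
    also have "\<dots> \<le> (1/4) ^ n / 2"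
    proof -
      have "(1/4) ^ m \<le> ((1/4) ^ n :: real)" using that by (intro power_decreasing) auto
      then show ?thesis by linarith
    qed
    finally show ?thesis by (simp add: w_def)
  qed
  obtain u where u: "u \<in> V" and lim: "(\<lambda>n. B (\<lambda>x. U n x - u x) (\<lambda>x. U n x - u x)) \<longlonglongrightarrow> 0"
    using complete[OF U cauchy] by blast
  have "B u v = l v" if v: "v \<in> V" for v
  proof -
    have "(\<lambda>n. (B (U n) v - B u v)\<^sup>2) \<longlonglongrightarrow> 0"
    proof (rule tendsto_sandwich[OF _ _ tendsto_const])
      show "(\<lambda>n. B (\<lambda>x. U n x - u x) (\<lambda>x. U n x - u x) * (B v v + 1)\<^sup>2) \<longlonglongrightarrow> 0"
        using tendsto_mult_right[OF lim, of "(B v v + 1)\<^sup>2"] by simp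
      have "(B (U n) v - B u v)\<^sup>2 \<le> B (\<lambda>x. U n x - u x) (\<lambda>x. U n x - u x) * (B v v + 1)\<^sup>2" for n
      proof (rule discriminant_bound[OF _ B_nonneg[OF v]])
        fix t
        have d: "(\<lambda>x. U n x - u x) \<in> V" by (intro V_diff U u)
        show "B (\<lambda>x. U n x - u x) (\<lambda>x. U n x - u x) + 2 * t * (B (U n) v - B u v) + t\<^sup>2 * B v v \<ge> 0"
          using B_nonneg[OF V_lin[OF d v, of t]] B_quad[OF d v, of t] B_diff[OF U u v] by simp
      qed
      then show "\<forall>\<^sub>F n in sequentially. (B (U n) v - B u v)\<^sup>2
           \<le> B (\<lambda>x. U n x - u x) (\<lambda>x. U n x - u x) * (B v v + 1)\<^sup>2" by simp
    qed simp
    then have "(\<lambda>n. \<bar>B (U n) v - B u v\<bar>) \<longlonglongrightarrow> 0"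
      using tendsto_real_sqrt by fastforce
    then have "(\<lambda>n. B (U n) v - B u v) \<longlonglongrightarrow> 0" by (rule tendsto_rabs_zero_cancel)
    then have lim2: "(\<lambda>n. B (U n) v) \<longlonglongrightarrow> B u v" by (simp add: LIM_zero_iff)
    \<comment> \<open>Euler equation of the minimum: the excess of J over I along U n + t v is
      nonnegative, and in the limit its constant term vanishes, so the discriminant bound with
      \<alpha> = 0 kills the linear term.\<close>
    have "(B u v - l v)\<^sup>2 \<le> 0 * (B v v + 1)\<^sup>2"
    proof (rule discriminant_bound[OF _ B_nonneg[OF v]])
      fix t
      have "(\<lambda>n. (1/4) ^ n / 4 + 2 * t * (B (U n) v - l v) + t\<^sup>2 * B v v)
          \<longlonglongrightarrow> 0 / 4 + 2 * t * (B u v - l v) + t\<^sup>2 * B v v"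
        by (intro tendsto_intros lim2 LIMSEQ_power_zero) auto
      moreover have "0 \<le> (1/4) ^ n / 4 + 2 * t * (B (U n) v - l v) + t\<^sup>2 * B v v" for n
      proof -
        have "J (\<lambda>x. U n x + t * v x) = J (U n) + 2 * t * (B (U n) v - l v) + t\<^sup>2 * B v v"
          unfolding J_def using U[of n] v by (simp add: B_quad l_lin algebra_simps)
        then show ?thesis using I_le[OF V_lin[OF U v, of n t]] J_U[of n] by simp
      qed
      ultimately show "0 + 2 * t * (B u v - l v) + t\<^sup>2 * B v v \<ge> 0"
        by (intro LIMSEQ_le_const) auto
    qed
    then show ?thesis by simp
  qed
  with u show ?thesis by blast
qed

section \<open>Square-integrable functions over a general measure, used on the line and on the space
  of bonds\<close>

definition square_integrable :: "'a measure \<Rightarrow> ('a \<Rightarrow> real) \<Rightarrow> bool" where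
  "square_integrable N f \<longleftrightarrow> f \<in> borel_measurable N \<and> integrable N (\<lambda>x. (f x)\<^sup>2)"

lemma square_integrableD:
  assumes "square_integrable N f"
  shows "f \<in> borel_measurable N" "integrable N (\<lambda>x. (f x)\<^sup>2)"
  using assms by (auto simp: square_integrable_def)

lemma square_integrable_mult:
  assumes "square_integrable N f" "square_integrable N g"
  shows "integrable N (\<lambda>x. f x * g x)"
proof (rule Bochner_Integration.integrable_bound)
  show "integrable N (\<lambda>x. (f x)\<^sup>2 + (g x)\<^sup>2)" using assms by (auto simp: square_integrable_def)
  show "(\<lambda>x. f x * g x) \<in> borel_measurable N" using assms by (auto simp: square_integrable_def)
  have "\<bar>f x * g x\<bar> \<le> (f x)\<^sup>2 + (g x)\<^sup>2" for x
  proof -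
    have "2 * (\<bar>f x\<bar> * \<bar>g x\<bar>) \<le> (f x)\<^sup>2 + (g x)\<^sup>2"
      using sum_squares_bound[of "\<bar>f x\<bar>" "\<bar>g x\<bar>"] by (simp add: mult.assoc)
    moreover have "0 \<le> \<bar>f x\<bar> * \<bar>g x\<bar>" by simp
    ultimately show ?thesis unfolding abs_mult by linarith
  qed
  then show "AE x in N. norm (f x * g x) \<le> norm ((f x)\<^sup>2 + (g x)\<^sup>2)" by simp
qed

lemma square_integrable_dominated:
  assumes "square_integrable N f" "g \<in> borel_measurable N" "AE x in N. \<bar>g x\<bar> \<le> \<bar>f x\<bar>"
  shows "square_integrable N g"
  unfolding square_integrable_def
proof
  show "integrable N (\<lambda>x. (g x)\<^sup>2)"
  proof (rule Bochner_Integration.integrable_bound)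
    show "integrable N (\<lambda>x. (f x)\<^sup>2)" using assms by (auto simp: square_integrable_def)
    show "(\<lambda>x. (g x)\<^sup>2) \<in> borel_measurable N" using assms by auto
    show "AE x in N. norm ((g x)\<^sup>2) \<le> norm ((f x)\<^sup>2)"
      using assms(3) by eventually_elim (simp add: abs_le_square_iff)
  qed
qed fact

lemma square_integrable_lin:
  assumes "square_integrable N f" "square_integrable N g"
  shows "square_integrable N (\<lambda>x. f x + c * g x)"
proof -
  have "integrable N (\<lambda>x. (f x)\<^sup>2 + 2 * c * (f x * g x) + c\<^sup>2 * (g x)\<^sup>2)"
    using assms square_integrable_mult[OF assms] by (auto simp: square_integrable_def)
  also have "(\<lambda>x. (f x)\<^sup>2 + 2 * c * (f x * g x) + c\<^sup>2 * (g x)\<^sup>2) = (\<lambda>x. (f x + c * g x)\<^sup>2)"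
    by (auto simp: power2_eq_square algebra_simps)
  finally show ?thesis using assms by (auto simp: square_integrable_def)
qed

lemma square_integrable_sub:
  assumes "square_integrable N f" "square_integrable N g"
  shows "square_integrable N (\<lambda>x. f x - g x)"
  using square_integrable_lin[OF assms, of "-1"] by simp

lemma square_integrable_nn_integral:
  assumes "f \<in> borel_measurable N"
  shows "square_integrable N f \<longleftrightarrow> (\<integral>\<^sup>+ x. ennreal ((f x)\<^sup>2) \<partial>N) < \<infinity>"
  using assms by (auto simp: square_integrable_def integrable_iff_bounded)

text \<open>Fatou's lemma for m to infinity in the Cauchy bound with n fixed. The limit g is
  prescribed by the caller, which allows limits found on two different measure spaces to come from
  one function.\<close>

lemma integral_square_fatou:
  fixes f :: "nat \<Rightarrow> 'a \<Rightarrow> real"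
  assumes f: "\<And>m. square_integrable N (f m)" and g: "g \<in> borel_measurable N"
    and lim: "AE x in N. (\<lambda>m. f m x) \<longlonglongrightarrow> g x"
    and bound: "\<And>m. m \<ge> n \<Longrightarrow> (LINT x|N. (f m x - f n x)\<^sup>2) \<le> e"
  shows "square_integrable N g" "(LINT x|N. (g x - f n x)\<^sup>2) \<le> e"
proof -
  have meas[measurable]: "f m \<in> borel_measurable N" for m using f by (auto simp: square_integrable_def)
  note g[measurable]
  have "0 \<le> (LINT x|N. (f n x - f n x)\<^sup>2)" by simp
  also have "\<dots> \<le> e" using bound[of n] by simp
  finally have "e \<ge> 0" .
  have "(\<integral>\<^sup>+ x. ennreal ((g x - f n x)\<^sup>2) \<partial>N)
      = (\<integral>\<^sup>+ x. liminf (\<lambda>m. ennreal ((f m x - f n x)\<^sup>2)) \<partial>N)"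
  proof (rule nn_integral_cong_AE)
    show "AE x in N. ennreal ((g x - f n x)\<^sup>2) = liminf (\<lambda>m. ennreal ((f m x - f n x)\<^sup>2))"
      using lim
    proof eventually_elim
      case (elim x)
      then have "(\<lambda>m. ennreal ((f m x - f n x)\<^sup>2)) \<longlonglongrightarrow> ennreal ((g x - f n x)\<^sup>2)"
        by (intro tendsto_intros)
      then show ?case by (intro lim_imp_Liminf[symmetric]) simp_all
    qed
  qed
  also have "\<dots> \<le> liminf (\<lambda>m. \<integral>\<^sup>+ x. ennreal ((f m x - f n x)\<^sup>2) \<partial>N)"
    by (rule nn_integral_liminf) simp
  also have "\<dots> \<le> ennreal e"
  proof -
    have "(\<integral>\<^sup>+ x. ennreal ((f m x - f n x)\<^sup>2) \<partial>N) \<le> ennreal e" if "m \<ge> n" for m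
      using bound[OF that] square_integrableD(2)[OF square_integrable_sub[OF f f, of m n]]
      by (subst nn_integral_eq_integral) (auto intro: ennreal_leI)
    then have "\<forall>\<^sub>F m in sequentially. (\<integral>\<^sup>+ x. ennreal ((f m x - f n x)\<^sup>2) \<partial>N) \<le> ennreal e"
      by (auto simp: eventually_sequentially)
    then show ?thesis by (rule Liminf_le[OF trivial_limit_sequentially])
  qed
  finally have le: "(\<integral>\<^sup>+ x. ennreal ((g x - f n x)\<^sup>2) \<partial>N) \<le> ennreal e" .
  then have sq: "square_integrable N (\<lambda>x. g x - f n x)"
    by (subst square_integrable_nn_integral) (auto intro: le_less_trans)
  then show "(LINT x|N. (g x - f n x)\<^sup>2) \<le> e"
    using le \<open>e \<ge> 0\<close> by (subst (asm) nn_integral_eq_integral) (auto simp: square_integrable_def)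
  show "square_integrable N g"
    using square_integrable_lin[OF sq f[of n], of 1] by simp
qed

section \<open>The space \<open>L2\<close> and its inner product\<close>

lemma L2_iff: "u \<in> L2 \<longleftrightarrow> square_integrable lborel u"
  by (auto simp: L2_def square_integrable_def)

lemma L2_lin: "u \<in> L2 \<Longrightarrow> v \<in> L2 \<Longrightarrow> (\<lambda>x. u x + c * v x) \<in> L2"
  unfolding L2_iff by (rule square_integrable_lin)

lemma L2_sub: "u \<in> L2 \<Longrightarrow> v \<in> L2 \<Longrightarrow> (\<lambda>x. u x - v x) \<in> L2"
  unfolding L2_iff by (rule square_integrable_sub)

lemma L2_mult: "u \<in> L2 \<Longrightarrow> v \<in> L2 \<Longrightarrow> integrable lborel (\<lambda>x. u x * v x)"
  unfolding L2_iff by (rule square_integrable_mult)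

lemma L2_zero: "(\<lambda>x. 0) \<in> L2" by (simp add: L2_def)

lemma L2_measurable: "u \<in> L2 \<Longrightarrow> u \<in> borel_measurable borel" by (simp add: L2_def)

lemma l2_inner_sym: "l2_inner u v = l2_inner v u" by (simp add: l2_inner_def mult.commute)

lemma l2_inner_lin: "u \<in> L2 \<Longrightarrow> v \<in> L2 \<Longrightarrow> w \<in> L2 \<Longrightarrow>
   l2_inner (\<lambda>x. u x + c * v x) w = l2_inner u w + c * l2_inner v w"
  using L2_mult[of u w] L2_mult[of v w] by (simp add: l2_inner_def ring_distribs mult.assoc)

lemma l2_inner_sub: "u \<in> L2 \<Longrightarrow> v \<in> L2 \<Longrightarrow> w \<in> L2 \<Longrightarrow>
   l2_inner (\<lambda>x. u x - v x) w = l2_inner u w - l2_inner v w"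
  using l2_inner_lin[of u v w "-1"] by simp

lemma l2_inner_nonneg: "l2_inner u u \<ge> 0" by (simp add: l2_inner_def)

lemma l2_inner_diff_square: "l2_inner (\<lambda>x. u x - v x) (\<lambda>x. u x - v x) = (LINT x|lborel. (u x - v x)\<^sup>2)"
  by (simp add: l2_inner_def power2_eq_square)

text \<open>Cauchy-Schwarz in the shape of \<open>l_bound\<close> in
  \<open>riesz_representation\<close>: a constant depending on u alone times the quadratic form of
  v.\<close>

lemma l2_inner_bound:
  assumes "u \<in> L2" "v \<in> L2" shows "(l2_inner u v)\<^sup>2 \<le> (l2_inner u u + 1)\<^sup>2 * l2_inner v v"
proof -
  have "(l2_inner v u)\<^sup>2 \<le> l2_inner v v * (l2_inner u u + 1)\<^sup>2"
  proof (rule discriminant_bound[OF _ l2_inner_nonneg])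
    fix t
    define w where "w = (\<lambda>x. v x + t * u x)"
    have w: "w \<in> L2" unfolding w_def using assms by (intro L2_lin)
    have "l2_inner w w = l2_inner w v + t * l2_inner w u"
      using l2_inner_lin[OF assms(2,1) w, of t]
      by (simp only: w_def[symmetric] l2_inner_sym[of v w] l2_inner_sym[of u w])
    also have "\<dots> = l2_inner v v + 2 * t * l2_inner v u + t\<^sup>2 * l2_inner u u"
      using assms l2_inner_lin[of v u v t] l2_inner_lin[of v u u t]
      by (simp only: w_def[symmetric] l2_inner_sym[of u v] power2_eq_square distrib_left)
    finally have "l2_inner w w = l2_inner v v + 2 * t * l2_inner v u + t\<^sup>2 * l2_inner u u" .
    then show "l2_inner v v + 2 * t * l2_inner v u + t\<^sup>2 * l2_inner u u \<ge> 0"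
      using l2_inner_nonneg by metis
  qed
  then show ?thesis by (simp add: l2_inner_sym[of u v] mult.commute)
qed

lemma L2_self_zero:
  assumes "u \<in> L2" "l2_inner u u = 0" shows "AE x in lborel. u x = 0"
proof -
  have "integrable lborel (\<lambda>x. u x * u x)" using assms L2_mult by blast
  then have "AE x in lborel. u x * u x = 0"
    using assms(2) unfolding l2_inner_def by (subst (asm) integral_nonneg_eq_0_iff_AE) auto
  then show ?thesis by simp
qed

text \<open>By \<open>2 \<bar>d\<bar> \<le> 2 ^ n d\<^sup>2 + 2 ^ - n\<close> the increments of the sequence are summable almost everywhere.\<close>

lemma L2_fast_Cauchy_AE_convergent:
  assumes U: "\<And>n. U n \<in> L2"
    and cauchy: "\<And>n m. n \<le> m \<Longrightarrow> (LINT x|lborel. (U m x - U n x)\<^sup>2) \<le> (1/4) ^ n"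
  shows "\<exists>u. u \<in> borel_measurable borel \<and> (AE x in lborel. (\<lambda>n. U n x) \<longlonglongrightarrow> u x)"
proof -
  have [measurable]: "U n \<in> borel_measurable borel" for n using U L2_measurable by blast
  define d where "d n x = U (Suc n) x - U n x" for n x
  have [measurable]: "d n \<in> borel_measurable borel" for n unfolding d_def by measurable
  \<comment> \<open>The weight 2^n splits the rate 4^-n evenly: the weighted squares still have
    summable integrals 2^-n, and the other half pays for the term 2^-n in the pointwise
    inequality.\<close>
  have "(\<integral>\<^sup>+ x. (\<Sum>n. ennreal (2 ^ n * (d n x)\<^sup>2)) \<partial>lborel)
      = (\<Sum>n. \<integral>\<^sup>+ x. ennreal (2 ^ n * (d n x)\<^sup>2) \<partial>lborel)"
    by (rule nn_integral_suminf) simp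
  also have "\<dots> \<le> (\<Sum>n. ennreal ((1/2) ^ n))"
  proof (rule suminf_le)
    fix n
    have sq: "integrable lborel (\<lambda>x. (d n x)\<^sup>2)"
      using L2_sub[OF U U, of "Suc n" n] by (simp add: d_def L2_def)
    have "(\<integral>\<^sup>+ x. ennreal (2 ^ n * (d n x)\<^sup>2) \<partial>lborel) = ennreal (LINT x|lborel. 2 ^ n * (d n x)\<^sup>2)"
      using sq by (intro nn_integral_eq_integral) auto
    also have "\<dots> \<le> ennreal (2 ^ n * (1/4) ^ n)"
      using cauchy[of n "Suc n"] by (intro ennreal_leI) (simp add: d_def)
    also have "2 ^ n * (1/4) ^ n = ((1/2) ^ n :: real)"
      by (simp add: power_mult_distrib[symmetric])
    finally show "(\<integral>\<^sup>+ x. ennreal (2 ^ n * (d n x)\<^sup>2) \<partial>lborel) \<le> ennreal ((1/2) ^ n)" .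
  qed auto
  also have "\<dots> < \<infinity>"
    by (subst suminf_ennreal_eq[OF _ geometric_sums]) auto
  finally have "AE x in lborel. (\<Sum>n. ennreal (2 ^ n * (d n x)\<^sup>2)) \<noteq> \<infinity>"
    by (intro nn_integral_PInf_AE) (auto simp: less_top)
  then have conv: "AE x in lborel. convergent (\<lambda>n. U n x)"
  proof eventually_elim
    case (elim x)
    then have "summable (\<lambda>n. 2 ^ n * (d n x)\<^sup>2)"
      by (intro summable_suminf_not_top) auto
    then have "summable (\<lambda>n. 2 ^ n * (d n x)\<^sup>2 + (1/2) ^ n)"
      by (intro summable_add summable_geometric) auto
    then have "summable (\<lambda>n. d n x)"
    proof (rule summable_comparison_test[rotated], intro exI allI impI)
      fix n
      define s :: real where "s = 2 ^ n"
      have s: "s > 0" "(1/2) ^ n = 1 / s" by (auto simp: s_def power_divide)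
      have "0 \<le> (s * \<bar>d n x\<bar> - 1)\<^sup>2 + s * \<bar>d n x\<bar> * 1" using s by auto
      then have "s * \<bar>d n x\<bar> \<le> s * (s * (d n x)\<^sup>2 + 1 / s)"
        using s by (simp add: power2_eq_square algebra_simps)
      then have "\<bar>d n x\<bar> \<le> s * (d n x)\<^sup>2 + 1 / s" using s by simp
      then show "norm (d n x) \<le> 2 ^ n * (d n x)\<^sup>2 + (1/2) ^ n" using s by (simp add: s_def)
    qed
    then have "convergent (\<lambda>n. U n x - U 0 x)"
      unfolding summable_iff_convergent d_def by (simp add: sum_lessThan_telescope[of "\<lambda>n. U n x"])
    then have "convergent (\<lambda>n. (U n x - U 0 x) + U 0 x)"
      by (intro convergent_add convergent_const)
    then show ?case by simp
  qed
  show ?thesis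
  proof (intro exI conjI)
    show "(\<lambda>x. lim (\<lambda>n. U n x)) \<in> borel_measurable borel" by measurable
    show "AE x in lborel. (\<lambda>n. U n x) \<longlonglongrightarrow> lim (\<lambda>n. U n x)"
      using conv by eventually_elim (simp add: convergent_LIMSEQ_iff)
  qed
qed

subsection \<open>The operator of a closed quadratic form\<close>

text \<open>D plays the part of a gradient and the form is the integral of D u times D v.
  \<open>D_lim\<close> stands in for closedness of D: it demands more than convergence in
  \<open>L2\<close> would give, but a difference of two point values satisfies it.\<close>

locale closed_form =
  fixes \<Omega> :: "'a measure" and D :: "(real \<Rightarrow> real) \<Rightarrow> 'a \<Rightarrow> real"
  assumes D_measurable: "u \<in> borel_measurable borel \<Longrightarrow> D u \<in> borel_measurable \<Omega>"
    and D_lin: "D (\<lambda>x. u x + c * v x) \<omega> = D u \<omega> + c * D v \<omega>"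
    and D_lim: "\<lbrakk>\<And>n. U n \<in> borel_measurable borel; u \<in> borel_measurable borel;
          AE x in lborel. (\<lambda>n. U n x) \<longlonglongrightarrow> u x\<rbrakk> \<Longrightarrow> AE \<omega> in \<Omega>. (\<lambda>n. D (U n) \<omega>) \<longlonglongrightarrow> D u \<omega>"
begin

definition "form_dom = {u \<in> L2. square_integrable \<Omega> (D u)}"

definition "form u v = (LINT \<omega>|\<Omega>. D u \<omega> * D v \<omega>)"

text \<open>The operator associated with the form, with a minus sign so that it is nonpositive. It
  is a set of pairs because f is fixed only up to null sets.\<close>

definition "op_graph = {(u, f). u \<in> form_dom \<and> f \<in> L2 \<and> (\<forall>v\<in>form_dom. form u v = - l2_inner f v)}"

lemma D_sub: "D (\<lambda>x. u x - v x) \<omega> = D u \<omega> - D v \<omega>"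
  using D_lin[of u "-1" v] by simp

text \<open>\<open>D_lim\<close> applied to the constant sequence u with limit v.\<close>

lemma D_AE_cong:
  assumes "u \<in> borel_measurable borel" "v \<in> borel_measurable borel" "AE x in lborel. u x = v x"
  shows "AE \<omega> in \<Omega>. D u \<omega> = D v \<omega>"
proof -
  have "AE x in lborel. (\<lambda>n::nat. u x) \<longlonglongrightarrow> v x" using assms(3) by eventually_elim simp
  from D_lim[OF assms(1,2) this] show ?thesis by eventually_elim (simp add: LIMSEQ_const_iff)
qed

lemma form_domD: "u \<in> form_dom \<Longrightarrow> u \<in> L2" "u \<in> form_dom \<Longrightarrow> square_integrable \<Omega> (D u)"
  by (auto simp: form_dom_def)

lemma form_dom_lin: "u \<in> form_dom \<Longrightarrow> v \<in> form_dom \<Longrightarrow> (\<lambda>x. u x + c * v x) \<in> form_dom"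
proof -
  assume "u \<in> form_dom" "v \<in> form_dom"
  moreover have "D (\<lambda>x. u x + c * v x) = (\<lambda>\<omega>. D u \<omega> + c * D v \<omega>)" by (auto simp: D_lin)
  ultimately show ?thesis by (auto simp: form_dom_def intro: L2_lin square_integrable_lin)
qed

lemma zero_in_form_dom: "(\<lambda>x. 0) \<in> form_dom"
proof -
  have "D (\<lambda>x. 0) = (\<lambda>\<omega>. 0)" using D_sub[of "\<lambda>x. 0" "\<lambda>x. 0"] by auto
  then show ?thesis by (simp add: form_dom_def L2_zero square_integrable_def)
qed

lemma form_sym: "form u v = form v u" by (simp add: form_def mult.commute)

lemma form_lin: "u \<in> form_dom \<Longrightarrow> v \<in> form_dom \<Longrightarrow> w \<in> form_dom \<Longrightarrow>
    form (\<lambda>x. u x + c * v x) w = form u w + c * form v w"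
  unfolding form_def D_lin
  using square_integrable_mult[OF form_domD(2) form_domD(2), of u w]
    square_integrable_mult[OF form_domD(2) form_domD(2), of v w]
  by (simp add: ring_distribs mult.assoc)

lemma form_nonneg: "form u u \<ge> 0" by (simp add: form_def)

lemma form_cong_AE:
  assumes "u \<in> form_dom" "v \<in> L2" "AE x in lborel. u x = v x"
  shows "v \<in> form_dom" "w \<in> form_dom \<Longrightarrow> form u w = form v w"
proof -
  have m: "u \<in> borel_measurable borel" "v \<in> borel_measurable borel"
    using assms form_domD L2_measurable by blast+
  have ae: "AE \<omega> in \<Omega>. D u \<omega> = D v \<omega>" using m assms(3) by (rule D_AE_cong)
  have "square_integrable \<Omega> (D v)"
  proof (rule square_integrable_dominated)
    show "square_integrable \<Omega> (D u)" by (rule form_domD) fact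
    show "AE x in \<Omega>. \<bar>D v x\<bar> \<le> \<bar>D u x\<bar>" using ae by eventually_elim simp
  qed (intro D_measurable m)
  then show v: "v \<in> form_dom" using assms by (simp add: form_dom_def)
  assume w: "w \<in> form_dom"
  show "form u w = form v w"
    unfolding form_def
  proof (rule integral_cong_AE)
    show "AE x in \<Omega>. D u x * D w x = D v x * D w x" using ae by eventually_elim simp
  qed (use D_measurable m L2_measurable form_domD(1)[OF w] in auto)
qed

text \<open>The energy norm makes both U n and D (U n) Cauchy. Only the limit u on the line is
  constructed; \<open>D_lim\<close> identifies the limit of the differences as D u, so Fatou applies
  on both spaces to the same u.\<close>

lemma energy_complete:
  assumes U: "\<And>n. U n \<in> form_dom"
    and cauchy: "\<And>n m. n \<le> m \<Longrightarrow> l2_inner (\<lambda>x. U m x - U n x) (\<lambda>x. U m x - U n x)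
       + form (\<lambda>x. U m x - U n x) (\<lambda>x. U m x - U n x) \<le> (1/4) ^ n"
  shows "\<exists>u\<in>form_dom. (\<lambda>n. l2_inner (\<lambda>x. U n x - u x) (\<lambda>x. U n x - u x)
       + form (\<lambda>x. U n x - u x) (\<lambda>x. U n x - u x)) \<longlonglongrightarrow> 0"
proof -
  have c1: "(LINT x|lborel. (U m x - U n x)\<^sup>2) \<le> (1/4) ^ n" if "n \<le> m" for n m
    using cauchy[OF that] form_nonneg[of "\<lambda>x. U m x - U n x"] unfolding l2_inner_diff_square by linarith
  have c2: "(LINT x|\<Omega>. (D (U m) x - D (U n) x)\<^sup>2) \<le> (1/4) ^ n" if "n \<le> m" for n m
    using cauchy[OF that] l2_inner_nonneg[of "\<lambda>x. U m x - U n x"]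
    unfolding form_def D_sub power2_eq_square by linarith
  have sqU: "square_integrable lborel (U n)" "square_integrable \<Omega> (D (U n))" for n
    using U form_domD by (auto simp: L2_iff)
  obtain u where u: "u \<in> borel_measurable borel" "AE x in lborel. (\<lambda>n. U n x) \<longlonglongrightarrow> u x"
    using L2_fast_Cauchy_AE_convergent[OF form_domD(1)[OF U] c1] by auto
  have Du: "AE \<omega> in \<Omega>. (\<lambda>n. D (U n) \<omega>) \<longlonglongrightarrow> D u \<omega>"
    using D_lim[OF L2_measurable[OF form_domD(1)[OF U]] u] .
  have f1: "square_integrable lborel u" "(LINT x|lborel. (u x - U n x)\<^sup>2) \<le> (1/4) ^ n" for n
    using integral_square_fatou[OF sqU(1) _ u(2), of n "(1/4) ^ n"] u(1) c1 by auto
  have f2: "square_integrable \<Omega> (D u)" "(LINT x|\<Omega>. (D u x - D (U n) x)\<^sup>2) \<le> (1/4) ^ n" for n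
    using integral_square_fatou[OF sqU(2) D_measurable[OF u(1)] Du, of n "(1/4) ^ n"] c2 by auto
  show ?thesis
  proof (intro bexI)
    show "u \<in> form_dom" using f1 f2 by (auto simp: form_dom_def L2_iff)
    define e where "e n = l2_inner (\<lambda>x. U n x - u x) (\<lambda>x. U n x - u x)
       + form (\<lambda>x. U n x - u x) (\<lambda>x. U n x - u x)" for n
    have le: "e n \<le> 2 * (1/4) ^ n" for n
      using f1(2)[of n] f2(2)[of n]
      unfolding e_def l2_inner_diff_square form_def D_sub power2_eq_square[symmetric]
      by (simp add: power2_commute[of "u _"] power2_commute[of "D u _"])
    have "(\<lambda>n. 2 * (1/4) ^ n :: real) \<longlonglongrightarrow> 2 * 0" by (intro tendsto_intros LIMSEQ_power_zero) auto
    moreover have "e n \<ge> 0" for n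
      unfolding e_def by (intro add_nonneg_nonneg l2_inner_nonneg form_nonneg)
    ultimately have "e \<longlonglongrightarrow> 0"
      by (intro tendsto_sandwich[where f = "\<lambda>n. 0" and g = e and h = "\<lambda>n. 2 * (1/4) ^ n"])
        (simp_all add: le)
    then show "(\<lambda>n. l2_inner (\<lambda>x. U n x - u x) (\<lambda>x. U n x - u x)
       + form (\<lambda>x. U n x - u x) (\<lambda>x. U n x - u x)) \<longlonglongrightarrow> 0"
      unfolding e_def .
  qed
qed

text \<open>Riesz representation for the sum of the inner product and the form, applied to the
  functional of h; then f = u - h.\<close>

lemma resolvent_exists:
  assumes h: "h \<in> L2"
  obtains u f where "(u, f) \<in> op_graph" "\<And>x. u x - f x = h x"
proof -
  have "\<exists>u\<in>form_dom. \<forall>v\<in>form_dom. l2_inner u v + form u v = l2_inner h v"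
  proof (rule riesz_representation[where C = "(l2_inner h h + 1)\<^sup>2"])
    show "(\<lambda>x. 0) \<in> form_dom" by (rule zero_in_form_dom)
    show "(l2_inner h v)\<^sup>2 \<le> (l2_inner h h + 1)\<^sup>2 * (l2_inner v v + form v v)" if "v \<in> form_dom" for v
      using l2_inner_bound[OF h form_domD(1)[OF that]] mult_left_mono[of "l2_inner v v" "l2_inner v v + form v v" "(l2_inner h h + 1)\<^sup>2"] form_nonneg[of v]
      by auto
    show "l2_inner h (\<lambda>x. u x + c * v x) = l2_inner h u + c * l2_inner h v"
      if "u \<in> form_dom" "v \<in> form_dom" for u v c
      using that form_domD h by (simp only: l2_inner_sym[of h] l2_inner_lin)
    show "l2_inner u v + form u v = l2_inner v u + form v u" for u v
      by (simp only: l2_inner_sym[of u v] form_sym[of u v])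
  qed (auto simp: form_dom_lin l2_inner_lin form_domD form_lin l2_inner_nonneg form_nonneg algebra_simps
         intro!: energy_complete)
  then obtain u where u: "u \<in> form_dom" "\<And>v. v \<in> form_dom \<Longrightarrow> l2_inner u v + form u v = l2_inner h v" by blast
  have "(u, \<lambda>x. u x - h x) \<in> op_graph"
    unfolding op_graph_def using u(1) h u(2) by (auto simp: form_domD L2_sub l2_inner_sub) (smt (verit))
  then show ?thesis by (rule that) simp
qed

lemma op_graph_symmetric:
  assumes "(u, f) \<in> op_graph" "(v, g) \<in> op_graph"
  shows "l2_inner f v = l2_inner u g"
  using assms form_sym[of u v] l2_inner_sym[of u g] by (auto simp: op_graph_def)

text \<open>Self-adjointness is an equality of sets of functions, not of classes, while
  \<open>adjoint_op_graph\<close> identifies its pairs only almost everywhere.\<close>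

lemma op_graph_cong_AE:
  assumes "(u, f) \<in> op_graph" "v \<in> L2" "g \<in> L2" "AE x in lborel. u x = v x" "AE x in lborel. f x = g x"
  shows "(v, g) \<in> op_graph"
proof -
  have u: "u \<in> form_dom" "f \<in> L2" "\<And>w. w \<in> form_dom \<Longrightarrow> form u w = - l2_inner f w"
    using assms(1) by (auto simp: op_graph_def)
  have "l2_inner f w = l2_inner g w" if "w \<in> form_dom" for w
    unfolding l2_inner_def
  proof (rule integral_cong_AE)
    show "AE x in lborel. f x * w x = g x * w x" using assms(5) by eventually_elim simp
  qed (use L2_measurable u(2) assms(3) form_domD(1)[OF that] in auto)
  then show ?thesis
    using form_cong_AE[OF u(1) assms(2,4)] u(3) assms(3) by (auto simp: op_graph_def)
qed

text \<open>The range of \<open>u \<mapsto> u - f\<close> over the graph is all of \<open>L2\<close>, so a pair in the adjoint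
  differs from a pair in the graph by an element orthogonal to that range.\<close>

lemma adjoint_op_graph: "adjoint_L2 op_graph = op_graph"
proof (intro equalityI subrelI)
  fix v g assume "(v, g) \<in> op_graph"
  then show "(v, g) \<in> adjoint_L2 op_graph"
    using op_graph_symmetric[OF _ \<open>(v, g) \<in> op_graph\<close>] by (auto simp: adjoint_L2_def op_graph_def form_domD)
next
  fix v g assume "(v, g) \<in> adjoint_L2 op_graph"
  then have v: "v \<in> L2" "g \<in> L2" "\<And>u f. (u, f) \<in> op_graph \<Longrightarrow> l2_inner f v = l2_inner u g"
    by (auto simp: adjoint_L2_def)
  \<comment> \<open>A graph pair with the same image under (u, f) to u - f as the given pair (v,
    g).\<close>
  obtain u' f' where G': "(u', f') \<in> op_graph" and eq': "\<And>x. u' x - f' x = v x - g x"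
    using resolvent_exists[OF L2_sub[OF v(1,2)]] by auto
  have L2': "u' \<in> L2" "f' \<in> L2" using G' by (auto simp: op_graph_def form_domD)
  define w where "w = (\<lambda>x. v x - u' x)"
  have w: "w \<in> L2" unfolding w_def by (intro L2_sub v L2')
  obtain u f where G: "(u, f) \<in> op_graph" and eq: "\<And>x. u x - f x = w x"
    using resolvent_exists[OF w] by auto
  have L2: "u \<in> L2" "f \<in> L2" using G by (auto simp: op_graph_def form_domD)
  \<comment> \<open>The difference of (v, g) and (u', f') is (w, w), with equal components. Testing
    it against a graph pair (u, f) with u - f = w yields that w is orthogonal to itself.\<close>
  have "w = (\<lambda>x. g x - f' x)" using eq' by (auto simp: w_def algebra_simps fun_eq_iff)
  then have "l2_inner u w = l2_inner u g - l2_inner u f'"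
    using l2_inner_sub[OF v(2) L2'(2) L2(1)] by (simp add: l2_inner_sym[of u])
  also have "\<dots> = l2_inner f v - l2_inner f u'"
    using v(3)[OF G] op_graph_symmetric[OF G G'] by simp
  also have "\<dots> = l2_inner f w"
    using l2_inner_sub[OF v(1) L2'(1) L2(2)] by (simp add: w_def l2_inner_sym[of f])
  finally have "l2_inner (\<lambda>x. u x - f x) w = 0" using l2_inner_sub[OF L2 w] by simp
  then have "AE x in lborel. w x = 0" using L2_self_zero[OF w] eq by simp
  then have "AE x in lborel. u' x = v x" "AE x in lborel. f' x = g x"
    using eq' by (auto simp: w_def elim!: eventually_mono) (smt (verit))
  then show "(v, g) \<in> op_graph" using op_graph_cong_AE[OF G' v(1,2)] by blast
qed

end

subsection \<open>Density of \<open>C2_compact\<close> in \<open>L2\<close>\<close>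

text \<open>Each power of the positive part gains one derivative, so the cube in \<open>bump\<close>
  is twice continuously differentiable.\<close>

lemma has_derivative_max_0_power:
  assumes "n \<ge> 1"
  shows "((\<lambda>t::real. max 0 t ^ Suc n) has_real_derivative real (Suc n) * max 0 t ^ n) (at t)"
proof -
  consider "t > 0" | "t < 0" | "t = 0" by linarith
  then show ?thesis
  proof cases
    case 1
    have "((\<lambda>t::real. t ^ Suc n) has_real_derivative real (Suc n) * max 0 t ^ n) (at t)"
      using 1 DERIV_pow[of "Suc n" t] by (simp add: max_def)
    then show ?thesis
      by (rule has_field_derivative_transform_within_open[of _ _ _ "{0<..}"]) (use 1 in \<open>auto simp: max_def\<close>)
  next
    case 2
    have "((\<lambda>t::real. 0) has_real_derivative real (Suc n) * max 0 t ^ n) (at t)"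
      using 2 assms by (simp add: max_def zero_power)
    then show ?thesis
      by (rule has_field_derivative_transform_within_open[of _ _ _ "{..<0}"]) (use 2 in \<open>auto simp: max_def\<close>)
  next
    case 3
    \<comment> \<open>At 0 the difference quotient of the power \<open>Suc n\<close> is max 0 h ^ n
      itself, which tends to 0 as n is at least 1.\<close>
    have "((\<lambda>h::real. max 0 h ^ n) \<longlongrightarrow> max 0 0 ^ n) (at 0)"
      by (intro tendsto_intros)
    moreover have "\<forall>\<^sub>F h::real in at 0. max 0 h ^ n = (max 0 (0 + h) ^ Suc n - max 0 0 ^ Suc n) / h"
      using assms by (auto simp: eventually_at_filter max_def zero_power)
    ultimately have "((\<lambda>h::real. (max 0 (0 + h) ^ Suc n - max 0 0 ^ Suc n) / h) \<longlongrightarrow> max 0 0 ^ n) (at 0)"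
      by (rule Lim_transform_eventually)
    then show ?thesis using 3 assms by (simp add: DERIV_def zero_power)
  qed
qed

text \<open>For a < b, an approximation of the indicator of the open interval from below: zero
  outside it and tending to 1 inside as n grows. The cube provides smoothness at the end points; n =
  0 gives the zero function.\<close>

definition bump :: "real \<Rightarrow> real \<Rightarrow> nat \<Rightarrow> real \<Rightarrow> real" where
  "bump a b n x = 1 - exp (- real n * max 0 ((x - a) * (b - x)) ^ 3)"

lemma bump_C2: "bump a b n \<in> C2_compact"
proof -
  define m where "m x = max 0 ((x - a) * (b - x))" for x
  define P' where "P' x = a + b - 2 * x" for x
  define e where "e x = exp (- real n * m x ^ 3)" for x
  have P: "((\<lambda>x. (x - a) * (b - x)) has_real_derivative P' x) (at x)" for x
    unfolding P'_def by (auto intro!: derivative_eq_intros)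
  have m3: "((\<lambda>x. m x ^ 3) has_real_derivative 3 * m x ^ 2 * P' x) (at x)" for x
    unfolding m_def using DERIV_chain2[OF has_derivative_max_0_power[of 2] P, of x]
    by (simp add: eval_nat_numeral)
  have m2: "((\<lambda>x. m x ^ 2) has_real_derivative 2 * m x * P' x) (at x)" for x
    unfolding m_def using DERIV_chain2[OF has_derivative_max_0_power[of 1] P, of x]
    by (simp add: eval_nat_numeral)
  have P'': "(P' has_real_derivative -2) (at x)" for x
    unfolding P'_def by (auto intro!: derivative_eq_intros)
  have e: "(e has_real_derivative - real n * (3 * m x ^ 2 * P' x) * e x) (at x)" for x
    unfolding e_def using DERIV_chain2[OF DERIV_exp DERIV_cmult[OF m3, of "- real n"]] by (simp add: mult_ac)
  have bump_eq: "bump a b n = (\<lambda>x. 1 - e x)" by (auto simp: bump_def e_def m_def)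
  have [continuous_intros]: "continuous_on UNIV m" "continuous_on UNIV P'" "continuous_on UNIV e"
    unfolding e_def m_def P'_def by (intro continuous_intros)+
  show ?thesis
    unfolding C2_compact_def bump_eq
  proof (intro CollectI conjI exI allI)
    fix x
    show "((\<lambda>x. 1 - e x) has_real_derivative real n * (3 * m x ^ 2 * P' x) * e x) (at x)"
      by (auto intro!: derivative_eq_intros e)
    show "((\<lambda>x. real n * (3 * m x ^ 2 * P' x) * e x) has_real_derivative
       real n * (3 * (2 * m x * P' x) * P' x + 3 * m x ^ 2 * (-2)) * e x
        + real n * (3 * m x ^ 2 * P' x) * (- real n * (3 * m x ^ 2 * P' x) * e x)) (at x)"
      by (rule m2 P'' e derivative_eq_intros refl)+ (simp add: algebra_simps)
  next
    show "continuous_on UNIV (\<lambda>x. real n * (3 * (2 * m x * P' x) * P' x + 3 * m x ^ 2 * (-2)) * e x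
        + real n * (3 * m x ^ 2 * P' x) * (- real n * (3 * m x ^ 2 * P' x) * e x))"
      by (intro continuous_intros)
  next
    fix x
    show "\<bar>a\<bar> + \<bar>b\<bar> < \<bar>x\<bar> \<longrightarrow> 1 - e x = 0"
    proof
      assume "\<bar>a\<bar> + \<bar>b\<bar> < \<bar>x\<bar>"
      then have "(x - a) * (b - x) \<le> 0" by (auto simp: mult_le_0_iff abs_if split: if_splits)
      then show "1 - e x = 0" by (simp add: e_def m_def max_def)
    qed
  qed
qed

lemma bump_bounds: "0 \<le> bump a b n x" "bump a b n x \<le> 1"
  by (auto simp: bump_def)

lemma bump_outside: "x \<notin> {a<..<b} \<Longrightarrow> a < b \<Longrightarrow> bump a b n x = 0"
  by (cases "x \<le> a") (auto simp: bump_def max_def mult_nonpos_nonneg mult_nonneg_nonpos antisym)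

lemma bump_tendsto_indicator:
  assumes "a < b"
  shows "(\<lambda>n. bump a b n x) \<longlonglongrightarrow> indicator {a<..<b} x"
proof (cases "x \<in> {a<..<b}")
  case True
  define c where "c = ((x - a) * (b - x)) ^ 3"
  have c: "c > 0" using True by (simp add: c_def)
  have "(\<lambda>n. 1 - exp (- c) ^ n) \<longlonglongrightarrow> 1 - 0"
    by (intro tendsto_intros LIMSEQ_power_zero) (use c in auto)
  moreover have "bump a b n x = 1 - exp (- c) ^ n" for n
    using True by (simp add: bump_def c_def max_def not_le flip: exp_of_nat_mult)
  ultimately show ?thesis using True by simp
next
  case False
  then show ?thesis using assms by (simp add: bump_outside)
qed

lemma C2_compactE:
  assumes "u \<in> C2_compact"
  obtains u' u'' R where "\<And>x. (u has_real_derivative u' x) (at x)"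
    "\<And>x. (u' has_real_derivative u'' x) (at x)" "continuous_on UNIV u''" "\<And>x. \<bar>x\<bar> > R \<Longrightarrow> u x = 0"
  using assms unfolding C2_compact_def by blast

lemma C2_compact_continuous:
  assumes "u \<in> C2_compact" shows "continuous_on UNIV u"
  using assms by (elim C2_compactE) (meson DERIV_isCont continuous_at_imp_continuous_on)

lemma C2_compact_L2:
  assumes "u \<in> C2_compact" shows "u \<in> L2"
proof -
  obtain R where R: "\<And>x. \<bar>x\<bar> > R \<Longrightarrow> u x = 0" using assms by (elim C2_compactE) blast
  have "integrable lborel (\<lambda>x. indicator {-R..R} x *\<^sub>R (u x)\<^sup>2)"
    by (rule borel_integrable_compact)
      (auto intro!: continuous_intros continuous_on_subset[OF C2_compact_continuous[OF assms]])
  also have "(\<lambda>x. indicator {-R..R} x *\<^sub>R (u x)\<^sup>2) = (\<lambda>x. (u x)\<^sup>2)"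
  proof
    show "indicator {-R..R} x *\<^sub>R (u x)\<^sup>2 = (u x)\<^sup>2" for x
      using R[of x] by (cases "\<bar>x\<bar> > R") (auto simp: indicator_def)
  qed
  finally show ?thesis
    using borel_measurable_continuous_onI[OF C2_compact_continuous[OF assms]] by (simp add: L2_def)
qed

lemma C2_compact_lin:
  assumes "u \<in> C2_compact" "v \<in> C2_compact" shows "(\<lambda>x. u x + c * v x) \<in> C2_compact"
proof -
  obtain u' u'' R where u: "\<And>x. (u has_real_derivative u' x) (at x)"
    "\<And>x. (u' has_real_derivative u'' x) (at x)" "continuous_on UNIV u''" "\<And>x. \<bar>x\<bar> > R \<Longrightarrow> u x = 0"
    using C2_compactE[OF assms(1)] by metis
  obtain v' v'' S where v: "\<And>x. (v has_real_derivative v' x) (at x)"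
    "\<And>x. (v' has_real_derivative v'' x) (at x)" "continuous_on UNIV v''" "\<And>x. \<bar>x\<bar> > S \<Longrightarrow> v x = 0"
    using C2_compactE[OF assms(2)] by metis
  show ?thesis
    unfolding C2_compact_def
  proof (intro CollectI conjI exI allI)
    show "((\<lambda>x. u x + c * v x) has_real_derivative u' x + c * v' x) (at x)" for x
      by (auto intro!: derivative_eq_intros u v)
    show "((\<lambda>x. u' x + c * v' x) has_real_derivative u'' x + c * v'' x) (at x)" for x
      by (auto intro!: derivative_eq_intros u v)
    show "continuous_on UNIV (\<lambda>x. u'' x + c * v'' x)" by (intro continuous_intros u v)
    show "max R S < \<bar>x\<bar> \<longrightarrow> u x + c * v x = 0" for x using u(4)[of x] v(4)[of x] by auto
  qed
qed

text \<open>\<open>ennreal\<close> truncates negative values to 0, so the two densities are the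
  positive and negative parts of f. The measures they define agree on all half lines, hence
  everywhere, so the two parts agree almost everywhere; as one of them is always 0, so is f.\<close>

lemma AE_zero_if_interval_integrals_zero:
  fixes f :: "real \<Rightarrow> real"
  assumes f: "integrable lborel f" and 0: "\<And>x. (LINT y|lborel. indicator {x<..} y * f y) = 0"
  shows "AE x in lborel. f x = 0"
proof -
  have [measurable]: "f \<in> borel_measurable borel" using f by auto
  have fin: "(\<integral>\<^sup>+ y. ennreal (f y) \<partial>lborel) < \<infinity>" "(\<integral>\<^sup>+ y. ennreal (- f y) \<partial>lborel) < \<infinity>"
    using f unfolding real_integrable_def by (auto simp: less_top)
  have eq: "emeasure (density lborel (\<lambda>y. ennreal (f y))) {x<..}
          = emeasure (density lborel (\<lambda>y. ennreal (- f y))) {x<..}"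
    and finx: "emeasure (density lborel (\<lambda>y. ennreal (f y))) {x<..} < \<infinity>" for x
  proof -
    define g where "g y = indicator {x<..} y * f y" for y
    have g: "integrable lborel g" unfolding g_def using f integrable_mult_indicator[of "{x<..}" lborel f] by simp
    have *: "emeasure (density lborel (\<lambda>y. ennreal (f y))) {x<..} = (\<integral>\<^sup>+ y. ennreal (g y) \<partial>lborel)"
      by (subst emeasure_density) (auto intro!: nn_integral_cong simp: g_def indicator_def)
    have **: "emeasure (density lborel (\<lambda>y. ennreal (- f y))) {x<..} = (\<integral>\<^sup>+ y. ennreal (- g y) \<partial>lborel)"
      by (subst emeasure_density) (auto intro!: nn_integral_cong simp: g_def indicator_def)
    have "(\<integral>\<^sup>+ y. ennreal (g y) \<partial>lborel) \<noteq> \<infinity>" "(\<integral>\<^sup>+ y. ennreal (- g y) \<partial>lborel) \<noteq> \<infinity>"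
      using g unfolding real_integrable_def by auto
    moreover have "enn2real (\<integral>\<^sup>+ y. ennreal (g y) \<partial>lborel) = enn2real (\<integral>\<^sup>+ y. ennreal (- g y) \<partial>lborel)"
      using 0[of x] real_lebesgue_integral_def[OF g] unfolding g_def by linarith
    ultimately show "emeasure (density lborel (\<lambda>y. ennreal (f y))) {x<..}
          = emeasure (density lborel (\<lambda>y. ennreal (- f y))) {x<..}"
      "emeasure (density lborel (\<lambda>y. ennreal (f y))) {x<..} < \<infinity>"
      unfolding * ** by (metis ennreal_enn2real infinity_ennreal_def less_top)+
  qed
  have "density lborel (\<lambda>y. ennreal (f y)) = density lborel (\<lambda>y. ennreal (- f y))"
    by (rule measure_eqI_lessThan) (use finx in \<open>auto simp: eq\<close>)
  then have "AE x in lborel. ennreal (f x) = ennreal (- f x)"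
    by (subst (asm) finite_density_unique) (use fin in auto)
  then show ?thesis
    by eventually_elim (smt (verit) ennreal_eq_0_iff ennreal_inj)
qed

lemma L2_indicator_interval: "indicator {a<..<b} \<in> L2" for a b :: real
  by (cases "a \<le> b") (auto simp: L2_def power2_eq_square indicator_inter_arith[symmetric] emeasure_lborel_Ioo)

text \<open>Bumps pass orthogonality on to indicators of bounded intervals by dominated convergence.
  Since w need not be integrable on the line, it is restricted to (-n, n) before half lines are
  tested.\<close>

lemma orthogonal_C2_compact_AE_zero:
  assumes w: "w \<in> L2" and orth: "\<And>\<phi>. \<phi> \<in> C2_compact \<Longrightarrow> l2_inner w \<phi> = 0"
  shows "AE x in lborel. w x = 0"
proof -
  have [measurable]: "w \<in> borel_measurable borel" using w L2_measurable by blast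
  have int: "integrable lborel (\<lambda>x. indicator {a<..<b} x * w x)" for a b :: real
    using L2_mult[OF L2_indicator_interval w] by simp
  have zero: "(LINT x|lborel. indicator {a<..<b} x * w x) = 0" for a b :: real
  proof (cases "a < b")
    case ab: True
    have "(\<lambda>n. LINT x|lborel. bump a b n x * w x) \<longlonglongrightarrow> (LINT x|lborel. indicator {a<..<b} x * w x)"
    proof (rule integral_dominated_convergence)
      show "integrable lborel (\<lambda>x. \<bar>indicator {a<..<b} x * w x\<bar>)" using int by (rule integrable_abs)
      show "AE x in lborel. (\<lambda>n. bump a b n x * w x) \<longlonglongrightarrow> indicator {a<..<b} x * w x"
        by (intro always_eventually allI tendsto_mult bump_tendsto_indicator ab tendsto_const)
      show "AE x in lborel. norm (bump a b n x * w x) \<le> \<bar>indicator {a<..<b} x * w x\<bar>" for n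
      proof (intro always_eventually allI)
        fix x
        show "norm (bump a b n x * w x) \<le> \<bar>indicator {a<..<b} x * w x\<bar>"
          using bump_outside[OF _ ab, of x n] bump_bounds[of a b n x]
          by (cases "x \<in> {a<..<b}") (auto simp: abs_mult mult_left_le_one_le)
      qed
    qed (auto simp: bump_def)
    moreover have "(LINT x|lborel. bump a b n x * w x) = 0" for n
      using orth[OF bump_C2[of a b n]] by (simp add: l2_inner_def mult.commute)
    ultimately show ?thesis by (simp add: LIMSEQ_const_iff)
  qed simp
  have "AE x in lborel. indicator {- real n<..<real n} x * w x = 0" for n
  proof (rule AE_zero_if_interval_integrals_zero[OF int])
    fix x
    have "(\<lambda>y. indicator {x<..} y * (indicator {- real n<..<real n} y * w y))
        = (\<lambda>y. indicator {max x (- real n)<..<real n} y * w y)"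
      by (auto simp: indicator_def)
    then show "(LINT y|lborel. indicator {x<..} y * (indicator {- real n<..<real n} y * w y)) = 0"
      by (simp add: zero)
  qed
  then have "AE x in lborel. \<forall>n. indicator {- real n<..<real n} x * w x = 0"
    by (subst AE_all_countable) blast
  then show ?thesis
  proof eventually_elim
    case (elim x)
    obtain n where "\<bar>x\<bar> < real n" using reals_Archimedean2 by blast
    then show ?case using elim[rule_format, of n] by (auto simp: indicator_def abs_if split: if_splits)
  qed
qed

lemma L2_square_add_le:
  assumes "f \<in> L2" "g \<in> L2"
  shows "(LINT x|lborel. (f x + g x)\<^sup>2) \<le> 2 * (LINT x|lborel. (f x)\<^sup>2) + 2 * (LINT x|lborel. (g x)\<^sup>2)"
proof -
  have fg: "integrable lborel (\<lambda>x. (f x)\<^sup>2)" "integrable lborel (\<lambda>x. (g x)\<^sup>2)"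
      "integrable lborel (\<lambda>x. (f x + g x)\<^sup>2)"
    using assms L2_lin[OF assms, of 1] by (auto simp: L2_def)
  have "(LINT x|lborel. (f x + g x)\<^sup>2) \<le> (LINT x|lborel. 2 * (f x)\<^sup>2 + 2 * (g x)\<^sup>2)"
  proof (rule integral_mono)
    show "(f x + g x)\<^sup>2 \<le> 2 * (f x)\<^sup>2 + 2 * (g x)\<^sup>2" for x
      using sum_squares_bound[of "f x" "g x"] by (simp add: power2_sum)
  qed (use fg in auto)
  also have "\<dots> = 2 * (LINT x|lborel. (f x)\<^sup>2) + 2 * (LINT x|lborel. (g x)\<^sup>2)" using fg by simp
  finally show ?thesis .
qed

text \<open>The orthogonal projection onto the closure of \<open>C2_compact\<close> is the identity.\<close>

lemma C2_compact_dense: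
  assumes w: "w \<in> L2" and e: "e > 0"
  shows "\<exists>u\<in>C2_compact. (LINT x|lborel. (w x - u x)\<^sup>2) < e"
proof -
  \<comment> \<open>The closure of \<open>C2_compact\<close> in \<open>L2\<close>, in epsilon
    form.\<close>
  define W where "W = {w\<in>L2. \<forall>e>0. \<exists>u\<in>C2_compact. (LINT x|lborel. (w x - u x)\<^sup>2) < e}"
  have sub: "C2_compact \<subseteq> W"
    using C2_compact_L2 by (force simp: W_def intro!: bexI)
  have WL2: "W \<subseteq> L2" by (auto simp: W_def)
  have tri: "(LINT x|lborel. (f x - h x)\<^sup>2) \<le> 2 * (LINT x|lborel. (f x - g x)\<^sup>2) + 2 * (LINT x|lborel. (g x - h x)\<^sup>2)"
    if "f \<in> L2" "g \<in> L2" "h \<in> L2" for f g h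
    using L2_square_add_le[OF L2_sub[OF that(1,2)] L2_sub[OF that(2,3)]] by simp
  have lin: "(\<lambda>x. f x + c * g x) \<in> W" if "f \<in> W" "g \<in> W" for f g c
    unfolding W_def
  proof (intro CollectI conjI allI impI)
    show "(\<lambda>x. f x + c * g x) \<in> L2" using that WL2 by (auto intro: L2_lin)
    fix e :: real assume "e > 0"
    have "e / 4 > 0" using \<open>e > 0\<close> by simp
    then obtain u where u: "u \<in> C2_compact" "(LINT x|lborel. (f x - u x)\<^sup>2) < e / 4"
      using \<open>f \<in> W\<close> unfolding W_def by blast
    \<comment> \<open>With this d, both halves of the estimate contribute e/2. The summand 1 keeps
      the denominator positive for c = 0 and leaves room for a strict inequality.\<close>
    define d where "d = e / (4 * (c\<^sup>2 + 1))"
    have c1: "c\<^sup>2 + 1 > 0" by (simp add: add_nonneg_pos)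
    then have "d > 0" using \<open>e > 0\<close> by (simp add: d_def)
    then obtain v where v: "v \<in> C2_compact" "(LINT x|lborel. (g x - v x)\<^sup>2) < d"
      using \<open>g \<in> W\<close> unfolding W_def by blast
    have L: "(\<lambda>x. f x - u x) \<in> L2" "(\<lambda>x. g x - v x) \<in> L2"
      using that u v WL2 by (intro L2_sub; auto intro: C2_compact_L2)+
    have "(LINT x|lborel. (f x + c * g x - (u x + c * v x))\<^sup>2)
        = (LINT x|lborel. ((f x - u x) + c * (g x - v x))\<^sup>2)"
      by (simp add: algebra_simps)
    also have "\<dots> \<le> 2 * (LINT x|lborel. (f x - u x)\<^sup>2) + 2 * (LINT x|lborel. (c * (g x - v x))\<^sup>2)"
      using L2_lin[OF L2_zero L(2), of c] by (intro L2_square_add_le L) simp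
    also have "\<dots> < e / 2 + 2 * c\<^sup>2 * d + 2 * d"
      using u(2) mult_left_mono[OF less_imp_le[OF v(2)], of "2 * c\<^sup>2"] \<open>d > 0\<close>
      by (simp add: power_mult_distrib)
    also have "e / 2 + 2 * c\<^sup>2 * d + 2 * d = e / 2 + 2 * (d * (c\<^sup>2 + 1))" by (simp add: algebra_simps)
    also have "d * (c\<^sup>2 + 1) = e / 4"
    proof -
      have "e / (4 * k) * k = e / 4" if "k \<noteq> 0" for k using that by simp
      then show ?thesis using c1 unfolding d_def by (metis less_irrefl)
    qed
    finally have "(LINT x|lborel. (f x + c * g x - (u x + c * v x))\<^sup>2) < e" by simp
    then show "\<exists>u\<in>C2_compact. (LINT x|lborel. (f x + c * g x - u x)\<^sup>2) < e"
      using C2_compact_lin[OF u(1) v(1), of c] by force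
  qed
  \<comment> \<open>This u is the projection of w onto the closure, so w - u is orthogonal to every
    test function.\<close>
  have "\<exists>u\<in>W. \<forall>v\<in>W. l2_inner u v = l2_inner w v"
  proof (rule riesz_representation[where C = "(l2_inner w w + 1)\<^sup>2"])
    show "bump 0 1 0 \<in> W" using sub bump_C2 by auto
    show "(l2_inner w v)\<^sup>2 \<le> (l2_inner w w + 1)\<^sup>2 * l2_inner v v" if "v \<in> W" for v
      using that WL2 w by (auto intro: l2_inner_bound)
    show "l2_inner w (\<lambda>x. u x + c * v x) = l2_inner w u + c * l2_inner w v"
      if "u \<in> W" "v \<in> W" for u v c
      using l2_inner_lin[of u v w c] that WL2 w by (auto simp: l2_inner_sym[of w])
    show "l2_inner u v = l2_inner v u" for u v by (rule l2_inner_sym)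
    fix U assume U: "\<And>n. U n \<in> W"
      and "\<And>n m. n \<le> m \<Longrightarrow> l2_inner (\<lambda>x. U m x - U n x) (\<lambda>x. U m x - U n x) \<le> (1/4) ^ n"
    then have c: "\<And>n m. n \<le> m \<Longrightarrow> (LINT x|lborel. (U m x - U n x)\<^sup>2) \<le> (1/4) ^ n"
      by (simp add: l2_inner_diff_square)
    have UL: "U n \<in> L2" for n using U WL2 by auto
    obtain u where u: "u \<in> borel_measurable borel" "AE x in lborel. (\<lambda>n. U n x) \<longlonglongrightarrow> u x"
      using L2_fast_Cauchy_AE_convergent[OF UL c] by auto
    have f: "u \<in> L2" "(LINT x|lborel. (u x - U n x)\<^sup>2) \<le> (1/4) ^ n" for n
      using integral_square_fatou[OF UL[unfolded L2_iff] _ u(2), of n "(1/4) ^ n"] u(1) c by (auto simp: L2_iff)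
    have p: "(\<lambda>n. (1/4) ^ n :: real) \<longlonglongrightarrow> 0" by (intro LIMSEQ_power_zero) auto
    show "\<exists>u\<in>W. (\<lambda>n. l2_inner (\<lambda>x. U n x - u x) (\<lambda>x. U n x - u x)) \<longlonglongrightarrow> 0"
    proof (intro bexI)
      show "(\<lambda>n. l2_inner (\<lambda>x. U n x - u x) (\<lambda>x. U n x - u x)) \<longlonglongrightarrow> 0"
        unfolding l2_inner_diff_square
        by (rule tendsto_sandwich[OF _ _ tendsto_const p])
          (use f(2) in \<open>auto simp: power2_commute[of "U _ _"]\<close>)
      show "u \<in> W" unfolding W_def
      proof (intro CollectI conjI allI impI f)
        fix e :: real assume e: "e > 0"
        obtain n where n: "(1/4) ^ n < e / 4"
          using order_tendstoD(2)[OF p, of "e / 4"] e by (auto simp: eventually_sequentially)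
        have "e / 4 > 0" using e by simp
        then obtain v where v: "v \<in> C2_compact" "(LINT x|lborel. (U n x - v x)\<^sup>2) < e / 4"
          using U[of n] unfolding W_def by blast
        have "(LINT x|lborel. (u x - v x)\<^sup>2) < e"
          using tri[OF f(1) UL C2_compact_L2[OF v(1)], of n] f(2)[of n] n v(2) by linarith
        then show "\<exists>v\<in>C2_compact. (LINT x|lborel. (u x - v x)\<^sup>2) < e" using v(1) by blast
      qed
    qed
  qed (use WL2 lin in \<open>auto simp: l2_inner_nonneg l2_inner_lin subset_iff\<close>)
  then obtain u where u: "u \<in> W" "\<And>v. v \<in> W \<Longrightarrow> l2_inner u v = l2_inner w v" by blast
  have uL: "u \<in> L2" using u WL2 by auto
  have "AE x in lborel. w x - u x = 0"
  proof (rule orthogonal_C2_compact_AE_zero[OF L2_sub[OF w uL]])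
    fix \<phi> assume "\<phi> \<in> C2_compact"
    then show "l2_inner (\<lambda>x. w x - u x) \<phi> = 0"
      using u(2)[of \<phi>] sub l2_inner_sub[OF w uL C2_compact_L2] by auto
  qed
  then have ae: "AE x in lborel. u x = w x" by eventually_elim simp
  obtain v where v: "v \<in> C2_compact" "(LINT x|lborel. (u x - v x)\<^sup>2) < e"
    using u(1) e by (auto simp: W_def)
  have "(LINT x|lborel. (u x - v x)\<^sup>2) = (LINT x|lborel. (w x - v x)\<^sup>2)"
  proof (rule integral_cong_AE)
    show "AE x in lborel. (u x - v x)\<^sup>2 = (w x - v x)\<^sup>2" using ae by eventually_elim simp
  qed (use L2_measurable uL w C2_compact_L2[OF v(1)] in auto)
  then show ?thesis using v by auto
qed

subsection \<open>The bond form\<close>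

text \<open>Here \<open>\<kappa>\<close> is \<open>scaled_kernel \<gamma> \<delta>2\<close> on positive reals and 0 elsewhere.  Index 0 belongs to the bonds
  of length \<open>M * r\<close> with left end point \<open>a \<le> 0\<close>, and index \<open>j + 1\<close> to the \<open>j\<close>-th of the \<open>M\<close> sub-bonds of
  a bond in the right half line; such a sub-bond has length \<open>r\<close> and left end point \<open>a > j * r\<close>.\<close>

locale qnl_kernel =
  fixes \<kappa> :: "real \<Rightarrow> real" and M :: nat and \<delta> :: real
  assumes kernel_measurable[measurable]: "\<kappa> \<in> borel_measurable borel"
    and kernel_nonneg: "\<kappa> r \<ge> 0"
    and kernel_left: "r \<le> 0 \<Longrightarrow> \<kappa> r = 0"
    and kernel_right: "r \<ge> \<delta> \<Longrightarrow> \<kappa> r = 0"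
    and kernel_moment: "integrable lborel (\<lambda>r. r\<^sup>2 * \<kappa> r)"
    and M_pos: "M \<ge> 1"
begin

text \<open>The substitution y - x = M r has Jacobian M, and the kernel of range \<delta>1 at M r is
  \<kappa> r / M^3; this leaves 1/M^2 for a long bond. For a sub-bond the energy density has the
  further factor M^2 / M, which gives 1/M.\<close>

definition coef :: "nat \<Rightarrow> real" where "coef i = (if i = 0 then 1 / (real M)\<^sup>2 else 1 / real M)"

definition stretch :: "nat \<Rightarrow> real" where "stretch i = (if i = 0 then real M else 1)"

text \<open>A bond touches the left half line exactly if its left end point is at most 0. The j-th
  sub-bond of a bond from x to x + M r with x > 0 starts at a = x + j r, which turns x > 0 into a >
  j r; with i = j + 1 this is the offset i - 1.\<close>

definition mask :: "nat \<Rightarrow> real \<Rightarrow> real \<Rightarrow> real" where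
  "mask i r a = (if (if i = 0 then a \<le> 0 else real (i - 1) * r < a) then 1 else 0)"

definition bond_diff :: "(real \<Rightarrow> real) \<Rightarrow> nat \<times> real \<times> real \<Rightarrow> real" where
  "bond_diff u = (\<lambda>(i, r, a). u (a + stretch i * r) - u a)"

definition bond_space :: "(nat \<times> real \<times> real) measure" where
  "bond_space = count_space {..M} \<Otimes>\<^sub>M (lborel \<Otimes>\<^sub>M lborel)"

definition weight :: "nat \<times> real \<times> real \<Rightarrow> real" where
  "weight = (\<lambda>(i, r, a). coef i * \<kappa> r * mask i r a)"

text \<open>With the weights placed in the measure, the gradient of \<open>closed_form\<close> is
  the plain difference \<open>bond_diff\<close>, and the form is the integral of products of
  differences.\<close>

definition bonds :: "(nat \<times> real \<times> real) measure" where
  "bonds = density bond_space (\<lambda>\<omega>. ennreal (weight \<omega>))"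

lemma coef_nonneg: "coef i \<ge> 0" by (simp add: coef_def)

lemma mask_bounds: "0 \<le> mask i r a" "mask i r a \<le> 1" by (auto simp: mask_def)

lemma weight_nonneg: "weight \<omega> \<ge> 0"
  by (cases \<omega>) (auto simp: weight_def intro!: mult_nonneg_nonneg coef_nonneg kernel_nonneg mask_bounds)

lemma mask_measurable[measurable]: "(\<lambda>(r, a). mask i r a) \<in> borel_measurable (lborel \<Otimes>\<^sub>M lborel)"
  unfolding mask_def by (cases "i = 0") simp_all

lemma mask_measurable1[measurable]: "mask i r \<in> borel_measurable borel"
  unfolding mask_def[abs_def] by (cases "i = 0") simp_all

lemma sigma_finite_plane: "sigma_finite_measure (lborel \<Otimes>\<^sub>M lborel :: (real \<times> real) measure)"
  by (rule sigma_finite_pair_measure) (rule lborel.sigma_finite_measure_axioms)+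

sublocale bond_pair: pair_sigma_finite "count_space {..M}" "lborel \<Otimes>\<^sub>M (lborel :: real measure) :: (real \<times> real) measure"
  by (intro pair_sigma_finite.intro sigma_finite_measure_count_space_finite sigma_finite_plane) simp

lemma measurable_bond_space:
  assumes "\<And>i. i \<le> M \<Longrightarrow> (\<lambda>(r, a). F (i, r, a)) \<in> measurable (lborel \<Otimes>\<^sub>M lborel) N"
  shows "F \<in> measurable bond_space N"
  unfolding bond_space_def
proof (rule measurable_pair_measure_countable1)
  show "(\<lambda>y. F (i, y)) \<in> measurable (lborel \<Otimes>\<^sub>M lborel) N" if "i \<in> {..M}" for i
    using assms[of i] that by (simp add: case_prod_unfold)
qed simp

lemma weight_measurable[measurable]: "weight \<in> borel_measurable bond_space"
proof (rule measurable_bond_space)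
  fix i
  show "(\<lambda>(r, a). weight (i, r, a)) \<in> borel_measurable (lborel \<Otimes>\<^sub>M lborel)"
    unfolding weight_def using mask_measurable[of i] by simp
qed

lemma bond_diff_measurable[measurable]:
  "u \<in> borel_measurable borel \<Longrightarrow> bond_diff u \<in> borel_measurable bond_space"
  by (rule measurable_bond_space) (simp add: bond_diff_def)

lemma sets_bonds[simp, measurable_cong]: "sets bonds = sets bond_space"
  by (simp add: bonds_def)

lemma AE_shift:
  assumes N: "N \<in> null_sets lborel"
  shows "AE a in lborel. a + t \<notin> (N :: real set)"
proof -
  have [measurable]: "N \<in> sets borel" using N by auto
  have "AE a in lborel. a \<notin> N" using N by (rule AE_not_in)
  then have "AE a in lborel. t + 1 * a \<notin> N" by (intro AE_borel_affine) auto
  then show ?thesis by (simp add: add.commute)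
qed

sublocale closed_form bonds bond_diff
proof
  show "bond_diff u \<in> borel_measurable bonds" if "u \<in> borel_measurable borel" for u
    using that by measurable
  show "bond_diff (\<lambda>x. u x + c * v x) \<omega> = bond_diff u \<omega> + c * bond_diff v \<omega>" for u v c \<omega>
    by (cases \<omega>) (simp add: bond_diff_def algebra_simps)
  fix U and u :: "real \<Rightarrow> real"
  assume "AE x in lborel. (\<lambda>n. U n x) \<longlonglongrightarrow> u x"
  then obtain N where N: "{x. \<not> (\<lambda>n. U n x) \<longlonglongrightarrow> u x} \<subseteq> N" "N \<in> null_sets lborel"
    by (auto elim!: AE_E simp: null_sets_def)
  then have [measurable]: "N \<in> sets borel" by auto
  \<comment> \<open>Convergence of a difference can fail only if an end point of the bond lies in N.
    For fixed r this happens for a null set of a, by translation invariance, and Fubini extends this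
    to the plane.\<close>
  have inner: "AE p in lborel \<Otimes>\<^sub>M lborel. snd p \<notin> N \<and> snd p + stretch i * fst p \<notin> N" for i
  proof (rule lborel_pair.AE_pair_measure)
    show "AE r in lborel. AE a in lborel. snd (r, a) \<notin> N \<and> snd (r, a) + stretch i * fst (r, a) \<notin> N"
      using AE_not_in[OF N(2)] AE_shift[OF N(2)] by simp
  qed (intro predE, measurable)
  have "AE \<omega> in bond_space. snd (snd \<omega>) \<notin> N \<and> snd (snd \<omega>) + stretch (fst \<omega>) * fst (snd \<omega>) \<notin> N"
    unfolding bond_space_def
  proof (rule bond_pair.AE_pair_measure)
    have "Measurable.pred bond_space (\<lambda>\<omega>. snd (snd \<omega>) \<notin> N \<and> snd (snd \<omega>) + stretch (fst \<omega>) * fst (snd \<omega>) \<notin> N)"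
      by (rule measurable_bond_space) (simp add: case_prod_unfold)
    then show "{\<omega> \<in> space (count_space {..M} \<Otimes>\<^sub>M (lborel \<Otimes>\<^sub>M lborel)).
        snd (snd \<omega>) \<notin> N \<and> snd (snd \<omega>) + stretch (fst \<omega>) * fst (snd \<omega>) \<notin> N}
      \<in> sets (count_space {..M} \<Otimes>\<^sub>M (lborel \<Otimes>\<^sub>M lborel))"
      unfolding bond_space_def by simp
  qed (use inner in \<open>simp add: AE_count_space\<close>)
  then have "AE \<omega> in bond_space. (\<lambda>n. bond_diff (U n) \<omega>) \<longlonglongrightarrow> bond_diff u \<omega>"
  proof eventually_elim
    case (elim \<omega>)
    obtain i r a where \<omega>: "\<omega> = (i, r, a)" by (cases \<omega>) auto
    have "(\<lambda>n. U n a) \<longlonglongrightarrow> u a" "(\<lambda>n. U n (a + stretch i * r)) \<longlonglongrightarrow> u (a + stretch i * r)"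
      using elim N(1) by (auto simp: \<omega>)
    then show ?case by (auto simp: bond_diff_def \<omega> intro: tendsto_diff)
  qed
  then show "AE \<omega> in bonds. (\<lambda>n. bond_diff (U n) \<omega>) \<longlonglongrightarrow> bond_diff u \<omega>"
    unfolding bonds_def by (subst AE_density) (auto elim: eventually_mono)
qed

lemma nn_integral_bonds:
  assumes F[measurable]: "F \<in> borel_measurable bond_space"
  shows "(\<integral>\<^sup>+ \<omega>. F \<omega> \<partial>bonds)
     = (\<Sum>i\<le>M. \<integral>\<^sup>+ r. \<integral>\<^sup>+ a. ennreal (coef i * \<kappa> r * mask i r a) * F (i, r, a) \<partial>lborel \<partial>lborel)"
proof -
  have "(\<integral>\<^sup>+ \<omega>. F \<omega> \<partial>bonds) = (\<integral>\<^sup>+ \<omega>. ennreal (weight \<omega>) * F \<omega> \<partial>bond_space)"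
    unfolding bonds_def by (rule nn_integral_density) auto
  also have "\<dots> = (\<integral>\<^sup>+ i. \<integral>\<^sup>+ p. ennreal (weight (i, p)) * F (i, p) \<partial>(lborel \<Otimes>\<^sub>M lborel) \<partial>count_space {..M})"
    unfolding bond_space_def
    by (subst sigma_finite_measure.nn_integral_fst[OF sigma_finite_plane]) (auto simp flip: bond_space_def)
  also have "\<dots> = (\<Sum>i\<le>M. \<integral>\<^sup>+ p. ennreal (weight (i, p)) * F (i, p) \<partial>(lborel \<Otimes>\<^sub>M lborel))"
    by (rule nn_integral_count_space_finite) simp
  also have "\<dots> = (\<Sum>i\<le>M. \<integral>\<^sup>+ r. \<integral>\<^sup>+ a. ennreal (weight (i, r, a)) * F (i, r, a) \<partial>lborel \<partial>lborel)"
  proof (rule sum.cong[OF refl])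
    fix i assume i: "i \<in> {..M}"
    have "(\<lambda>\<omega>. ennreal (weight \<omega>) * F \<omega>) \<in> borel_measurable bond_space" by measurable
    then have "(\<lambda>p. ennreal (weight (i, p)) * F (i, p)) \<in> borel_measurable (lborel \<Otimes>\<^sub>M lborel)"
      unfolding bond_space_def using i by (rule_tac measurable_compose[OF measurable_Pair1']) auto
    then show "(\<integral>\<^sup>+ p. ennreal (weight (i, p)) * F (i, p) \<partial>(lborel \<Otimes>\<^sub>M lborel))
       = (\<integral>\<^sup>+ r. \<integral>\<^sup>+ a. ennreal (weight (i, r, a)) * F (i, r, a) \<partial>lborel \<partial>lborel)"
      by (subst lborel.nn_integral_fst) auto
  qed
  finally show ?thesis by (simp add: weight_def)
qed

text \<open>The sum over i stays inside the integral over r, the order in which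
  \<open>range_by_parts\<close> collects it into \<open>range_op\<close>.\<close>

lemma integral_bonds:
  assumes F: "integrable bonds F"
  shows "(LINT \<omega>|bonds. F \<omega>)
     = (LINT r|lborel. (\<Sum>i\<le>M. (LINT a|lborel. coef i * \<kappa> r * mask i r a * F (i, r, a))))"
proof -
  have [measurable]: "F \<in> borel_measurable bond_space" using F by auto
  have int: "integrable bond_space (\<lambda>\<omega>. weight \<omega> * F \<omega>)"
    using F unfolding bonds_def by (subst (asm) integrable_density) (auto simp: weight_nonneg)
  have "(LINT \<omega>|bonds. F \<omega>) = (LINT \<omega>|bond_space. weight \<omega> * F \<omega>)"
    unfolding bonds_def by (subst integral_density) (auto simp: weight_nonneg)
  also have "\<dots> = (LINT i|count_space {..M}. LINT p|(lborel \<Otimes>\<^sub>M lborel). weight (i, p) * F (i, p))"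
    using bond_pair.integral_fst'[OF int[unfolded bond_space_def]] by (simp add: bond_space_def)
  also have "\<dots> = (\<Sum>i\<le>M. (LINT p|(lborel \<Otimes>\<^sub>M lborel). weight (i, p) * F (i, p)))"
    by (rule lebesgue_integral_count_space_finite) simp
  finally have 1: "(LINT \<omega>|bonds. F \<omega>) = (\<Sum>i\<le>M. (LINT p|(lborel \<Otimes>\<^sub>M lborel). weight (i, p) * F (i, p)))" .
  have "integrable (lborel \<Otimes>\<^sub>M lborel) (\<lambda>p. weight (i, p) * F (i, p))" if "i \<le> M" for i
    using bond_pair.AE_integrable_fst'[OF int[unfolded bond_space_def]] that by (simp add: AE_count_space)
  note 2 = lborel_pair.integral_fst'[OF this] lborel_pair.integrable_fst'[OF this]
  have "(LINT \<omega>|bonds. F \<omega>) = (\<Sum>i\<le>M. (LINT r|lborel. LINT a|lborel. weight (i, r, a) * F (i, r, a)))"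
    unfolding 1 using 2(1) by (intro sum.cong) auto
  also have "\<dots> = (LINT r|lborel. (\<Sum>i\<le>M. (LINT a|lborel. weight (i, r, a) * F (i, r, a))))"
    using 2(2) by (subst Bochner_Integration.integral_sum) auto
  finally show ?thesis by (simp add: weight_def)
qed

text \<open>Negative first variation of the bonds of index i at the point x, which occurs once as a
  left end point and once as a right end point; in the latter case the mask is taken at x -
  \<open>stretch i * r\<close>.\<close>

definition bond_op :: "nat \<Rightarrow> real \<Rightarrow> (real \<Rightarrow> real) \<Rightarrow> real \<Rightarrow> real" where
  "bond_op i r u x = mask i r x * (u (x + stretch i * r) - u x)
     + mask i r (x - stretch i * r) * (u (x - stretch i * r) - u x)"

text \<open>The combination of translations called \<open>L r\<close> in the overview.\<close>

definition range_op :: "real \<Rightarrow> (real \<Rightarrow> real) \<Rightarrow> real \<Rightarrow> real" where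
  "range_op r u x = (\<Sum>i\<le>M. coef i * bond_op i r u x)"

definition qnl_op :: "(real \<Rightarrow> real) \<Rightarrow> real \<Rightarrow> real" where
  "qnl_op u x = (LINT r|lborel. \<kappa> r * range_op r u x)"

lemma range_op_measurable[measurable]:
  assumes [measurable]: "u \<in> borel_measurable borel"
  shows "(\<lambda>(r, x). range_op r u x) \<in> borel_measurable (lborel \<Otimes>\<^sub>M lborel)"
proof -
  have "(\<lambda>(r, x). mask i r (x - stretch i * r)) \<in> borel_measurable (lborel \<Otimes>\<^sub>M lborel)" for i
    using measurable_compose[OF _ mask_measurable[of i], of "\<lambda>(r, x). (r, x - stretch i * r)" "lborel \<Otimes>\<^sub>M lborel"]
    by (simp add: case_prod_unfold)
  then have [measurable]: "(\<lambda>p. mask i (fst p) (snd p - stretch i * fst p)) \<in> borel_measurable (lborel \<Otimes>\<^sub>M lborel)" for i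
    by (simp add: case_prod_unfold)
  have [measurable]: "(\<lambda>p. mask i (fst p) (snd p)) \<in> borel_measurable (lborel \<Otimes>\<^sub>M lborel)" for i
    using mask_measurable[of i] by (simp add: case_prod_unfold)
  show ?thesis unfolding range_op_def bond_op_def case_prod_unfold by measurable
qed

lemma range_op_measurable2[measurable]:
  assumes [measurable]: "u \<in> borel_measurable borel"
  shows "range_op r u \<in> borel_measurable borel"
  unfolding range_op_def[abs_def] bond_op_def by measurable

lemma qnl_op_measurable:
  assumes [measurable]: "u \<in> borel_measurable borel"
  shows "qnl_op u \<in> borel_measurable borel"
proof -
  have "(\<lambda>x. LINT r|lborel. \<kappa> r * range_op r u x) \<in> borel_measurable lborel"
  proof (rule lborel.borel_measurable_lebesgue_integral)
    have "(\<lambda>(r, x). \<kappa> r * range_op r u x) \<in> borel_measurable (lborel \<Otimes>\<^sub>M lborel)"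
      using range_op_measurable[OF assms] by (simp add: case_prod_unfold)
    from measurable_pair_swap[OF this]
    show "(\<lambda>(x, r). \<kappa> r * range_op r u x) \<in> borel_measurable (lborel \<Otimes>\<^sub>M lborel)"
      by (simp add: case_prod_unfold)
  qed
  then show ?thesis by (simp add: qnl_op_def[abs_def])
qed

lemma L2_shift: "u \<in> L2 \<Longrightarrow> (\<lambda>x. u (x + t)) \<in> L2"
  using lborel_integrable_real_affine[of "\<lambda>x. (u x)\<^sup>2" 1 t]
  by (auto simp: L2_def add.commute)

lemma L2_mask:
  assumes "u \<in> L2" shows "(\<lambda>x. mask i r (x + t) * u x) \<in> L2"
  unfolding L2_iff
proof (rule square_integrable_dominated)
  show "square_integrable lborel u" using assms by (simp add: L2_iff)
  show "AE x in lborel. \<bar>mask i r (x + t) * u x\<bar> \<le> \<bar>u x\<bar>"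
    using mask_bounds by (auto simp: abs_mult mult_left_le_one_le)
  show "(\<lambda>x. mask i r (x + t) * u x) \<in> borel_measurable lborel"
    using L2_measurable[OF assms] by measurable
qed

lemma L2_cmult: "u \<in> L2 \<Longrightarrow> (\<lambda>x. c * u x) \<in> L2"
  using L2_lin[OF L2_zero, of u c] by simp

lemma L2_add: "u \<in> L2 \<Longrightarrow> v \<in> L2 \<Longrightarrow> (\<lambda>x. u x + v x) \<in> L2"
  using L2_lin[of u v 1] by simp

lemma bond_op_L2: "u \<in> L2 \<Longrightarrow> bond_op i r u \<in> L2"
  unfolding bond_op_def[abs_def]
  using L2_mask[OF L2_sub[OF L2_shift[of u "stretch i * r"], of u], of i r 0]
    L2_mask[OF L2_sub[OF L2_shift[of u "- stretch i * r"], of u], of i r "- stretch i * r"]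
  by (intro L2_add) auto

text \<open>Translation moves the factor at the right end point a + h back to x, leaving g (x - h) -
  g x against v. At fixed r every product is integrable because u and v are in
  \<open>L2\<close>.\<close>

lemma bond_by_parts:
  assumes u: "u \<in> L2" and v: "v \<in> L2"
  shows "(LINT a|lborel. mask i r a * ((u (a + stretch i * r) - u a) * (v (a + stretch i * r) - v a)))
       = - (LINT x|lborel. bond_op i r u x * v x)"
proof -
  define h where "h = stretch i * r"
  define g where "g a = mask i r a * (u (a + h) - u a)" for a
  have g: "g \<in> L2" unfolding g_def[abs_def]
    using L2_mask[OF L2_sub[OF L2_shift[OF u, of h] u], of i r 0] by simp
  have int: "integrable lborel (\<lambda>a. g a * v (a + h))" "integrable lborel (\<lambda>a. g a * v a)"
     "integrable lborel (\<lambda>x. g (x - h) * v x)"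
    using L2_mult[OF g L2_shift[OF v, of h]] L2_mult[OF g v] L2_mult[OF L2_shift[OF g, of "-h"] v]
    by auto
  have "(LINT a|lborel. mask i r a * ((u (a + h) - u a) * (v (a + h) - v a)))
      = (LINT a|lborel. g a * v (a + h) - g a * v a)"
    by (simp add: g_def algebra_simps)
  also have "\<dots> = (LINT a|lborel. g a * v (a + h)) - (LINT a|lborel. g a * v a)"
    using int by simp
  also have "(LINT a|lborel. g a * v (a + h)) = (LINT x|lborel. g (x - h) * v x)"
    using lborel_integral_real_affine[of 1 "\<lambda>a. g a * v (a + h)" "- h"] by simp
  also have "(LINT x|lborel. g (x - h) * v x) - (LINT a|lborel. g a * v a)
     = - (LINT x|lborel. g x * v x - g (x - h) * v x)" using int by simp
  also have "(\<lambda>x. g x * v x - g (x - h) * v x) = (\<lambda>x. bond_op i r u x * v x)"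
    by (auto simp: g_def bond_op_def h_def algebra_simps)
  finally show ?thesis by (simp add: h_def)
qed

lemma range_by_parts:
  assumes u: "u \<in> L2" and v: "v \<in> L2"
  shows "(\<Sum>i\<le>M. (LINT a|lborel. coef i * \<kappa> r * mask i r a * (bond_diff u (i, r, a) * bond_diff v (i, r, a))))
       = - (LINT x|lborel. \<kappa> r * range_op r u x * v x)"
proof -
  have "(\<Sum>i\<le>M. (LINT a|lborel. coef i * \<kappa> r * mask i r a * (bond_diff u (i, r, a) * bond_diff v (i, r, a))))
      = (\<Sum>i\<le>M. coef i * \<kappa> r * - (LINT x|lborel. bond_op i r u x * v x))"
    unfolding bond_by_parts[OF u v, symmetric]
    by (intro sum.cong refl) (simp add: bond_diff_def mult.assoc flip: integral_mult_right_zero)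
  also have "\<dots> = - (LINT x|lborel. (\<Sum>i\<le>M. coef i * \<kappa> r * (bond_op i r u x * v x)))"
    using L2_mult[OF bond_op_L2[OF u] v]
    by (subst Bochner_Integration.integral_sum) (auto simp: sum_negf)
  also have "(\<lambda>x. \<Sum>i\<le>M. coef i * \<kappa> r * (bond_op i r u x * v x)) = (\<lambda>x. \<kappa> r * range_op r u x * v x)"
    by (simp add: range_op_def sum_distrib_left sum_distrib_right mult_ac)
  finally show ?thesis .
qed

text \<open>A common criterion for smooth functions and for integrable kernels. The joint
  integrability in \<open>int\<close> is what Fubini needs for exchanging r and x; taken with v = u,
  it also yields finiteness of the energy.\<close>

lemma qnl_op_in_graph:
  assumes u: "u \<in> L2" and Lu: "qnl_op u \<in> L2"
    and int: "\<And>v. v \<in> L2 \<Longrightarrow> integrable (lborel \<Otimes>\<^sub>M lborel) (\<lambda>(r, x). \<kappa> r * range_op r u x * v x)"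
  shows "(u, qnl_op u) \<in> op_graph"
proof -
  have [measurable]: "u \<in> borel_measurable borel" using u L2_measurable by blast
  have dom: "u \<in> form_dom"
  proof -
    \<comment> \<open>The energy stored at bond length r. Its terms are nonnegative, and summation
      by parts with v = u shows that it is integrable in r, so u lies in the form domain.\<close>
    define e where "e r = (\<Sum>i\<le>M. (LINT a|lborel. coef i * \<kappa> r * mask i r a * (bond_diff u (i, r, a))\<^sup>2))" for r
    have e_eq: "e = (\<lambda>r. - (LINT x|lborel. \<kappa> r * range_op r u x * u x))"
      unfolding e_def power2_eq_square using range_by_parts[OF u u] by auto
    have e_int: "integrable lborel e"
      unfolding e_eq using lborel_pair.integrable_fst[OF int[OF u]] by simp
    have sq: "integrable lborel (\<lambda>a. coef i * \<kappa> r * mask i r a * (bond_diff u (i, r, a))\<^sup>2)" for i r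
    proof -
      have "(\<lambda>a. u (a + stretch i * r) - u a) \<in> L2" by (intro L2_sub L2_shift u)
      from L2_mult[OF L2_mask[OF this, of i r 0] this] show ?thesis
        by (simp add: bond_diff_def power2_eq_square mult.assoc)
    qed
    have "(\<integral>\<^sup>+ \<omega>. ennreal ((bond_diff u \<omega>)\<^sup>2) \<partial>bonds)
      = (\<Sum>i\<le>M. \<integral>\<^sup>+ r. \<integral>\<^sup>+ a. ennreal (coef i * \<kappa> r * mask i r a) * ennreal ((bond_diff u (i, r, a))\<^sup>2) \<partial>lborel \<partial>lborel)"
      by (rule nn_integral_bonds) measurable
    also have "\<dots> = (\<Sum>i\<le>M. \<integral>\<^sup>+ r. ennreal (LINT a|lborel. coef i * \<kappa> r * mask i r a * (bond_diff u (i, r, a))\<^sup>2) \<partial>lborel)"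
    proof (intro sum.cong refl nn_integral_cong)
      fix i r
      have "(\<integral>\<^sup>+ a. ennreal (coef i * \<kappa> r * mask i r a) * ennreal ((bond_diff u (i, r, a))\<^sup>2) \<partial>lborel)
        = (\<integral>\<^sup>+ a. ennreal (coef i * \<kappa> r * mask i r a * (bond_diff u (i, r, a))\<^sup>2) \<partial>lborel)"
        by (intro nn_integral_cong)
          (simp add: ennreal_mult' coef_nonneg kernel_nonneg mask_bounds)
      also have "\<dots> = ennreal (LINT a|lborel. coef i * \<kappa> r * mask i r a * (bond_diff u (i, r, a))\<^sup>2)"
        using sq by (intro nn_integral_eq_integral) (auto simp: coef_nonneg kernel_nonneg mask_bounds)
      finally show "(\<integral>\<^sup>+ a. ennreal (coef i * \<kappa> r * mask i r a) * ennreal ((bond_diff u (i, r, a))\<^sup>2) \<partial>lborel)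
        = ennreal (LINT a|lborel. coef i * \<kappa> r * mask i r a * (bond_diff u (i, r, a))\<^sup>2)" .
    qed
    also have "\<dots> = (\<integral>\<^sup>+ r. ennreal (e r) \<partial>lborel)"
    proof (subst nn_integral_sum[symmetric])
      show "(\<lambda>r. ennreal (LINT a|lborel. coef i * \<kappa> r * mask i r a * (bond_diff u (i, r, a))\<^sup>2)) \<in> borel_measurable lborel" for i
      proof -
        have "(\<lambda>(r, a). coef i * \<kappa> r * mask i r a * (bond_diff u (i, r, a))\<^sup>2) \<in> borel_measurable (lborel \<Otimes>\<^sub>M lborel)"
          using mask_measurable[of i] unfolding bond_diff_def by (simp add: case_prod_unfold)
        then show ?thesis by (intro measurable_compose[OF lborel.borel_measurable_lebesgue_integral measurable_ennreal])
      qed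
      show "(\<integral>\<^sup>+ r. (\<Sum>i\<le>M. ennreal (LINT a|lborel. coef i * \<kappa> r * mask i r a * (bond_diff u (i, r, a))\<^sup>2)) \<partial>lborel)
        = (\<integral>\<^sup>+ r. ennreal (e r) \<partial>lborel)"
        unfolding e_def by (intro nn_integral_cong sum_ennreal integral_nonneg)
          (auto simp: coef_nonneg kernel_nonneg mask_bounds)
    qed
    also have "\<dots> < \<infinity>"
      using e_int unfolding real_integrable_def by (auto simp: less_top)
    finally show ?thesis
      using u D_measurable[of u] by (simp add: form_dom_def square_integrable_nn_integral)
  qed
  have "form u v = - l2_inner (qnl_op u) v" if v: "v \<in> form_dom" for v
  proof -
    have vL: "v \<in> L2" using v form_domD by blast
    have "form u v = (LINT r|lborel. - (LINT x|lborel. \<kappa> r * range_op r u x * v x))"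
      unfolding form_def range_by_parts[OF u vL, symmetric]
      by (rule integral_bonds) (intro square_integrable_mult form_domD dom v)
    also have "\<dots> = - (LINT r|lborel. LINT x|lborel. \<kappa> r * range_op r u x * v x)" by simp
    also have "\<dots> = - (LINT x|lborel. LINT r|lborel. \<kappa> r * range_op r u x * v x)"
      using lborel_pair.Fubini_integral[OF int[OF vL]] by simp
    also have "\<dots> = - l2_inner (qnl_op u) v" by (simp add: l2_inner_def qnl_op_def)
    finally show ?thesis .
  qed
  then show ?thesis using dom Lu by (simp add: op_graph_def)
qed

end

subsection \<open>Pointwise action of the operator\<close>

lemma integrable_pair_mult:
  fixes f g :: "real \<Rightarrow> real"
  assumes f: "integrable lborel f" and g: "integrable lborel g"
  shows "integrable (lborel \<Otimes>\<^sub>M lborel) (\<lambda>(x, y). f x * g y)"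
proof (rule lborel_pair.Fubini_integrable)
  have [measurable]: "f \<in> borel_measurable borel" "g \<in> borel_measurable borel" using assms by auto
  show "(\<lambda>(x, y). f x * g y) \<in> borel_measurable (lborel \<Otimes>\<^sub>M lborel)" by measurable
  show "integrable lborel (\<lambda>x. LINT y|lborel. norm (case (x, y) of (x, y) \<Rightarrow> f x * g y))"
    using f by (simp add: abs_mult)
  show "AE x in lborel. integrable lborel (\<lambda>y. case (x, y) of (x, y) \<Rightarrow> f x * g y)"
    using g by simp
qed

text \<open>K is uniform in x because the continuous second derivative vanishes wherever
  \<bar>x\<bar> > R, hence is bounded on the whole line.\<close>

lemma C2_compact_taylor:
  assumes "u \<in> C2_compact"
  obtains u' K where "K \<ge> 0" "\<And>x d. \<bar>u (x + d) - u x - d * u' x\<bar> \<le> K * d\<^sup>2"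
proof -
  obtain u' u'' R where u: "\<And>x. (u has_real_derivative u' x) (at x)"
    "\<And>x. (u' has_real_derivative u'' x) (at x)" "continuous_on UNIV u''" "\<And>x. \<bar>x\<bar> > R \<Longrightarrow> u x = 0"
    using C2_compactE[OF assms] by metis
  have far_open: "open {x::real. \<bar>x\<bar> > R}" by (intro open_Collect_less continuous_intros)
  have u'0: "u' x = 0" if "\<bar>x\<bar> > R" for x
  proof -
    have "((\<lambda>x. 0) has_real_derivative u' x) (at x)"
      by (rule has_field_derivative_transform_within_open[OF u(1) far_open]) (use that u(4) in auto)
    then show ?thesis by (rule DERIV_unique) simp
  qed
  have u''0: "u'' x = 0" if "\<bar>x\<bar> > R" for x
  proof -
    have "((\<lambda>x. 0) has_real_derivative u'' x) (at x)"
      by (rule has_field_derivative_transform_within_open[OF u(2) far_open]) (use that u'0 in auto)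
    then show ?thesis by (rule DERIV_unique) simp
  qed
  have "compact (u'' ` {-R..R})"
    by (intro compact_continuous_image continuous_on_subset[OF u(3)]) auto
  then obtain B where "\<forall>y\<in>u'' ` {-R..R}. norm y \<le> B"
    using compact_imp_bounded bounded_iff by blast
  then have B: "\<And>x. x \<in> {-R..R} \<Longrightarrow> \<bar>u'' x\<bar> \<le> B" by simp
  define K where "K = max B 0"
  have K: "\<bar>u'' x\<bar> \<le> K" for x
  proof (cases "\<bar>x\<bar> > R")
    case False
    then have "x \<in> {-R..R}" by auto
    from B[OF this] show ?thesis by (simp add: K_def)
  qed (simp add: u''0 K_def)
  have lip: "\<bar>u' y - u' x\<bar> \<le> K * \<bar>y - x\<bar>" for x y
    using field_differentiable_bound[of UNIV u' u'' K y x] u(2) K by auto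
  have "\<bar>u (x + d) - u x - d * u' x\<bar> \<le> K * d\<^sup>2" for x d
  proof -
    \<comment> \<open>Mean value inequality for z to u z - z u' x: its derivative u' z - u' x is at
      most K \<bar>d\<bar> between x and x + d.\<close>
    have "norm ((u (x + d) - (x + d) * u' x) - (u x - x * u' x)) \<le> (K * \<bar>d\<bar>) * norm ((x + d) - x)"
    proof (rule field_differentiable_bound)
      show "convex {min x (x + d)..max x (x + d)}" by (rule convex_real_interval)
      fix z assume z: "z \<in> {min x (x + d)..max x (x + d)}"
      show "((\<lambda>z. u z - z * u' x) has_field_derivative u' z - u' x) (at z within {min x (x + d)..max x (x + d)})"
        by (auto intro!: derivative_eq_intros DERIV_subset[OF u(1)])
      have "\<bar>z - x\<bar> \<le> \<bar>d\<bar>" using z by (auto simp: abs_if min_def max_def split: if_splits)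
      then have "K * \<bar>z - x\<bar> \<le> K * \<bar>d\<bar>" by (intro mult_left_mono) (auto simp: K_def)
      then show "norm (u' z - u' x) \<le> K * \<bar>d\<bar>" using lip[of z x] by simp
    qed auto
    then show ?thesis by (simp add: algebra_simps power2_eq_square)
  qed
  moreover have "K \<ge> 0" by (simp add: K_def)
  ultimately show ?thesis using that by blast
qed

context qnl_kernel
begin

text \<open>The sum over \<open>i\<close> telescopes; this is the consistency of the coupling at the interface.\<close>

lemma range_op_id: "(\<Sum>i\<le>M. coef i * ((mask i r x - mask i r (x - stretch i * r)) * (stretch i * r))) = 0"
proof -
  define s where "s j = (if real j * r < x then 1 else 0 :: real)" for j :: nat
  have "mask (Suc j) r x - mask (Suc j) r (x - r) = s j - s (Suc j)" for j
    by (auto simp: mask_def s_def algebra_simps)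
  then have 1: "(\<Sum>j<M. mask (Suc j) r x - mask (Suc j) r (x - r)) = s 0 - s M"
    by (simp add: sum_lessThan_telescope')
  \<comment> \<open>The masks of the long bonds leave the two ends s 0 and s M of the telescoping
    sum with opposite sign, and \<open>coef i * stretch i\<close> is 1/M for every i, so the
    contributions cancel.\<close>
  have 2: "mask 0 r x - mask 0 r (x - real M * r) = s M - s 0"
    by (auto simp: mask_def s_def)
  have "(\<Sum>i\<le>M. coef i * ((mask i r x - mask i r (x - stretch i * r)) * (stretch i * r)))
     = 1 / (real M)\<^sup>2 * ((mask 0 r x - mask 0 r (x - real M * r)) * (real M * r))
       + (\<Sum>j<M. 1 / real M * ((mask (Suc j) r x - mask (Suc j) r (x - r)) * r))"
    by (subst sum.atMost_shift) (simp add: coef_def stretch_def)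
  also have "(\<Sum>j<M. 1 / real M * ((mask (Suc j) r x - mask (Suc j) r (x - r)) * r))
     = 1 / real M * r * (\<Sum>j<M. mask (Suc j) r x - mask (Suc j) r (x - r))"
    by (simp only: sum_distrib_left mult_ac)
  also have "1 / (real M)\<^sup>2 * ((mask 0 r x - mask 0 r (x - real M * r)) * (real M * r)) + \<dots> = 0"
    unfolding 1 2 using M_pos by (simp add: field_simps power2_eq_square)
  finally show ?thesis .
qed

lemma range_op_affine: "range_op r (\<lambda>z. F * z + u0) x = 0"
proof -
  have "bond_op i r (\<lambda>z. F * z + u0) x = F * ((mask i r x - mask i r (x - stretch i * r)) * (stretch i * r))" for i
    by (simp add: bond_op_def algebra_simps)
  then have "range_op r (\<lambda>z. F * z + u0) x
     = F * (\<Sum>i\<le>M. coef i * ((mask i r x - mask i r (x - stretch i * r)) * (stretch i * r)))"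
    by (simp add: range_op_def sum_distrib_left mult_ac)
  then show ?thesis by (simp add: range_op_id)
qed

lemma range_op_C2_bound:
  assumes "u \<in> C2_compact"
  obtains B where "\<And>r x. \<bar>range_op r u x\<bar> \<le> B * r\<^sup>2"
proof -
  obtain u' K where K: "K \<ge> 0" "\<And>x d. \<bar>u (x + d) - u x - d * u' x\<bar> \<le> K * d\<^sup>2"
    using C2_compact_taylor[OF assms] by metis
  define B where "B = (\<Sum>i\<le>M. coef i * (2 * K * (stretch i)\<^sup>2))"
  have "\<bar>range_op r u x\<bar> \<le> B * r\<^sup>2" for r x
  proof -
    define \<rho> where "\<rho> d = u (x + d) - u x - d * u' x" for d
    define R where "R i = mask i r x * \<rho> (stretch i * r) + mask i r (x - stretch i * r) * \<rho> (- (stretch i * r))" for i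
    have R: "\<bar>R i\<bar> \<le> 2 * K * (stretch i)\<^sup>2 * r\<^sup>2" for i
    proof -
      have b: "\<bar>mask i r y * \<rho> d\<bar> \<le> K * d\<^sup>2" for y d
      proof -
        have "\<bar>mask i r y * \<rho> d\<bar> \<le> \<bar>\<rho> d\<bar>" by (simp add: abs_mult mult_left_le_one_le mask_bounds)
        then show ?thesis using K(2)[of x d] by (simp add: \<rho>_def)
      qed
      have "\<bar>R i\<bar> \<le> K * (stretch i * r)\<^sup>2 + K * (- (stretch i * r))\<^sup>2"
        unfolding R_def by (rule order_trans[OF abs_triangle_ineq add_mono[OF b b]])
      then show ?thesis by (simp add: power_mult_distrib mult_ac)
    qed
    have "bond_op i r u x = u' x * ((mask i r x - mask i r (x - stretch i * r)) * (stretch i * r)) + R i" for i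
      by (simp add: bond_op_def R_def \<rho>_def algebra_simps)
    then have "range_op r u x
      = u' x * (\<Sum>i\<le>M. coef i * ((mask i r x - mask i r (x - stretch i * r)) * (stretch i * r))) + (\<Sum>i\<le>M. coef i * R i)"
      by (simp add: range_op_def sum_distrib_left distrib_left sum.distrib mult_ac)
    then have "\<bar>range_op r u x\<bar> = \<bar>\<Sum>i\<le>M. coef i * R i\<bar>" by (simp add: range_op_id)
    also have "\<dots> \<le> (\<Sum>i\<le>M. coef i * (2 * K * (stretch i)\<^sup>2 * r\<^sup>2))"
      by (rule order_trans[OF sum_abs sum_mono]) (simp add: abs_mult coef_nonneg mult_left_mono R)
    also have "\<dots> = B * r\<^sup>2" unfolding B_def sum_distrib_right by (simp add: mult_ac)
    finally show ?thesis .
  qed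
  then show ?thesis using that by blast
qed

lemma stretch_bounds: "0 \<le> stretch i" "stretch i \<le> real M"
  using M_pos by (auto simp: stretch_def)

lemma range_op_far:
  assumes "\<And>x. \<bar>x\<bar> > R \<Longrightarrow> u x = 0" "0 < r" "r < \<delta>" "\<bar>x\<bar> > R + real M * \<delta>"
  shows "range_op r u x = 0"
proof -
  have "u x = 0 \<and> u (x + stretch i * r) = 0 \<and> u (x - stretch i * r) = 0" for i
  proof -
    have "stretch i * r \<le> real M * \<delta>" "0 \<le> stretch i * r"
      using assms(2,3) stretch_bounds[of i] by (auto intro: mult_mono)
    then show ?thesis using assms(4) by (intro conjI assms(1)) auto
  qed
  then show ?thesis by (simp add: range_op_def bond_op_def)
qed

lemma C2_compact_in_graph:
  assumes u: "u \<in> C2_compact" shows "(u, qnl_op u) \<in> op_graph"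
proof -
  obtain B where B: "\<And>r x. \<bar>range_op r u x\<bar> \<le> B * r\<^sup>2" using range_op_C2_bound[OF u] by blast
  obtain R where R: "\<And>x. \<bar>x\<bar> > R \<Longrightarrow> u x = 0" using u by (elim C2_compactE) blast
  have uL: "u \<in> L2" by (rule C2_compact_L2[OF u])
  have [measurable]: "u \<in> borel_measurable borel" by (rule L2_measurable[OF uL])

  \<comment> \<open>No shift exceeds M \<delta>. The extra 1 makes points outside this open interval
    satisfy the strict inequality in \<open>range_op_far\<close>.\<close>
  define I where "I = {- (R + real M * \<delta> + 1) <..< R + real M * \<delta> + 1}"
  have far: "\<kappa> r * range_op r u x = 0" if "x \<notin> I" for r x
  proof (cases "0 < r \<and> r < \<delta>")
    case True
    moreover have "\<bar>x\<bar> > R + real M * \<delta>" using that by (auto simp: I_def)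
    ultimately show ?thesis using range_op_far[where R = R and u = u and r = r and x = x] R by simp
  next
    case False
    then show ?thesis using kernel_left kernel_right by (metis mult_zero_left not_le)
  qed
  \<comment> \<open>A majorant that separates r from x; it gives both the square integrability of
    \<open>qnl_op u\<close> and, multiplied by \<bar>v x\<bar>, the joint integrability for
    Fubini.\<close>
  have bound: "\<bar>\<kappa> r * range_op r u x\<bar> \<le> B * (r\<^sup>2 * \<kappa> r) * indicator I x" for r x
    using far[of x r] mult_left_mono[OF B[of r x] kernel_nonneg[of r]]
    by (cases "x \<in> I") (auto simp: abs_mult kernel_nonneg mult_ac)
  have int: "integrable lborel (\<lambda>r. B * (r\<^sup>2 * \<kappa> r))" using kernel_moment by simp
  show ?thesis
  proof (rule qnl_op_in_graph[OF uL])
    define C where "C = (LINT r|lborel. B * (r\<^sup>2 * \<kappa> r))"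
    have "\<bar>qnl_op u x\<bar> \<le> \<bar>C * indicator I x\<bar>" for x
    proof -
      have "\<bar>qnl_op u x\<bar> \<le> (LINT r|lborel. B * (r\<^sup>2 * \<kappa> r) * indicator I x)"
        unfolding qnl_op_def
        by (rule order_trans[OF integral_abs_bound integral_mono'])
          (use int bound in \<open>auto intro: order_trans[OF abs_ge_zero]\<close>)
      also have "\<dots> = C * indicator I x" using int by (simp add: C_def)
      finally show ?thesis by simp
    qed
    moreover have "(\<lambda>x. C * indicator I x) \<in> L2"
      unfolding I_def by (intro L2_cmult L2_indicator_interval)
    ultimately show "qnl_op u \<in> L2"
      unfolding L2_iff
      by (rule_tac square_integrable_dominated) (auto intro!: qnl_op_measurable)
    fix v assume v: "v \<in> L2"
    have [measurable]: "v \<in> borel_measurable borel" by (rule L2_measurable[OF v])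
    show "integrable (lborel \<Otimes>\<^sub>M lborel) (\<lambda>(r, x). \<kappa> r * range_op r u x * v x)"
    proof (rule Bochner_Integration.integrable_bound)
      have "indicator I \<in> L2" unfolding I_def by (rule L2_indicator_interval)
      from integrable_pair_mult[OF int integrable_abs[OF L2_mult[OF this v]]]
      show "integrable (lborel \<Otimes>\<^sub>M lborel) (\<lambda>(r, x). B * (r\<^sup>2 * \<kappa> r) * \<bar>indicator I x * v x\<bar>)" .
      show "(\<lambda>(r, x). \<kappa> r * range_op r u x * v x) \<in> borel_measurable (lborel \<Otimes>\<^sub>M lborel)"
        using range_op_measurable[of u] by (simp add: case_prod_unfold)
      have "\<bar>\<kappa> r * range_op r u x * v x\<bar> \<le> \<bar>B * (r\<^sup>2 * \<kappa> r) * \<bar>indicator I x * v x\<bar>\<bar>" for r x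
      proof -
        have "\<bar>\<kappa> r * range_op r u x * v x\<bar> \<le> (B * (r\<^sup>2 * \<kappa> r) * indicator I x) * \<bar>v x\<bar>"
          unfolding abs_mult[of "\<kappa> r * range_op r u x"] by (intro mult_right_mono bound) simp
        also have "\<dots> = B * (r\<^sup>2 * \<kappa> r) * \<bar>indicator I x * v x\<bar>" by (simp add: abs_mult)
        finally show ?thesis by linarith
      qed
      then show "AE p in lborel \<Otimes>\<^sub>M lborel. norm (case p of (r, x) \<Rightarrow> \<kappa> r * range_op r u x * v x)
          \<le> norm (case p of (r, x) \<Rightarrow> B * (r\<^sup>2 * \<kappa> r) * \<bar>indicator I x * v x\<bar>)"
        by (intro always_eventually) auto
    qed
  qed
qed

lemma op_graph_self_adjoint: "self_adjoint_L2 op_graph"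
  unfolding self_adjoint_L2_def
proof (intro conjI ballI allI impI)
  show "op_graph \<subseteq> L2 \<times> L2" by (auto simp: op_graph_def form_domD)
  show "adjoint_L2 op_graph = op_graph" by (rule adjoint_op_graph)
  fix w and e :: real assume "w \<in> L2" "e > 0"
  then obtain u where "u \<in> C2_compact" "(LINT x|lborel. (w x - u x)\<^sup>2) < e"
    using C2_compact_dense by blast
  then show "\<exists>u\<in>Domain op_graph. (LINT x|lborel. (w x - u x)\<^sup>2) < e"
    using C2_compact_in_graph by blast
qed

section \<open>Integrable kernels: the operator on all of \<open>L2\<close>\<close>

text \<open>The squares of all values of u that \<open>range_op\<close> reads at x. By translation
  invariance its integral over x does not depend on r, which bounds \<open>range_op r\<close> on
  \<open>L2\<close> uniformly in r.\<close>

definition majorant :: "real \<Rightarrow> (real \<Rightarrow> real) \<Rightarrow> real \<Rightarrow> real" where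
  "majorant r u x = (\<Sum>i\<le>M. (u (x + stretch i * r))\<^sup>2 + (u (x - stretch i * r))\<^sup>2 + (u x)\<^sup>2)"

lemma range_op_square_bound:
  obtains C where "C \<ge> 0" "\<And>r u x. (range_op r u x)\<^sup>2 \<le> C * majorant r u x"
proof -
  have "(range_op r u x)\<^sup>2 \<le> (\<Sum>i\<le>M. (coef i)\<^sup>2) * 8 * majorant r u x" for r u x
  proof -
    \<comment> \<open>Two applications of (s + t)^2 at most 2 s^2 + 2 t^2 give weights 4, 4 and 8,
      rounded up to 8 throughout.\<close>
    have b: "(bond_op i r u x)\<^sup>2 \<le> 8 * ((u (x + stretch i * r))\<^sup>2 + (u (x - stretch i * r))\<^sup>2 + (u x)\<^sup>2)" for i
    proof -
      define p q c where "p = u (x + stretch i * r)" and "q = u (x - stretch i * r)" and "c = u x"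
      define s t where "s = mask i r x" and "t = mask i r (x - stretch i * r)"
      have st: "s\<^sup>2 \<le> 1" "t\<^sup>2 \<le> 1" by (auto simp: s_def t_def mask_def)
      have "(s * (p - c) + t * (q - c))\<^sup>2 \<le> 2 * (s\<^sup>2 * (p - c)\<^sup>2) + 2 * (t\<^sup>2 * (q - c)\<^sup>2)"
        using sum_squares_bound[of "s * (p - c)" "t * (q - c)"] by (simp add: power2_sum power_mult_distrib)
      also have "\<dots> \<le> 2 * (p - c)\<^sup>2 + 2 * (q - c)\<^sup>2"
        using st by (intro add_mono mult_left_mono mult_left_le_one_le) auto
      also have "\<dots> \<le> 2 * (2 * p\<^sup>2 + 2 * c\<^sup>2) + 2 * (2 * q\<^sup>2 + 2 * c\<^sup>2)"
        using sum_squares_bound[of p "- c"] sum_squares_bound[of q "- c"] by (simp add: power2_diff)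
      also have "\<dots> \<le> 8 * (p\<^sup>2 + q\<^sup>2 + c\<^sup>2)" by simp
      finally show ?thesis by (simp add: bond_op_def p_def q_def c_def s_def t_def)
    qed
    have "(range_op r u x)\<^sup>2 \<le> (\<Sum>i\<le>M. (coef i)\<^sup>2) * (\<Sum>i\<le>M. (bond_op i r u x)\<^sup>2)"
      unfolding range_op_def by (rule Cauchy_Schwarz_ineq_sum)
    also have "\<dots> \<le> (\<Sum>i\<le>M. (coef i)\<^sup>2) * (8 * majorant r u x)"
      unfolding majorant_def sum_distrib_left by (intro mult_left_mono sum_mono b sum_nonneg) simp
    finally show ?thesis by simp
  qed
  moreover have "(\<Sum>i\<le>M. (coef i)\<^sup>2) * 8 \<ge> 0" by (intro mult_nonneg_nonneg sum_nonneg) auto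
  ultimately show ?thesis using that by blast
qed

lemma nn_integral_shift:
  fixes u :: "real \<Rightarrow> real"
  assumes [measurable]: "u \<in> borel_measurable borel"
  shows "(\<integral>\<^sup>+ x. ennreal ((u (x + t))\<^sup>2) \<partial>lborel) = (\<integral>\<^sup>+ x. ennreal ((u x)\<^sup>2) \<partial>lborel)"
  using nn_integral_real_affine[of "\<lambda>x. ennreal ((u x)\<^sup>2)" 1 t] by (simp add: add.commute)

lemma nn_integral_majorant:
  assumes [measurable]: "u \<in> borel_measurable borel"
  shows "(\<integral>\<^sup>+ x. ennreal (majorant r u x) \<partial>lborel)
     = of_nat (Suc M) * (3 * (\<integral>\<^sup>+ x. ennreal ((u x)\<^sup>2) \<partial>lborel))"
proof -
  define U where "U = (\<integral>\<^sup>+ x. ennreal ((u x)\<^sup>2) \<partial>lborel)"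
  have "(\<integral>\<^sup>+ x. ennreal (majorant r u x) \<partial>lborel) = (\<integral>\<^sup>+ x. (\<Sum>i\<le>M. ennreal ((u (x + stretch i * r))\<^sup>2)
      + ennreal ((u (x + - (stretch i * r)))\<^sup>2) + ennreal ((u x)\<^sup>2)) \<partial>lborel)"
    unfolding majorant_def by (intro nn_integral_cong) (simp flip: sum_ennreal ennreal_plus)
  also have "\<dots> = (\<Sum>i\<le>M. \<integral>\<^sup>+ x. ennreal ((u (x + stretch i * r))\<^sup>2)
      + ennreal ((u (x + - (stretch i * r)))\<^sup>2) + ennreal ((u x)\<^sup>2) \<partial>lborel)"
    by (rule nn_integral_sum) measurable
  also have "\<dots> = (\<Sum>i\<le>M. 3 * U)"
  proof (rule sum.cong[OF refl])
    fix i
    have "(\<integral>\<^sup>+ x. ennreal ((u (x + stretch i * r))\<^sup>2)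
        + ennreal ((u (x + - (stretch i * r)))\<^sup>2) + ennreal ((u x)\<^sup>2) \<partial>lborel) = U + U + U"
      unfolding U_def by (subst nn_integral_add, measurable, subst nn_integral_add, measurable)
        (simp only: nn_integral_shift[OF assms])
    also have "\<dots> = (1 + 1 + 1) * U" by (simp only: distrib_right mult_1)
    finally show "(\<integral>\<^sup>+ x. ennreal ((u (x + stretch i * r))\<^sup>2)
        + ennreal ((u (x + - (stretch i * r)))\<^sup>2) + ennreal ((u x)\<^sup>2) \<partial>lborel) = 3 * U" by simp
  qed
  finally show ?thesis by (simp add: U_def)
qed

text \<open>No cancellation is used here: Cauchy-Schwarz in r with respect to the finite measure of
  density \<kappa>, followed by Tonelli, reduces everything to the bound on
  \<open>range_op r\<close> in \<open>L2\<close>, uniform in r.\<close>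

lemma kernel_integrable_op:
  assumes \<kappa>: "integrable lborel \<kappa>" and u: "u \<in> L2"
  shows "(u, qnl_op u) \<in> op_graph"
proof -
  have [measurable]: "u \<in> borel_measurable borel" by (rule L2_measurable[OF u])
  obtain C where C: "C \<ge> 0" "\<And>r u x. (range_op r u x)\<^sup>2 \<le> C * majorant r u x"
    using range_op_square_bound by blast
  define U where "U = (\<integral>\<^sup>+ x. ennreal ((u x)\<^sup>2) \<partial>lborel)"
  define A where "A = ennreal C * (of_nat (Suc M) * (3 * U))"
  have "U < \<infinity>" using u unfolding U_def L2_iff by (simp add: square_integrable_nn_integral)
  then have A: "A < \<infinity>" by (auto simp: A_def ennreal_mult_less_top of_nat_less_top)
  have A_bound: "(\<integral>\<^sup>+ x. ennreal ((range_op r u x)\<^sup>2) \<partial>lborel) \<le> A" for r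
  proof -
    have [measurable]: "majorant r u \<in> borel_measurable borel" unfolding majorant_def[abs_def] by measurable
    have "(\<integral>\<^sup>+ x. ennreal ((range_op r u x)\<^sup>2) \<partial>lborel) \<le> (\<integral>\<^sup>+ x. ennreal C * ennreal (majorant r u x) \<partial>lborel)"
      using C by (intro nn_integral_mono) (simp add: ennreal_mult'[symmetric] ennreal_leI)
    also have "\<dots> = A" by (subst nn_integral_cmult) (auto simp: nn_integral_majorant A_def U_def)
    finally show ?thesis .
  qed
  have K: "(\<integral>\<^sup>+ r. ennreal (\<kappa> r) \<partial>lborel) < \<infinity>"
    using \<kappa> kernel_nonneg unfolding real_integrable_def by (auto simp: less_top)
  have [measurable]: "(\<lambda>p. range_op (fst p) u (snd p)) \<in> borel_measurable (lborel \<Otimes>\<^sub>M lborel)"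
    using range_op_measurable[of u] by (simp add: case_prod_unfold)
  have [measurable]: "(\<lambda>p. range_op (snd p) u (fst p)) \<in> borel_measurable (lborel \<Otimes>\<^sub>M lborel)"
    using measurable_pair_swap[OF range_op_measurable[of u]] by (simp add: case_prod_unfold)
  have [measurable]: "(\<lambda>r. range_op r u x) \<in> borel_measurable borel" for x
    using measurable_compose[OF measurable_Pair2'[of x lborel lborel] range_op_measurable[of u]] by simp
  show ?thesis
  proof (rule qnl_op_in_graph[OF u])
    have "ennreal ((qnl_op u x)\<^sup>2) \<le> (\<integral>\<^sup>+ r. ennreal (\<kappa> r) \<partial>lborel) * (\<integral>\<^sup>+ r. ennreal (\<kappa> r * (range_op r u x)\<^sup>2) \<partial>lborel)" for x
    proof -
      have "ennreal \<bar>qnl_op u x\<bar> \<le> (\<integral>\<^sup>+ r. ennreal (norm (\<kappa> r * range_op r u x)) \<partial>lborel)"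
      \<comment> \<open>If the integrand is not integrable, the integral defining
        \<open>qnl_op u x\<close> has the default value 0 and the bound is trivial.\<close>
      proof (cases "integrable lborel (\<lambda>r. \<kappa> r * range_op r u x)")
        case True
        from integral_norm_bound_ennreal[OF this] show ?thesis by (simp add: qnl_op_def)
      qed (simp add: qnl_op_def not_integrable_integral_eq)
      also have "\<dots> = (\<integral>\<^sup>+ r. ennreal (sqrt (\<kappa> r)) * ennreal (sqrt (\<kappa> r) * \<bar>range_op r u x\<bar>) \<partial>lborel)"
        using kernel_nonneg by (intro nn_integral_cong) (simp add: abs_mult ennreal_mult'[symmetric] mult.assoc[symmetric])
      finally have "(ennreal \<bar>qnl_op u x\<bar>)\<^sup>2 \<le> (\<integral>\<^sup>+ r. ennreal (sqrt (\<kappa> r)) * ennreal (sqrt (\<kappa> r) * \<bar>range_op r u x\<bar>) \<partial>lborel)\<^sup>2"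
        by (rule power_mono) simp
      also have "\<dots> \<le> (\<integral>\<^sup>+ r. (ennreal (sqrt (\<kappa> r)))\<^sup>2 \<partial>lborel) * (\<integral>\<^sup>+ r. (ennreal (sqrt (\<kappa> r) * \<bar>range_op r u x\<bar>))\<^sup>2 \<partial>lborel)"
        by (rule Cauchy_Schwarz_nn_integral) measurable
      finally show ?thesis
        using kernel_nonneg by (simp add: ennreal_power power_mult_distrib)
    qed
    then have "(\<integral>\<^sup>+ x. ennreal ((qnl_op u x)\<^sup>2) \<partial>lborel)
       \<le> (\<integral>\<^sup>+ x. (\<integral>\<^sup>+ r. ennreal (\<kappa> r) \<partial>lborel) * (\<integral>\<^sup>+ r. ennreal (\<kappa> r * (range_op r u x)\<^sup>2) \<partial>lborel) \<partial>lborel)"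
      by (intro nn_integral_mono)
    also have "\<dots> = (\<integral>\<^sup>+ r. ennreal (\<kappa> r) \<partial>lborel) * (\<integral>\<^sup>+ x. \<integral>\<^sup>+ r. ennreal (\<kappa> r * (range_op r u x)\<^sup>2) \<partial>lborel \<partial>lborel)"
      by (rule nn_integral_cmult) measurable
    also have "(\<integral>\<^sup>+ x. \<integral>\<^sup>+ r. ennreal (\<kappa> r * (range_op r u x)\<^sup>2) \<partial>lborel \<partial>lborel)
        = (\<integral>\<^sup>+ r. \<integral>\<^sup>+ x. ennreal (\<kappa> r * (range_op r u x)\<^sup>2) \<partial>lborel \<partial>lborel)"
      by (rule lborel_pair.Fubini') (simp add: case_prod_unfold)
    also have "\<dots> = (\<integral>\<^sup>+ r. ennreal (\<kappa> r) * (\<integral>\<^sup>+ x. ennreal ((range_op r u x)\<^sup>2) \<partial>lborel) \<partial>lborel)"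
      using kernel_nonneg by (intro nn_integral_cong) (simp add: ennreal_mult' nn_integral_cmult)
    also have "\<dots> \<le> (\<integral>\<^sup>+ r. ennreal (\<kappa> r) * A \<partial>lborel)"
      by (intro nn_integral_mono mult_left_mono A_bound) simp
    also have "\<dots> = (\<integral>\<^sup>+ r. ennreal (\<kappa> r) \<partial>lborel) * A" by (rule nn_integral_multc) measurable
    finally have "(\<integral>\<^sup>+ x. ennreal ((qnl_op u x)\<^sup>2) \<partial>lborel)
       \<le> (\<integral>\<^sup>+ r. ennreal (\<kappa> r) \<partial>lborel) * ((\<integral>\<^sup>+ r. ennreal (\<kappa> r) \<partial>lborel) * A)"
      by (simp add: mult_left_mono)
    also have "\<dots> < \<infinity>" using K A by (simp add: ennreal_mult_less_top)
    finally show "qnl_op u \<in> L2"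
      unfolding L2_iff using qnl_op_measurable[of u] by (subst square_integrable_nn_integral) auto
    fix v assume v: "v \<in> L2"
    have [measurable]: "v \<in> borel_measurable borel" by (rule L2_measurable[OF v])
    define V where "V = (\<integral>\<^sup>+ x. ennreal ((v x)\<^sup>2) \<partial>lborel)"
    have V: "V < \<infinity>" using v unfolding V_def L2_iff by (simp add: square_integrable_nn_integral)
    show "integrable (lborel \<Otimes>\<^sub>M lborel) (\<lambda>(r, x). \<kappa> r * range_op r u x * v x)"
    proof (rule integrableI_bounded)
      show "(\<lambda>(r, x). \<kappa> r * range_op r u x * v x) \<in> borel_measurable (lborel \<Otimes>\<^sub>M lborel)"
        by (simp add: case_prod_unfold)
      have "(\<integral>\<^sup>+ p. ennreal (norm (case p of (r, x) \<Rightarrow> \<kappa> r * range_op r u x * v x)) \<partial>(lborel \<Otimes>\<^sub>M lborel))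
          = (\<integral>\<^sup>+ r. \<integral>\<^sup>+ x. ennreal \<bar>\<kappa> r * range_op r u x * v x\<bar> \<partial>lborel \<partial>lborel)"
        by (subst lborel.nn_integral_fst[symmetric]) (auto simp: case_prod_unfold)
      also have "\<dots> \<le> (\<integral>\<^sup>+ r. ennreal (\<kappa> r) * (A + V) \<partial>lborel)"
      proof (intro nn_integral_mono)
        fix r
        have "(\<integral>\<^sup>+ x. ennreal \<bar>\<kappa> r * range_op r u x * v x\<bar> \<partial>lborel)
          \<le> (\<integral>\<^sup>+ x. ennreal (\<kappa> r) * (ennreal ((range_op r u x)\<^sup>2) + ennreal ((v x)\<^sup>2)) \<partial>lborel)"
        proof (intro nn_integral_mono)
          fix x
          have "2 * (\<bar>range_op r u x\<bar> * \<bar>v x\<bar>) \<le> (range_op r u x)\<^sup>2 + (v x)\<^sup>2"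
            using sum_squares_bound[of "\<bar>range_op r u x\<bar>" "\<bar>v x\<bar>"] by (simp add: mult.assoc)
          moreover have "0 \<le> \<bar>range_op r u x\<bar> * \<bar>v x\<bar>" by simp
          ultimately have "\<bar>range_op r u x\<bar> * \<bar>v x\<bar> \<le> (range_op r u x)\<^sup>2 + (v x)\<^sup>2" by linarith
          then have "\<kappa> r * (\<bar>range_op r u x\<bar> * \<bar>v x\<bar>) \<le> \<kappa> r * ((range_op r u x)\<^sup>2 + (v x)\<^sup>2)"
            by (intro mult_left_mono kernel_nonneg)
          then show "ennreal \<bar>\<kappa> r * range_op r u x * v x\<bar> \<le> ennreal (\<kappa> r) * (ennreal ((range_op r u x)\<^sup>2) + ennreal ((v x)\<^sup>2))"
            using kernel_nonneg[of r]
            by (simp add: abs_mult mult.assoc ennreal_leI flip: ennreal_plus ennreal_mult')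
        qed
        also have "\<dots> = ennreal (\<kappa> r) * ((\<integral>\<^sup>+ x. ennreal ((range_op r u x)\<^sup>2) \<partial>lborel) + V)"
          by (subst nn_integral_cmult) (auto simp: nn_integral_add V_def)
        also have "\<dots> \<le> ennreal (\<kappa> r) * (A + V)" by (intro mult_left_mono add_mono A_bound) auto
        finally show "(\<integral>\<^sup>+ x. ennreal \<bar>\<kappa> r * range_op r u x * v x\<bar> \<partial>lborel) \<le> ennreal (\<kappa> r) * (A + V)" .
      qed
      also have "\<dots> = (\<integral>\<^sup>+ r. ennreal (\<kappa> r) \<partial>lborel) * (A + V)" by (rule nn_integral_multc) measurable
      also have "\<dots> < \<infinity>" using K A V by (simp add: ennreal_mult_less_top)
      finally show "(\<integral>\<^sup>+ p. ennreal (norm (case p of (r, x) \<Rightarrow> \<kappa> r * range_op r u x * v x)) \<partial>(lborel \<Otimes>\<^sub>M lborel)) < \<infinity>" .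
    qed
  qed
qed

text \<open>By Tonelli the square of the translated u has finite \<kappa>-integral for almost every
  x, and \<bar>z\<bar> is at most 1 + z^2. The separate terms of the operator thus become ordinary
  integrals at almost every x.\<close>

lemma kernel_integrable_AE:
  assumes \<kappa>: "integrable lborel \<kappa>" and u: "u \<in> L2"
  shows "AE x in lborel. integrable lborel (\<lambda>r. \<kappa> r * u (x + t * r))"
proof -
  have [measurable]: "u \<in> borel_measurable borel" by (rule L2_measurable[OF u])
  have K: "(\<integral>\<^sup>+ r. ennreal (\<kappa> r) \<partial>lborel) < \<infinity>"
    using \<kappa> kernel_nonneg unfolding real_integrable_def by (auto simp: less_top)
  have U: "(\<integral>\<^sup>+ x. ennreal ((u x)\<^sup>2) \<partial>lborel) < \<infinity>"
    using u unfolding L2_iff by (simp add: square_integrable_nn_integral)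
  have "(\<integral>\<^sup>+ x. \<integral>\<^sup>+ r. ennreal (\<kappa> r * (u (x + t * r))\<^sup>2) \<partial>lborel \<partial>lborel)
     = (\<integral>\<^sup>+ r. \<integral>\<^sup>+ x. ennreal (\<kappa> r * (u (x + t * r))\<^sup>2) \<partial>lborel \<partial>lborel)"
    by (rule lborel_pair.Fubini') (simp add: case_prod_unfold)
  also have "\<dots> = (\<integral>\<^sup>+ r. ennreal (\<kappa> r) * (\<integral>\<^sup>+ x. ennreal ((u x)\<^sup>2) \<partial>lborel) \<partial>lborel)"
    using kernel_nonneg
    by (intro nn_integral_cong) (simp add: ennreal_mult' nn_integral_cmult nn_integral_shift)
  also have "\<dots> = (\<integral>\<^sup>+ r. ennreal (\<kappa> r) \<partial>lborel) * (\<integral>\<^sup>+ x. ennreal ((u x)\<^sup>2) \<partial>lborel)"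
    by (rule nn_integral_multc) measurable
  also have "\<dots> < \<infinity>" using K U by (simp add: ennreal_mult_less_top)
  finally have "AE x in lborel. (\<integral>\<^sup>+ r. ennreal (\<kappa> r * (u (x + t * r))\<^sup>2) \<partial>lborel) \<noteq> \<infinity>"
    by (intro nn_integral_PInf_AE) (auto simp: less_top)
  then show ?thesis
  proof eventually_elim
    case (elim x)
    then have int: "integrable lborel (\<lambda>r. \<kappa> r * (u (x + t * r))\<^sup>2)"
      using kernel_nonneg by (intro integrableI_nonneg) (auto simp: less_top)
    show ?case
    proof (rule Bochner_Integration.integrable_bound)
      show "integrable lborel (\<lambda>r. \<kappa> r + \<kappa> r * (u (x + t * r))\<^sup>2)" using \<kappa> int by simp
      have "\<bar>z\<bar> \<le> 1 + z\<^sup>2" for z :: real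
        using zero_le_power2[of "\<bar>z\<bar> - 1"] by (simp add: power2_diff)
      then have "\<bar>\<kappa> r * u (x + t * r)\<bar> \<le> \<kappa> r + \<kappa> r * (u (x + t * r))\<^sup>2" for r
        using mult_left_mono[OF _ kernel_nonneg[of r], of "\<bar>u (x + t * r)\<bar>" "1 + (u (x + t * r))\<^sup>2"]
        by (simp add: abs_mult kernel_nonneg distrib_left)
      then show "AE r in lborel. norm (\<kappa> r * u (x + t * r)) \<le> norm (\<kappa> r + \<kappa> r * (u (x + t * r))\<^sup>2)"
        by (intro always_eventually allI) (simp add: order_trans[OF _ abs_ge_self])
    qed measurable
  qed
qed

end

subsection \<open>Principal values\<close>

text \<open>The cut-off around x is symmetric, so y = x + s and y = x - s are removed together.
  Folding the two sides gives one integrand in s, and if that is integrable up to 0, dominated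
  convergence turns the principal value into its Lebesgue integral.\<close>

lemma pv_reflect:
  fixes g :: "real \<Rightarrow> real" and S :: "real set" and x :: real
  defines "p \<equiv> \<lambda>s. indicator S (x + s) * g (x + s)"
    and "q \<equiv> \<lambda>s. indicator S (x - s) * g (x - s)"
  assumes p: "\<And>\<epsilon>. \<epsilon> > 0 \<Longrightarrow> integrable lborel (\<lambda>s. indicator {\<epsilon><..} s * p s)"
    and q: "\<And>\<epsilon>. \<epsilon> > 0 \<Longrightarrow> integrable lborel (\<lambda>s. indicator {\<epsilon><..} s * q s)"
    and pq: "integrable lborel (\<lambda>s. indicator {0<..} s * (p s + q s))"
  shows "pv_integrable S x g"
    and "pv_integral S x g = (LINT s|lborel. indicator {0<..} s * (p s + q s))"
proof -
  have split: "indicator {y\<in>S. \<epsilon> < \<bar>y - x\<bar>} y * g y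
     = indicator {\<epsilon><..} (-x + 1 * y) * p (-x + 1 * y) + indicator {\<epsilon><..} (x + (-1) * y) * q (x + (-1) * y)"
    if "\<epsilon> > 0" for \<epsilon> y
    using that by (auto simp: p_def q_def indicator_def)
  have int1: "integrable lborel (\<lambda>y. indicator {\<epsilon><..} (-x + 1 * y) * p (-x + 1 * y))"
    and int2: "integrable lborel (\<lambda>y. indicator {\<epsilon><..} (x + (-1) * y) * q (x + (-1) * y))" if "\<epsilon> > 0" for \<epsilon>
    using lborel_integrable_real_affine[OF p[OF that], of 1 "-x"]
      lborel_integrable_real_affine[OF q[OF that], of "-1" x] by simp_all
  have set_int: "set_integrable lborel {y\<in>S. \<epsilon> < \<bar>y - x\<bar>} g" if "\<epsilon> > 0" for \<epsilon>
    unfolding set_integrable_def real_scaleR_def split[OF that]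
    using int1[OF that] int2[OF that] by (rule Bochner_Integration.integrable_add)
  have val: "(LINT y:{y\<in>S. \<epsilon> < \<bar>y - x\<bar>}|lborel. g y) = (LINT s|lborel. indicator {\<epsilon><..} s * (p s + q s))"
    if "\<epsilon> > 0" for \<epsilon>
  proof -
    have "(LINT y:{y\<in>S. \<epsilon> < \<bar>y - x\<bar>}|lborel. g y)
      = (LINT y|lborel. indicator {\<epsilon><..} (-x + 1 * y) * p (-x + 1 * y))
        + (LINT y|lborel. indicator {\<epsilon><..} (x + (-1) * y) * q (x + (-1) * y))"
      unfolding set_lebesgue_integral_def real_scaleR_def split[OF that]
      by (rule Bochner_Integration.integral_add[OF int1[OF that] int2[OF that]])
    also have "\<dots> = (LINT s|lborel. indicator {\<epsilon><..} s * p s) + (LINT s|lborel. indicator {\<epsilon><..} s * q s)"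
      using lborel_integral_real_affine[of 1 "\<lambda>s. indicator {\<epsilon><..} s * p s" "-x"]
        lborel_integral_real_affine[of "-1" "\<lambda>s. indicator {\<epsilon><..} s * q s" x] by simp
    also have "\<dots> = (LINT s|lborel. indicator {\<epsilon><..} s * (p s + q s))"
      using p[OF that] q[OF that] by (simp add: distrib_left)
    finally show ?thesis .
  qed
  define I where "I = (LINT s|lborel. indicator {0<..} s * (p s + q s))"
  have "((\<lambda>\<epsilon>. LINT s|lborel. indicator {\<epsilon><..} s * (p s + q s)) \<longlongrightarrow> I) (at_right 0)"
  proof (rule tendsto_at_right_sequentially[of 0 1])
    fix \<epsilon> :: "nat \<Rightarrow> real" assume e: "\<And>n. 0 < \<epsilon> n" "\<epsilon> \<longlonglongrightarrow> 0"
    show "(\<lambda>n. LINT s|lborel. indicator {\<epsilon> n<..} s * (p s + q s)) \<longlonglongrightarrow> I"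
      unfolding I_def
    proof (rule integral_dominated_convergence)
      show "integrable lborel (\<lambda>s. \<bar>indicator {0<..} s * (p s + q s)\<bar>)" using pq by (rule integrable_abs)
      show "(\<lambda>s. indicator {0<..} s * (p s + q s)) \<in> borel_measurable lborel" using pq by auto
      show "(\<lambda>s. indicator {\<epsilon> n<..} s * (p s + q s)) \<in> borel_measurable lborel" for n
        unfolding distrib_left using p[OF e(1)] q[OF e(1)]
        by (intro borel_measurable_add borel_measurable_integrable)
      show "AE s in lborel. norm (indicator {\<epsilon> n<..} s * (p s + q s)) \<le> \<bar>indicator {0<..} s * (p s + q s)\<bar>" for n
        using e(1)[of n] by (intro always_eventually allI) (auto simp: indicator_def)
      show "AE s in lborel. (\<lambda>n. indicator {\<epsilon> n<..} s * (p s + q s)) \<longlonglongrightarrow> indicator {0<..} s * (p s + q s)"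
      proof (intro always_eventually allI)
        fix s
        show "(\<lambda>n. indicator {\<epsilon> n<..} s * (p s + q s)) \<longlonglongrightarrow> indicator {0<..} s * (p s + q s)"
        proof (cases "s > 0")
          case True
          then have "\<forall>\<^sub>F n in sequentially. \<epsilon> n < s" using e(2) order_tendstoD(2) by blast
          then have "\<forall>\<^sub>F n in sequentially. indicator {0<..} s * (p s + q s) = indicator {\<epsilon> n<..} s * (p s + q s)"
            by eventually_elim (use True in auto)
          then show ?thesis by (rule Lim_transform_eventually[OF tendsto_const])
        next
          case False
          then have "indicator {\<epsilon> n<..} s = (0::real)" for n using e(1)[of n] by auto
          then show ?thesis using False by simp
        qed
      qed
    qed
  qed simp
  moreover have "\<forall>\<^sub>F \<epsilon> in at_right 0. (LINT s|lborel. indicator {\<epsilon><..} s * (p s + q s))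
      = (LINT y:{y\<in>S. \<epsilon> < \<bar>y - x\<bar>}|lborel. g y)"
    using val by (auto simp: eventually_at_right_field intro!: exI[of _ 1])
  ultimately have lim: "((\<lambda>\<epsilon>. LINT y:{y\<in>S. \<epsilon> < \<bar>y - x\<bar>}|lborel. g y) \<longlongrightarrow> I) (at_right 0)"
    by (rule Lim_transform_eventually)
  then show "pv_integrable S x g" using set_int by (auto simp: pv_integrable_def)
  show "pv_integral S x g = (LINT s|lborel. indicator {0<..} s * (p s + q s))"
    using tendsto_Lim[OF _ lim] by (simp add: pv_integral_def I_def)
qed

context qnl_kernel
begin

text \<open>The pointwise integrability required by every piece of \<open>L_qnl\<close>: one-sided
  differences away from r = 0, and symmetric second differences across r = 0. The factors 1 and M
  correspond to the ranges \<delta>2 and \<delta>1.\<close>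

definition pv_regular :: "(real \<Rightarrow> real) \<Rightarrow> real \<Rightarrow> bool" where
  "pv_regular u x \<longleftrightarrow>
     (\<forall>t\<in>{1, -1, real M, - real M}. \<forall>\<epsilon>>0. integrable lborel (\<lambda>r. indicator {\<epsilon><..} r * (\<kappa> r * (u (x + t * r) - u x))))
   \<and> (\<forall>t\<in>{1, real M}. integrable lborel (\<lambda>r. \<kappa> r * (u (x + t * r) + u (x - t * r) - 2 * u x)))"

text \<open>Reflection at x followed by s = h r; the Jacobian h turns the kernel factor 1/h^3 into
  1/h^2. The case h = M is the kernel of range \<delta>1, and h = 1 that of range \<delta>2.\<close>

lemma pv_bond:
  fixes h :: real
  assumes h: "h \<in> {1, real M}" and reg: "pv_regular u x" and [measurable]: "S \<in> sets borel"
  defines "G \<equiv> \<lambda>r. \<kappa> r * (indicator S (x + h * r) * (u (x + h * r) - u x)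
                + indicator S (x - h * r) * (u (x - h * r) - u x))"
  assumes int: "integrable lborel G"
  shows "pv_integrable S x (\<lambda>y. (u y - u x) * (\<kappa> (\<bar>y - x\<bar> / h) / h ^ 3))"
    and "pv_integral S x (\<lambda>y. (u y - u x) * (\<kappa> (\<bar>y - x\<bar> / h) / h ^ 3)) = 1 / h\<^sup>2 * (LINT r|lborel. G r)"
proof -
  have h0: "h > 0" using h M_pos by auto
  define g where "g y = (u y - u x) * (\<kappa> (\<bar>y - x\<bar> / h) / h ^ 3)" for y
  define p where "p s = indicator S (x + s) * g (x + s)" for s
  define q where "q s = indicator S (x - s) * g (x - s)" for s
  have scale: "integrable lborel f" if "integrable lborel (\<lambda>r. f (h * r))" for f :: "real \<Rightarrow> real"
    using that lborel_integrable_real_affine_iff[of h f 0] h0 by simp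
  have cut: "integrable lborel (\<lambda>r. indicator {\<epsilon><..} r * (indicator S (x + t * r) * (\<kappa> r * (u (x + t * r) - u x))))"
    if "t \<in> {1, -1, real M, - real M}" "\<epsilon> > 0" for t \<epsilon>
  proof -
    define T where "T = {r. x + t * r \<in> S}"
    have "T \<in> sets borel" unfolding T_def by measurable
    moreover have "integrable lborel (\<lambda>r. indicator {\<epsilon><..} r * (\<kappa> r * (u (x + t * r) - u x)))"
      using reg that by (auto simp: pv_regular_def)
    ultimately have "integrable lborel (\<lambda>r. indicator T r *\<^sub>R (indicator {\<epsilon><..} r * (\<kappa> r * (u (x + t * r) - u x))))"
      by (intro integrable_mult_indicator) auto
    also have "(\<lambda>r. indicator T r *\<^sub>R (indicator {\<epsilon><..} r * (\<kappa> r * (u (x + t * r) - u x))))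
      = (\<lambda>r. indicator {\<epsilon><..} r * (indicator S (x + t * r) * (\<kappa> r * (u (x + t * r) - u x))))"
      by (auto simp: T_def indicator_def)
    finally show ?thesis .
  qed
  have P: "integrable lborel (\<lambda>s. indicator {\<epsilon><..} s * p s)" if "\<epsilon> > 0" for \<epsilon>
  proof (rule scale)
    have "integrable lborel (\<lambda>r. 1 / h ^ 3 * (indicator {\<epsilon> / h<..} r * (indicator S (x + h * r) * (\<kappa> r * (u (x + h * r) - u x)))))"
      using h h0 that by (intro integrable_mult_right cut) auto
    also have "(\<lambda>r. 1 / h ^ 3 * (indicator {\<epsilon> / h<..} r * (indicator S (x + h * r) * (\<kappa> r * (u (x + h * r) - u x)))))
      = (\<lambda>r. indicator {\<epsilon><..} (h * r) * p (h * r))"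
    proof
      fix r
      have "\<epsilon> / h < r \<longleftrightarrow> \<epsilon> < h * r" using h0 by (simp add: pos_divide_less_eq mult.commute)
      moreover have "\<bar>h * r\<bar> / h = r" if "\<epsilon> < h * r"
        using that h0 \<open>\<epsilon> > 0\<close> by simp
      ultimately show "1 / h ^ 3 * (indicator {\<epsilon> / h<..} r * (indicator S (x + h * r) * (\<kappa> r * (u (x + h * r) - u x))))
        = indicator {\<epsilon><..} (h * r) * p (h * r)"
        by (auto simp: p_def g_def indicator_def)
    qed
    finally show "integrable lborel (\<lambda>r. indicator {\<epsilon><..} (h * r) * p (h * r))" .
  qed
  have Q: "integrable lborel (\<lambda>s. indicator {\<epsilon><..} s * q s)" if "\<epsilon> > 0" for \<epsilon>
  proof (rule scale)
    have "integrable lborel (\<lambda>r. 1 / h ^ 3 * (indicator {\<epsilon> / h<..} r * (indicator S (x + (- h) * r) * (\<kappa> r * (u (x + (- h) * r) - u x)))))"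
      using h h0 that by (intro integrable_mult_right cut) auto
    also have "(\<lambda>r. 1 / h ^ 3 * (indicator {\<epsilon> / h<..} r * (indicator S (x + (- h) * r) * (\<kappa> r * (u (x + (- h) * r) - u x)))))
      = (\<lambda>r. indicator {\<epsilon><..} (h * r) * q (h * r))"
    proof
      fix r
      have "\<epsilon> / h < r \<longleftrightarrow> \<epsilon> < h * r" using h0 by (simp add: pos_divide_less_eq mult.commute)
      moreover have "\<bar>h * r\<bar> / h = r" if "\<epsilon> < h * r"
        using that h0 \<open>\<epsilon> > 0\<close> by simp
      ultimately show "1 / h ^ 3 * (indicator {\<epsilon> / h<..} r * (indicator S (x + (- h) * r) * (\<kappa> r * (u (x + (- h) * r) - u x))))
        = indicator {\<epsilon><..} (h * r) * q (h * r)"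
        by (auto simp: q_def g_def indicator_def)
    qed
    finally show "integrable lborel (\<lambda>r. indicator {\<epsilon><..} (h * r) * q (h * r))" .
  qed
  have G: "indicator {0<..} (h * r) * (p (h * r) + q (h * r)) = 1 / h ^ 3 * G r" for r
    using h0 kernel_left[of r]
    by (cases "r > 0") (auto simp: p_def q_def g_def G_def zero_less_mult_iff field_simps)
  have PQ: "integrable lborel (\<lambda>s. indicator {0<..} s * (p s + q s))"
    by (rule scale) (use int G in simp)
  show "pv_integrable S x (\<lambda>y. (u y - u x) * (\<kappa> (\<bar>y - x\<bar> / h) / h ^ 3))"
    using pv_reflect(1)[of S x g] P Q PQ unfolding p_def q_def g_def[symmetric] by blast
  have "pv_integral S x g = (LINT s|lborel. indicator {0<..} s * (p s + q s))"
    using pv_reflect(2)[of S x g] P Q PQ unfolding p_def q_def by blast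
  also have "\<dots> = h * (LINT r|lborel. 1 / h ^ 3 * G r)"
    using lborel_integral_real_affine[of h "\<lambda>s. indicator {0<..} s * (p s + q s)" 0] h0 by (simp add: G)
  also have "\<dots> = 1 / h\<^sup>2 * (LINT r|lborel. G r)"
    using h0 by (simp add: power2_eq_square power3_eq_cube)
  finally show "pv_integral S x (\<lambda>y. (u y - u x) * (\<kappa> (\<bar>y - x\<bar> / h) / h ^ 3)) = 1 / h\<^sup>2 * (LINT r|lborel. G r)"
    by (simp add: g_def[abs_def])
qed

lemma range_op_expand:
  "range_op r u x = 1 / (real M)\<^sup>2 * ((if x \<le> 0 then 1 else 0) * (u (x + real M * r) - u x)
       + (if x \<le> real M * r then 1 else 0) * (u (x - real M * r) - u x))
     + 1 / real M * (\<Sum>j<M. (if real j * r < x then 1 else 0) * (u (x + r) - u x)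
       + (if real (Suc j) * r < x then 1 else 0) * (u (x - r) - u x))"
proof -
  have "range_op r u x = coef 0 * bond_op 0 r u x + (\<Sum>j<M. coef (Suc j) * bond_op (Suc j) r u x)"
    unfolding range_op_def by (rule sum.atMost_shift)
  moreover have "coef 0 * bond_op 0 r u x = 1 / (real M)\<^sup>2 * ((if x \<le> 0 then 1 else 0) * (u (x + real M * r) - u x)
       + (if x \<le> real M * r then 1 else 0) * (u (x - real M * r) - u x))"
    by (simp add: coef_def bond_op_def mask_def stretch_def)
  moreover have "coef (Suc j) * bond_op (Suc j) r u x = 1 / real M * ((if real j * r < x then 1 else 0) * (u (x + r) - u x)
       + (if real (Suc j) * r < x then 1 else 0) * (u (x - r) - u x))" for j
    by (simp add: coef_def bond_op_def mask_def stretch_def algebra_simps)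
  ultimately show ?thesis by (simp only: sum_distrib_left)
qed

text \<open>Evaluating the masks separates the three regions of the definition. Each piece of
  \<open>L_qnl\<close> becomes an r-integral by \<open>pv_bond\<close>, and these integrands add up
  to \<kappa> r times \<open>range_op\<close>.\<close>

lemma qnl_op_pv:
  assumes reg: "pv_regular u x" and \<delta>: "\<delta> > 0" "\<delta>1 = real M * \<delta>"
    and d1: "diff_term \<gamma> \<delta>1 u x = (\<lambda>y. (u y - u x) * (\<kappa> (\<bar>y - x\<bar> / real M) / real M ^ 3))"
    and d2: "diff_term \<gamma> \<delta> u x = (\<lambda>y. (u y - u x) * (\<kappa> (\<bar>y - x\<bar> / 1) / 1 ^ 3))"
  shows "L_qnl_defined \<gamma> \<delta>1 \<delta> M u x \<and> L_qnl \<gamma> \<delta>1 \<delta> M u x = qnl_op u x"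
proof -
  have M0: "real M > 0" using M_pos by simp
  define p where "p t r = \<kappa> r * (u (x + t * r) - u x)" for t r
  have p_cut: "integrable lborel (\<lambda>r. indicator {\<epsilon><..} r * p t r)"
    if "t \<in> {1, -1, real M, - real M}" "\<epsilon> > 0" for t \<epsilon>
    using reg that unfolding pv_regular_def p_def by blast
  have p_sum: "integrable lborel (\<lambda>r. p t r + p (- t) r)" if "t \<in> {1, real M}" for t
  proof -
    have "integrable lborel (\<lambda>r. \<kappa> r * (u (x + t * r) + u (x - t * r) - 2 * u x))"
      using reg that unfolding pv_regular_def by blast
    also have "(\<lambda>r. \<kappa> r * (u (x + t * r) + u (x - t * r) - 2 * u x)) = (\<lambda>r. p t r + p (- t) r)"
      by (auto simp: p_def algebra_simps)
    finally show ?thesis .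
  qed
  note bond1 = pv_bond[OF _ reg, of "real M", folded d1]
  note bond2 = pv_bond[OF _ reg, of 1, folded d2]
  consider "x \<le> 0" | "x \<ge> \<delta>1" "x > 0" | "0 < x" "x < \<delta>1" by linarith
  then show ?thesis
  proof cases
    case 1
    have eq: "\<kappa> r * (indicator UNIV (x + real M * r) * (u (x + real M * r) - u x)
          + indicator UNIV (x - real M * r) * (u (x - real M * r) - u x)) = p (real M) r + p (- real M) r" for r
      by (simp add: p_def algebra_simps)
    have pv: "pv_integrable UNIV x (diff_term \<gamma> \<delta>1 u x)"
      "pv_integral UNIV x (diff_term \<gamma> \<delta>1 u x) = 1 / (real M)\<^sup>2 * (LINT r|lborel. p (real M) r + p (- real M) r)"
      using bond1[of UNIV] p_sum[of "real M"] unfolding eq by auto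
    have "\<kappa> r * range_op r u x = 1 / (real M)\<^sup>2 * (p (real M) r + p (- real M) r)" for r
    proof (cases "r > 0")
      case True
      \<comment> \<open>Left of the interface no sub-bond is active, and a long bond is active with
        x as either of its end points.\<close>
      have a: "\<not> real j * r < x" for j :: nat using 1 True by (smt (verit) mult_nonneg_nonneg of_nat_0_le_iff)
      have "x \<le> real M * r" using 1 True M0 by (smt (verit) mult_pos_pos)
      then have "range_op r u x = 1 / (real M)\<^sup>2 * ((u (x + real M * r) - u x) + (u (x - real M * r) - u x))"
        unfolding range_op_expand using 1 by (simp only: a if_False mult_zero_left) simp
      moreover have "p (- real M) r = \<kappa> r * (u (x - real M * r) - u x)" by (simp add: p_def)
      ultimately show ?thesis by (simp only: p_def[of "real M"] distrib_left mult.left_commute)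
    qed (simp add: kernel_left p_def)
    then have "qnl_op u x = 1 / (real M)\<^sup>2 * (LINT r|lborel. p (real M) r + p (- real M) r)"
      by (simp add: qnl_op_def)
    then show ?thesis using pv 1 by (simp add: L_qnl_defined_def L_qnl_def)
  next
    case 2
    have eq: "\<kappa> r * (indicator UNIV (x + 1 * r) * (u (x + 1 * r) - u x)
          + indicator UNIV (x - 1 * r) * (u (x - 1 * r) - u x)) = p 1 r + p (- 1) r" for r
      by (simp add: p_def algebra_simps)
    have pv: "pv_integrable UNIV x (diff_term \<gamma> \<delta> u x)"
      "pv_integral UNIV x (diff_term \<gamma> \<delta> u x) = (LINT r|lborel. p 1 r + p (- 1) r)"
      using bond2[of UNIV] p_sum[of 1] unfolding eq by auto
    have "\<kappa> r * range_op r u x = p 1 r + p (- 1) r" for r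
    proof (cases "0 < r \<and> r < \<delta>")
      case True
      \<comment> \<open>Within the range of the kernel, M r < \<delta>1 \<le> x: all sub-bonds at x
        are active and no long bond reaches across 0.\<close>
      then have Mr: "real M * r < x" using 2 \<delta>(2) M0 by (smt (verit) mult_strict_left_mono)
      have a: "real j * r < x" if "j \<le> M" for j
      proof -
        have "real j * r \<le> real M * r" using that True by (intro mult_right_mono) auto
        then show ?thesis using Mr by linarith
      qed
      have "(\<Sum>j<M. (if real j * r < x then 1 else 0) * (u (x + r) - u x)
          + (if real (Suc j) * r < x then 1 else 0) * (u (x - r) - u x))
        = (\<Sum>j<M. (u (x + r) - u x) + (u (x - r) - u x))"
        using a[of "_"] a[of "Suc _"] by (intro sum.cong) auto
      then have "range_op r u x = (u (x + r) - u x) + (u (x - r) - u x)"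
        unfolding range_op_expand using 2 Mr M0 by simp
      then show ?thesis by (simp add: p_def flip: distrib_left)
    next
      case False
      then have "\<kappa> r = 0" using kernel_left kernel_right by (meson not_le)
      then show ?thesis by (simp add: p_def)
    qed
    then have "qnl_op u x = (LINT r|lborel. p 1 r + p (- 1) r)" by (simp add: qnl_op_def)
    then show ?thesis using pv 2 by (simp add: L_qnl_defined_def L_qnl_def)
  next
    case 3
    \<comment> \<open>Integrands in r of the pieces of the transition region: T0 for long bonds
      reaching left across 0, T j for the symmetric window of radius x/j, and TM for the half line,
      whose left side is available only for r < x/M.\<close>
    define T0 where "T0 r = indicator {x / real M<..} r * p (- real M) r" for r
    define T where "T j r = indicator {..< x / real j} r * (p 1 r + p (- 1) r)" for j :: nat and r
    define TM where "TM r = T M r + indicator {x / real M..} r * p 1 r" for r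
    have T0: "integrable lborel T0"
      unfolding T0_def using 3 M0 by (intro p_cut) auto
    have T: "integrable lborel (T j)" for j
      unfolding T_def using integrable_mult_indicator[OF _ p_sum[of 1], of "{..< x / real j}"] by simp
    \<comment> \<open>The unpaired term p 1 is integrable only away from 0; the closed ray from x/M
      lies inside the open ray from half that point.\<close>
    have "integrable lborel (\<lambda>r. indicator {x / real M..} r *\<^sub>R (indicator {x / real M / 2<..} r * p 1 r))"
      using 3 M0 by (intro integrable_mult_indicator p_cut) auto
    also have "(\<lambda>r. indicator {x / real M..} r *\<^sub>R (indicator {x / real M / 2<..} r * p 1 r))
      = (\<lambda>r. indicator {x / real M..} r * p 1 r)"
    proof
      have "x / real M > 0" using 3 M0 by simp
      then show "indicator {x / real M..} r *\<^sub>R (indicator {x / real M / 2<..} r * p 1 r)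
        = indicator {x / real M..} r * p 1 r" for r by (auto simp: indicator_def)
    qed
    finally have TM: "integrable lborel TM" unfolding TM_def using T by simp
    \<comment> \<open>The left boundary x - \<delta>1 of the window is automatic, since \<kappa>
      vanishes once M r reaches \<delta>1.\<close>
    have eq0: "\<kappa> r * (indicator {x - \<delta>1<..<0} (x + real M * r) * (u (x + real M * r) - u x)
          + indicator {x - \<delta>1<..<0} (x - real M * r) * (u (x - real M * r) - u x)) = T0 r" for r
    proof (cases "0 < r \<and> r < \<delta>")
      case True
      then have "real M * r < \<delta>1" "0 < real M * r" using \<delta>(2) M0 by auto
      moreover have "x / real M < r \<longleftrightarrow> x < real M * r" using M0 by (simp add: pos_divide_less_eq mult.commute)
      ultimately show ?thesis using 3 by (auto simp: T0_def p_def indicator_def)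
    next
      case False
      then have "\<kappa> r = 0" using kernel_left kernel_right by (meson not_le)
      then show ?thesis by (simp add: T0_def p_def)
    qed
    have pv0: "pv_integrable {x - \<delta>1<..<0} x (diff_term \<gamma> \<delta>1 u x)"
      "pv_integral {x - \<delta>1<..<0} x (diff_term \<gamma> \<delta>1 u x) = 1 / (real M)\<^sup>2 * (LINT r|lborel. T0 r)"
      using bond1[of "{x - \<delta>1<..<0}"] T0 unfolding eq0 by auto
    \<comment> \<open>This includes j = 0: division by 0 gives 0, the window is empty and T 0
      vanishes.\<close>
    have eqj: "\<kappa> r * (indicator {x - 1 / real j * x<..<x + 1 / real j * x} (x + 1 * r) * (u (x + 1 * r) - u x)
          + indicator {x - 1 / real j * x<..<x + 1 / real j * x} (x - 1 * r) * (u (x - 1 * r) - u x)) = T j r" for r j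
    proof (cases "r > 0")
      case True
      then show ?thesis by (auto simp: T_def p_def indicator_def algebra_simps)
    qed (simp add: kernel_left T_def p_def)
    have pvj: "pv_integrable {x - 1 / real j * x<..<x + 1 / real j * x} x (diff_term \<gamma> \<delta> u x)"
      "pv_integral {x - 1 / real j * x<..<x + 1 / real j * x} x (diff_term \<gamma> \<delta> u x) = (LINT r|lborel. T j r)" for j
      using bond2[of "{x - 1 / real j * x<..<x + 1 / real j * x}"] T[of j] unfolding eqj by auto
    have eqM: "\<kappa> r * (indicator {x - 1 / real M * x<..} (x + 1 * r) * (u (x + 1 * r) - u x)
          + indicator {x - 1 / real M * x<..} (x - 1 * r) * (u (x - 1 * r) - u x)) = TM r" for r
    proof (cases "r > 0")
      case True
      moreover have "x / real M > 0" using 3 M0 by simp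
      ultimately show ?thesis by (auto simp: TM_def T_def p_def indicator_def algebra_simps)
    qed (simp add: kernel_left TM_def T_def p_def)
    have pvM: "pv_integrable {x - 1 / real M * x<..} x (diff_term \<gamma> \<delta> u x)"
      "pv_integral {x - 1 / real M * x<..} x (diff_term \<gamma> \<delta> u x) = (LINT r|lborel. TM r)"
      using bond2[of "{x - 1 / real M * x<..}"] TM unfolding eqM by auto
    \<comment> \<open>At r = x/M the open window of T0 and the non-strict mask x \<le> M r differ, a
      single point that the integral ignores.\<close>
    have pointwise: "\<kappa> r * range_op r u x
       = 1 / (real M)\<^sup>2 * T0 r + 1 / real M * (\<Sum>j=1..M - 1. T j r) + 1 / real M * TM r"
      if "r \<noteq> x / real M" for r
    proof (cases "r > 0")
      case True
      obtain m where m: "M = Suc m" using M_pos by (cases M) auto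
      define P Q where "P = u (x + r) - u x" and "Q = u (x - r) - u x"
      define s where "s j = (if real j * r < x then 1 else 0 :: real)" for j :: nat
      have ind: "indicator {..< x / real j} r = s j" if "j > 0" for j
        using that by (auto simp: s_def indicator_def pos_less_divide_eq mult.commute)
      \<comment> \<open>Forward differences P carry s 0, ..., s (M-1) and backward differences Q
        carry s 1, ..., s M. Equal indices combine into the symmetric windows j = 1, ..., M-1; what
        remains is P, as s 0 = 1 for x > 0, and s M times Q, which form the last, one-sided
        integral.\<close>
      have "(\<Sum>j<M. s j * P + s (Suc j) * Q) = (\<Sum>j<Suc m. s j * P) + (\<Sum>j<Suc m. s (Suc j) * Q)"
        by (simp add: m sum.distrib)
      also have "(\<Sum>j<Suc m. s j * P) = s 0 * P + (\<Sum>j<m. s (Suc j) * P)" by (rule sum.lessThan_Suc_shift)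
      also have "(\<Sum>j<Suc m. s (Suc j) * Q) = (\<Sum>j<m. s (Suc j) * Q) + s M * Q" by (simp add: m)
      also have "(\<Sum>j<m. s (Suc j) * P) = (\<Sum>j=1..M - 1. s j * P)"
        by (rule sum.reindex_bij_witness[of _ "\<lambda>j. j - 1" Suc]) (auto simp: m)
      also have "(\<Sum>j<m. s (Suc j) * Q) = (\<Sum>j=1..M - 1. s j * Q)"
        by (rule sum.reindex_bij_witness[of _ "\<lambda>j. j - 1" Suc]) (auto simp: m)
      finally have sum: "(\<Sum>j<M. s j * P + s (Suc j) * Q) = P + (\<Sum>j=1..M - 1. s j * (P + Q)) + s M * Q"
        using 3 by (simp add: s_def[of 0] distrib_left sum.distrib)
      have Ts: "(\<Sum>j=1..M - 1. T j r) = \<kappa> r * (\<Sum>j=1..M - 1. s j * (P + Q))"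
        unfolding sum_distrib_left by (intro sum.cong) (auto simp: T_def ind p_def P_def Q_def algebra_simps)
      have x_ind: "indicator {x / real M..} r = 1 - s M" "indicator {x / real M<..} r = 1 - s M"
        using that M0 by (auto simp: s_def indicator_def pos_less_divide_eq pos_divide_less_eq pos_divide_le_eq mult.commute)
          (auto simp: field_simps)
      have TMr: "TM r = \<kappa> r * (P + s M * Q)"
        unfolding TM_def T_def using M_pos by (simp add: x_ind ind p_def P_def Q_def algebra_simps)
      have "x \<le> real M * r \<longleftrightarrow> \<not> real M * r < x" by auto
      then have x_if: "(if x \<le> real M * r then 1 else 0) = 1 - s M" by (simp add: s_def)
      have "range_op r u x = 1 / (real M)\<^sup>2 * ((1 - s M) * (u (x - real M * r) - u x))
          + 1 / real M * (\<Sum>j<M. s j * P + s (Suc j) * Q)"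
        unfolding range_op_expand x_if P_def Q_def s_def using 3 by simp
      moreover have "T0 r = \<kappa> r * ((1 - s M) * (u (x - real M * r) - u x))"
        by (simp add: T0_def x_ind p_def)
      moreover have "k * (c * X + d * (P + Z + Y)) = c * (k * X) + d * (k * Z) + d * (k * (P + Y))"
        for k c X d Z Y :: real
        by (simp add: algebra_simps)
      ultimately show ?thesis unfolding Ts TMr sum by (simp only:)
    next
      case False
      then show ?thesis by (simp add: kernel_left T0_def TM_def T_def p_def)
    qed
    define W where "W r = 1 / (real M)\<^sup>2 * T0 r + 1 / real M * (\<Sum>j=1..M - 1. T j r) + 1 / real M * TM r" for r
    have W: "integrable lborel W" unfolding W_def using T0 T TM by simp
    have "qnl_op u x = (LINT r|lborel. W r)"
    proof -
      have "AE r in lborel. W r = \<kappa> r * range_op r u x"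
        using AE_lborel_singleton[of "x / real M"] by eventually_elim (simp add: pointwise W_def)
      \<comment> \<open>The lemma does not assume u measurable, so measurability of the integrand is
        read off from W, changed at one point.\<close>
      moreover have "(\<lambda>r. if r = x / real M then \<kappa> (x / real M) * range_op (x / real M) u x else W r) \<in> borel_measurable lborel"
        using borel_measurable_integrable[OF W] by (intro measurable_If) auto
      moreover have "(\<lambda>r. if r = x / real M then \<kappa> (x / real M) * range_op (x / real M) u x else W r) = (\<lambda>r. \<kappa> r * range_op r u x)"
        by (auto simp: pointwise W_def)
      ultimately show ?thesis
        unfolding qnl_op_def using W by (intro integral_cong_AE) (auto elim: eventually_mono)
    qed
    also have "\<dots> = 1 / (real M)\<^sup>2 * (LINT r|lborel. T0 r)
        + 1 / real M * (\<Sum>j=1..M - 1. LINT r|lborel. T j r) + 1 / real M * (LINT r|lborel. TM r)"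
      unfolding W_def using T0 T TM by simp
    finally show ?thesis
      using pv0 pvj pvM 3 by (simp add: L_qnl_defined_def L_qnl_def)
  qed
qed

section \<open>Functions to which the principal value formula applies\<close>

lemma pv_regular_taylor:
  assumes [measurable]: "u \<in> borel_measurable borel" and "K \<ge> 0"
    and K: "\<And>d. \<bar>u (x + d) - u x - d * p\<bar> \<le> K * d\<^sup>2"
  shows "pv_regular u x"
  unfolding pv_regular_def
proof (intro conjI ballI allI impI)
  fix t \<epsilon> :: real assume "\<epsilon> > 0"
  \<comment> \<open>For r > \<epsilon> the linear term is at most \<bar>t p\<bar> r^2 / \<epsilon>,
    so the second moment controls it; in the symmetric difference treated afterwards the linear
    terms cancel.\<close>
  define C where "C = K * t\<^sup>2 + \<bar>t * p\<bar> / \<epsilon>"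
  show "integrable lborel (\<lambda>r. indicator {\<epsilon><..} r * (\<kappa> r * (u (x + t * r) - u x)))"
  proof (rule Bochner_Integration.integrable_bound)
    show "integrable lborel (\<lambda>r. C * (r\<^sup>2 * \<kappa> r))" using kernel_moment by simp
    show "AE r in lborel. norm (indicator {\<epsilon><..} r * (\<kappa> r * (u (x + t * r) - u x))) \<le> norm (C * (r\<^sup>2 * \<kappa> r))"
    proof (intro always_eventually allI)
      fix r
      show "norm (indicator {\<epsilon><..} r * (\<kappa> r * (u (x + t * r) - u x))) \<le> norm (C * (r\<^sup>2 * \<kappa> r))"
      proof (cases "r > \<epsilon>")
        case True
        have "\<bar>u (x + t * r) - u x\<bar> \<le> K * (t * r)\<^sup>2 + \<bar>t * r * p\<bar>" using K[of "t * r"] by linarith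
        also have "\<bar>t * r * p\<bar> \<le> \<bar>t * p\<bar> / \<epsilon> * r\<^sup>2"
        proof -
          have "r * \<epsilon> \<le> r * r" using True \<open>\<epsilon> > 0\<close> by (intro mult_left_mono) auto
          then have "r \<le> r\<^sup>2 / \<epsilon>" using \<open>\<epsilon> > 0\<close> by (simp add: pos_le_divide_eq power2_eq_square)
          then have "\<bar>t * p\<bar> * r \<le> \<bar>t * p\<bar> * (r\<^sup>2 / \<epsilon>)" by (intro mult_left_mono) auto
          then show ?thesis using True \<open>\<epsilon> > 0\<close> by (simp add: abs_mult mult_ac)
        qed
        finally have "\<bar>u (x + t * r) - u x\<bar> \<le> C * r\<^sup>2" by (simp add: C_def algebra_simps power_mult_distrib)
        then have "\<kappa> r * \<bar>u (x + t * r) - u x\<bar> \<le> \<kappa> r * (C * r\<^sup>2)" by (intro mult_left_mono kernel_nonneg)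
        then show ?thesis using True kernel_nonneg[of r] abs_ge_self[of "C * (r\<^sup>2 * \<kappa> r)"]
          by (simp add: abs_mult mult_ac)
      qed simp
    qed
  qed measurable
next
  fix t :: real
  show "integrable lborel (\<lambda>r. \<kappa> r * (u (x + t * r) + u (x - t * r) - 2 * u x))"
  proof (rule Bochner_Integration.integrable_bound)
    show "integrable lborel (\<lambda>r. 2 * K * t\<^sup>2 * (r\<^sup>2 * \<kappa> r))" using kernel_moment by simp
    show "AE r in lborel. norm (\<kappa> r * (u (x + t * r) + u (x - t * r) - 2 * u x)) \<le> norm (2 * K * t\<^sup>2 * (r\<^sup>2 * \<kappa> r))"
    proof (intro always_eventually allI)
      fix r
      have "\<bar>u (x + t * r) + u (x - t * r) - 2 * u x\<bar> \<le> K * (t * r)\<^sup>2 + K * (t * r)\<^sup>2"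
        using K[of "t * r"] K[of "- (t * r)"] by simp
      then have "\<kappa> r * \<bar>u (x + t * r) + u (x - t * r) - 2 * u x\<bar> \<le> \<kappa> r * (2 * K * (t * r)\<^sup>2)"
        by (intro mult_left_mono kernel_nonneg) simp
      then show "norm (\<kappa> r * (u (x + t * r) + u (x - t * r) - 2 * u x)) \<le> norm (2 * K * t\<^sup>2 * (r\<^sup>2 * \<kappa> r))"
        using kernel_nonneg[of r] \<open>K \<ge> 0\<close> by (simp add: abs_mult power_mult_distrib mult_ac)
    qed
  qed measurable
qed

lemma pv_regular_C2:
  assumes "u \<in> C2_compact" shows "pv_regular u x"
proof -
  obtain u' K where "K \<ge> 0" "\<And>x d. \<bar>u (x + d) - u x - d * u' x\<bar> \<le> K * d\<^sup>2"
    using C2_compact_taylor[OF assms] by metis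
  then show ?thesis
    by (intro pv_regular_taylor[of u K x "u' x"] L2_measurable C2_compact_L2 assms) auto
qed

lemma pv_regular_affine: "pv_regular (\<lambda>z. F * z + u0) x"
  by (rule pv_regular_taylor[of _ 0 _ F]) (auto simp: algebra_simps)

lemma qnl_op_affine: "qnl_op (\<lambda>z. F * z + u0) x = 0"
  by (simp add: qnl_op_def range_op_affine)

lemma pv_regular_kernel_integrable:
  assumes \<kappa>: "integrable lborel \<kappa>" and u: "u \<in> L2"
  shows "AE x in lborel. pv_regular u x"
proof -
  have "AE x in lborel. \<forall>t\<in>{1, -1, real M, - real M}. integrable lborel (\<lambda>r. \<kappa> r * u (x + t * r))"
  proof (subst AE_finite_all)
    show "\<forall>t\<in>{1, -1, real M, - real M}. AE x in lborel. integrable lborel (\<lambda>r. \<kappa> r * u (x + t * r))"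
      by (intro ballI kernel_integrable_AE[OF \<kappa> u])
  qed simp
  then show ?thesis
  proof eventually_elim
    case (elim x)
    have d: "integrable lborel (\<lambda>r. \<kappa> r * (u (x + t * r) - u x))" if "t \<in> {1, -1, real M, - real M}" for t
      using elim that \<kappa> by (auto simp: right_diff_distrib)
    show ?case
      unfolding pv_regular_def
    proof (intro conjI ballI allI impI)
      fix t \<epsilon> :: real assume "t \<in> {1, -1, real M, - real M}"
      from integrable_mult_indicator[OF _ d[OF this], of "{\<epsilon><..}"]
      show "integrable lborel (\<lambda>r. indicator {\<epsilon><..} r * (\<kappa> r * (u (x + t * r) - u x)))" by simp
    next
      fix t :: real assume t: "t \<in> {1, real M}"
      have "integrable lborel (\<lambda>r. \<kappa> r * (u (x + t * r) - u x) + \<kappa> r * (u (x + (- t) * r) - u x))"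
        using t by (intro Bochner_Integration.integrable_add d) auto
      then show "integrable lborel (\<lambda>r. \<kappa> r * (u (x + t * r) + u (x - t * r) - 2 * u x))"
        by (simp add: algebra_simps)
    qed
  qed
qed

end

subsection \<open>The energy\<close>

lemma nn_integral_symmetrize:
  fixes H :: "real \<Rightarrow> ennreal"
  assumes [measurable]: "H \<in> borel_measurable borel"
  shows "(\<integral>\<^sup>+ r. H r \<partial>lborel) = (\<integral>\<^sup>+ r. indicator {0<..} r * (H r + H (- r)) \<partial>lborel)"
proof -
  have "(\<integral>\<^sup>+ r. H r \<partial>lborel) = (\<integral>\<^sup>+ r. indicator {0<..} r * H r + indicator {..<0} r * H r \<partial>lborel)"
    by (rule nn_integral_cong_AE, use AE_lborel_singleton[of 0] in eventually_elim) (auto simp: indicator_def)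
  also have "\<dots> = (\<integral>\<^sup>+ r. indicator {0<..} r * H r \<partial>lborel) + (\<integral>\<^sup>+ r. indicator {..<0} r * H r \<partial>lborel)"
    by (rule nn_integral_add) measurable
  also have "(\<integral>\<^sup>+ r. indicator {..<0} r * H r \<partial>lborel) = (\<integral>\<^sup>+ r. indicator {..<0} (- r) * H (- r) \<partial>lborel)"
    using nn_integral_real_affine[of "\<lambda>r. indicator {..<0} r * H r" "-1" 0] by simp
  also have "(\<lambda>r. indicator {..<0} (- r) * H (- r)) = (\<lambda>r::real. indicator {0<..} r * H (- r))"
    by (auto simp: indicator_def)
  also have "(\<integral>\<^sup>+ r. indicator {0<..} r * H r \<partial>lborel) + (\<integral>\<^sup>+ r. indicator {0<..} r * H (- r) \<partial>lborel)
      = (\<integral>\<^sup>+ r. indicator {0<..} r * H r + indicator {0<..} r * H (- r) \<partial>lborel)"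
    by (rule nn_integral_add[symmetric]) measurable
  finally show ?thesis by (simp add: distrib_left)
qed

text \<open>Every bond of length c r occurs in both orientations, y = x + c r and y = x - c r. For
  the energy the two contribute equally, which turns its factor 1/4 into 1/2.\<close>

lemma nn_integral_plane_bonds:
  fixes F :: "real \<times> real \<Rightarrow> ennreal"
  assumes F[measurable]: "F \<in> borel_measurable (lborel \<Otimes>\<^sub>M lborel)" and c: "c > 0"
  shows "(\<integral>\<^sup>+ p. F p \<partial>(lborel \<Otimes>\<^sub>M lborel))
     = (\<integral>\<^sup>+ r. indicator {0<..} r * (ennreal c * ((\<integral>\<^sup>+ x. F (x, x + c * r) \<partial>lborel) + (\<integral>\<^sup>+ x. F (x, x - c * r) \<partial>lborel))) \<partial>lborel)"
proof -
  have "(\<integral>\<^sup>+ p. F p \<partial>(lborel \<Otimes>\<^sub>M lborel)) = (\<integral>\<^sup>+ x. \<integral>\<^sup>+ y. F (x, y) \<partial>lborel \<partial>lborel)"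
    by (rule lborel.nn_integral_fst[symmetric]) measurable
  also have "\<dots> = (\<integral>\<^sup>+ x. \<integral>\<^sup>+ r. ennreal c * F (x, x + c * r) \<partial>lborel \<partial>lborel)"
  proof (rule nn_integral_cong)
    fix x
    have "(\<integral>\<^sup>+ y. F (x, y) \<partial>lborel) = ennreal \<bar>c\<bar> * (\<integral>\<^sup>+ r. F (x, x + c * r) \<partial>lborel)"
      using c by (intro nn_integral_real_affine) auto
    then show "(\<integral>\<^sup>+ y. F (x, y) \<partial>lborel) = (\<integral>\<^sup>+ r. ennreal c * F (x, x + c * r) \<partial>lborel)"
      using c by (subst nn_integral_cmult) auto
  qed
  also have "\<dots> = (\<integral>\<^sup>+ r. \<integral>\<^sup>+ x. ennreal c * F (x, x + c * r) \<partial>lborel \<partial>lborel)"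
    by (rule lborel_pair.Fubini') (simp add: case_prod_unfold)
  also have "\<dots> = (\<integral>\<^sup>+ r. indicator {0<..} r * ((\<integral>\<^sup>+ x. ennreal c * F (x, x + c * r) \<partial>lborel)
      + (\<integral>\<^sup>+ x. ennreal c * F (x, x + c * - r) \<partial>lborel)) \<partial>lborel)"
    by (rule nn_integral_symmetrize) measurable
  finally show ?thesis by (simp add: nn_integral_cmult distrib_left)
qed

lemma nn_integral_translate:
  fixes f :: "real \<Rightarrow> ennreal"
  assumes "f \<in> borel_measurable borel"
  shows "(\<integral>\<^sup>+ x. f (x + t) \<partial>lborel) = (\<integral>\<^sup>+ x. f x \<partial>lborel)"
  using nn_integral_real_affine[of f 1 t] assms by (simp add: add.commute)

context qnl_kernel
begin

definition bond_energy :: "nat \<Rightarrow> (real \<Rightarrow> real) \<Rightarrow> real \<Rightarrow> ennreal" where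
  "bond_energy i u r = (\<integral>\<^sup>+ a. ennreal (coef i * \<kappa> r * mask i r a) * ennreal ((u (a + stretch i * r) - u a)\<^sup>2) \<partial>lborel)"

lemma bond_energy_measurable:
  assumes [measurable]: "u \<in> borel_measurable borel"
  shows "bond_energy i u \<in> borel_measurable borel"
proof -
  have [measurable]: "(\<lambda>p. mask i (fst p) (snd p)) \<in> borel_measurable (lborel \<Otimes>\<^sub>M lborel)"
    using mask_measurable[of i] by (simp add: case_prod_unfold)
  show ?thesis unfolding bond_energy_def[abs_def] by measurable
qed

context
  fixes k :: "real \<Rightarrow> real" and u :: "real \<Rightarrow> real"
  assumes k: "\<And>r. r > 0 \<Longrightarrow> k (real M * r) = \<kappa> r / real M ^ 3"
    and u[measurable]: "u \<in> borel_measurable borel"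
begin

text \<open>Off the diagonal k is a rescaled \<kappa>; only its value at 0 is unconstrained, and
  changing one value does not affect measurability.\<close>

lemma k_measurable: "(\<lambda>p. k \<bar>snd p - fst p\<bar>) \<in> borel_measurable (lborel \<Otimes>\<^sub>M lborel)"
proof -
  have "k \<bar>z\<bar> = (if z = 0 then k 0 else \<kappa> (\<bar>z\<bar> / real M) / real M ^ 3)" for z
    using k[of "\<bar>z\<bar> / real M"] M_pos by auto
  then show ?thesis by simp
qed

text \<open>For a bond of positive length, having an end point at most 0 means that the left end
  point is at most 0. The backward orientation becomes the forward one after a shift by M r.\<close>

lemma energy_across:
  "(\<integral>\<^sup>+ (x, y). (if x \<le> 0 \<or> y \<le> 0 then ennreal (k \<bar>y - x\<bar> * (u y - u x)\<^sup>2) else 0) \<partial>(lborel \<Otimes>\<^sub>M lborel))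
   = 2 * (\<integral>\<^sup>+ r. bond_energy 0 u r \<partial>lborel)"
proof -
  have M0: "real M > 0" using M_pos by simp
  note k_measurable[measurable]
  define F where "F = (\<lambda>(x, y). if x \<le> 0 \<or> y \<le> 0 then ennreal (k \<bar>y - x\<bar> * (u y - u x)\<^sup>2) else 0)"
  have F[measurable]: "F \<in> borel_measurable (lborel \<Otimes>\<^sub>M lborel)"
    unfolding F_def case_prod_unfold by measurable
  have "indicator {0<..} r * (ennreal (real M) * ((\<integral>\<^sup>+ x. F (x, x + real M * r) \<partial>lborel) + (\<integral>\<^sup>+ x. F (x, x - real M * r) \<partial>lborel)))
      = 2 * bond_energy 0 u r" for r
  proof (cases "r > 0")
    case True
    define G where "G a = ennreal (coef 0 * \<kappa> r * mask 0 r a) * ennreal ((u (a + stretch 0 * r) - u a)\<^sup>2)" for a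
    have G[measurable]: "G \<in> borel_measurable borel" unfolding G_def by measurable
    have eq: "ennreal (real M) * ennreal (\<kappa> r * w / real M ^ 3) = ennreal (coef 0 * \<kappa> r) * ennreal w" if "w \<ge> 0" for w
    proof -
      have "real M * (\<kappa> r * w / real M ^ 3) = coef 0 * \<kappa> r * w"
        using M0 by (simp add: coef_def power2_eq_square power3_eq_cube)
      then show ?thesis using that kernel_nonneg coef_nonneg by (simp add: ennreal_mult'[symmetric])
    qed
    have pos: "real M * r > 0" using M0 True by simp
    have 1: "ennreal (real M) * F (a, a + real M * r) = G a" for a
      using pos True by (auto simp: F_def G_def k eq mask_def stretch_def)
    have 2: "ennreal (real M) * F (a + real M * r, a + real M * r - real M * r) = G a" for a
      using pos True by (auto simp: F_def G_def k eq mask_def stretch_def power2_commute)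
    have "ennreal (real M) * (\<integral>\<^sup>+ x. F (x, x + real M * r) \<partial>lborel) = bond_energy 0 u r"
      unfolding bond_energy_def by (subst nn_integral_cmult[symmetric]) (auto simp: 1 G_def)
    moreover have "ennreal (real M) * (\<integral>\<^sup>+ x. F (x, x - real M * r) \<partial>lborel) = bond_energy 0 u r"
    proof -
      have "(\<integral>\<^sup>+ x. F (x, x - real M * r) \<partial>lborel) = (\<integral>\<^sup>+ a. F (a + real M * r, a + real M * r - real M * r) \<partial>lborel)"
        by (rule nn_integral_translate[symmetric]) measurable
      then show ?thesis
        unfolding bond_energy_def by (simp only:, subst nn_integral_cmult[symmetric]) (measurable, simp only: 2 G_def)
    qed
    ultimately show ?thesis using True by (simp add: distrib_left mult_2)
  qed (simp add: bond_energy_def kernel_left)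
  then show ?thesis
    unfolding F_def[symmetric] nn_integral_plane_bonds[OF F M0]
    using bond_energy_measurable by (simp add: nn_integral_cmult)
qed

text \<open>For each j, x is translated to the left end point of the j-th sub-bond, so the sum of
  squares along a bond becomes a sum of masked bond energies.\<close>

lemma energy_right:
  "(\<integral>\<^sup>+ (x, y). (if x > 0 \<and> y > 0 then ennreal (k \<bar>y - x\<bar> * (1 / real M * (\<Sum>j=0..M - 1.
      (u (x + real (j + 1) / real M * (y - x)) - u (x + real j / real M * (y - x)))\<^sup>2 * (real M)\<^sup>2))) else 0)
    \<partial>(lborel \<Otimes>\<^sub>M lborel))
   = 2 * (\<integral>\<^sup>+ r. (\<Sum>j<M. bond_energy (Suc j) u r) \<partial>lborel)"
proof -
  have M0: "real M > 0" using M_pos by simp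
  note k_measurable[measurable]
  define F where "F = (\<lambda>(x, y). if x > 0 \<and> y > 0 then ennreal (k \<bar>y - x\<bar> * (1 / real M * (\<Sum>j=0..M - 1.
      (u (x + real (j + 1) / real M * (y - x)) - u (x + real j / real M * (y - x)))\<^sup>2 * (real M)\<^sup>2))) else 0)"
  have F[measurable]: "F \<in> borel_measurable (lborel \<Otimes>\<^sub>M lborel)"
    unfolding F_def case_prod_unfold by measurable
  have set_eq: "{0..M - 1} = {..<M}" using M_pos by auto
  have "indicator {0<..} r * (ennreal (real M) * ((\<integral>\<^sup>+ x. F (x, x + real M * r) \<partial>lborel) + (\<integral>\<^sup>+ x. F (x, x - real M * r) \<partial>lborel)))
      = 2 * (\<Sum>j<M. bond_energy (Suc j) u r)" for r
  proof (cases "r > 0")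
    case True
    have pos: "real M * r > 0" using M0 True by simp
    define G where "G j a = ennreal (coef (Suc j) * \<kappa> r * mask (Suc j) r a) * ennreal ((u (a + stretch (Suc j) * r) - u a)\<^sup>2)" for j a
    have G[measurable]: "G j \<in> borel_measurable borel" for j unfolding G_def by measurable
    define c where "c = \<kappa> r / real M"
    have c: "c \<ge> 0" using kernel_nonneg by (simp add: c_def)
    have coef: "ennreal (real M) * ennreal (\<kappa> r / real M ^ 3 * (1 / real M * (\<Sum>j<M. w j * (real M)\<^sup>2)))
        = (\<Sum>j<M. ennreal c * ennreal (w j))" if "\<And>j. w j \<ge> 0" for w :: "nat \<Rightarrow> real"
    proof -
      have "real M * (\<kappa> r / real M ^ 3 * (1 / real M * (\<Sum>j<M. w j * (real M)\<^sup>2))) = (\<Sum>j<M. c * w j)"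
        using M0 by (simp add: c_def power2_eq_square power3_eq_cube sum_distrib_left sum_distrib_right)
      then show ?thesis
        using that c kernel_nonneg
        by (simp add: ennreal_mult'[symmetric] sum_nonneg)
    qed
    have 1: "ennreal (real M) * F (x, x + real M * r)
        = (\<Sum>j<M. ennreal (c * (if 0 < x then 1 else 0)) * ennreal ((u (x + real (j + 1) * r) - u (x + real j * r))\<^sup>2))" for x
    proof -
      have arg: "real i / real M * (x + real M * r - x) = real i * r" for i using M0 by simp
      show ?thesis
        using pos True coef[of "\<lambda>j. (u (x + real (j + 1) * r) - u (x + real j * r))\<^sup>2"]
        unfolding F_def prod.case arg set_eq by (auto simp: k)
    qed
    have 2: "ennreal (real M) * F (x, x - real M * r)
        = (\<Sum>j<M. ennreal (c * (if 0 < x - real M * r then 1 else 0)) * ennreal ((u (x - real (j + 1) * r) - u (x - real j * r))\<^sup>2))" for x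
    proof -
      have arg: "x + real i / real M * (x - real M * r - x) = x - real i * r" for i using M0 by simp
      show ?thesis
        using pos True coef[of "\<lambda>j. (u (x - real (j + 1) * r) - u (x - real j * r))\<^sup>2"]
        unfolding F_def prod.case arg set_eq by (auto simp: k)
    qed
    have "ennreal (real M) * (\<integral>\<^sup>+ x. F (x, x + real M * r) \<partial>lborel)
      = (\<Sum>j<M. \<integral>\<^sup>+ x. ennreal (c * (if 0 < x then 1 else 0)) * ennreal ((u (x + real (j + 1) * r) - u (x + real j * r))\<^sup>2) \<partial>lborel)"
      by (subst nn_integral_cmult[symmetric], measurable, unfold 1, subst nn_integral_sum) auto
    also have "\<dots> = (\<Sum>j<M. bond_energy (Suc j) u r)"
    proof (rule sum.cong[OF refl])
      fix j
      have "(\<integral>\<^sup>+ x. ennreal (c * (if 0 < x then 1 else 0)) * ennreal ((u (x + real (j + 1) * r) - u (x + real j * r))\<^sup>2) \<partial>lborel)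
         = (\<integral>\<^sup>+ x. G j (x + real j * r) \<partial>lborel)"
        by (intro nn_integral_cong) (simp add: G_def coef_def mask_def stretch_def c_def algebra_simps)
      also have "\<dots> = (\<integral>\<^sup>+ a. G j a \<partial>lborel)" by (rule nn_integral_translate) measurable
      finally show "(\<integral>\<^sup>+ x. ennreal (c * (if 0 < x then 1 else 0)) * ennreal ((u (x + real (j + 1) * r) - u (x + real j * r))\<^sup>2) \<partial>lborel)
         = bond_energy (Suc j) u r" by (simp add: G_def bond_energy_def)
    qed
    finally have s1: "ennreal (real M) * (\<integral>\<^sup>+ x. F (x, x + real M * r) \<partial>lborel) = (\<Sum>j<M. bond_energy (Suc j) u r)" .
    have "ennreal (real M) * (\<integral>\<^sup>+ x. F (x, x - real M * r) \<partial>lborel)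
      = (\<Sum>j<M. \<integral>\<^sup>+ x. ennreal (c * (if 0 < x - real M * r then 1 else 0)) * ennreal ((u (x - real (j + 1) * r) - u (x - real j * r))\<^sup>2) \<partial>lborel)"
      by (subst nn_integral_cmult[symmetric], measurable, unfold 2, subst nn_integral_sum) auto
    \<comment> \<open>Seen from the right end point the sub-bonds are counted backwards: the j-th
      from the right is number M - 1 - j from the left.\<close>
    also have "\<dots> = (\<Sum>j<M. bond_energy (Suc (M - Suc j)) u r)"
    proof (rule sum.cong[OF refl])
      fix j assume "j \<in> {..<M}"
      then have j: "real (M - Suc j) = real M - real (j + 1)" by simp
      have "(\<integral>\<^sup>+ x. ennreal (c * (if 0 < x - real M * r then 1 else 0)) * ennreal ((u (x - real (j + 1) * r) - u (x - real j * r))\<^sup>2) \<partial>lborel)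
         = (\<integral>\<^sup>+ x. G (M - Suc j) (x + - (real (j + 1) * r)) \<partial>lborel)"
      proof (intro nn_integral_cong)
        fix x
        have "0 < x - real M * r \<longleftrightarrow> real (M - Suc j) * r < x + - (real (j + 1) * r)"
          unfolding j left_diff_distrib by linarith
        moreover have "(u (x - real (j + 1) * r) - u (x - real j * r))\<^sup>2
            = (u (x + - (real (j + 1) * r) + 1 * r) - u (x + - (real (j + 1) * r)))\<^sup>2"
          by (subst power2_commute) (simp add: algebra_simps)
        ultimately show "ennreal (c * (if 0 < x - real M * r then 1 else 0)) * ennreal ((u (x - real (j + 1) * r) - u (x - real j * r))\<^sup>2)
          = G (M - Suc j) (x + - (real (j + 1) * r))"
          by (simp only: G_def coef_def mask_def stretch_def c_def) simp
      qed
      also have "\<dots> = (\<integral>\<^sup>+ a. G (M - Suc j) a \<partial>lborel)" by (rule nn_integral_translate) measurable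
      finally show "(\<integral>\<^sup>+ x. ennreal (c * (if 0 < x - real M * r then 1 else 0)) * ennreal ((u (x - real (j + 1) * r) - u (x - real j * r))\<^sup>2) \<partial>lborel)
         = bond_energy (Suc (M - Suc j)) u r" by (simp add: G_def bond_energy_def)
    qed
    also have "\<dots> = (\<Sum>j<M. bond_energy (Suc j) u r)" by (rule sum.nat_diff_reindex)
    finally show ?thesis using True s1 by (simp add: distrib_left mult_2)
  qed (simp add: bond_energy_def kernel_left)
  then show ?thesis
    unfolding F_def[symmetric] nn_integral_plane_bonds[OF F M0]
    using bond_energy_measurable by (simp add: nn_integral_cmult)
qed

end

lemma E_qnl_eq:
  assumes k: "\<And>r. r > 0 \<Longrightarrow> scaled_kernel \<gamma> \<delta>1 (real M * r) = \<kappa> r / real M ^ 3"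
    and u[measurable]: "u \<in> borel_measurable borel"
  shows "E_qnl \<gamma> \<delta>1 M u = ennreal (1 / 2) * (\<integral>\<^sup>+ \<omega>. ennreal ((bond_diff u \<omega>)\<^sup>2) \<partial>bonds)"
proof -

  have half: "ennreal (1 / 4) * (2 * z) = ennreal (1 / 2) * z" for z
  proof -
    have "ennreal (1 / 4) * (2 * z) = (ennreal (1 / 4) * ennreal 2) * z" by (simp add: mult.assoc)
    also have "ennreal (1 / 4) * ennreal 2 = ennreal (1 / 2)" by (subst ennreal_mult'[symmetric]) auto
    finally show ?thesis .
  qed
  have "(\<integral>\<^sup>+ \<omega>. ennreal ((bond_diff u \<omega>)\<^sup>2) \<partial>bonds) = (\<Sum>i\<le>M. \<integral>\<^sup>+ r. bond_energy i u r \<partial>lborel)"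
  proof -
    have "(\<lambda>\<omega>. ennreal ((bond_diff u \<omega>)\<^sup>2)) \<in> borel_measurable bond_space" by measurable
    from nn_integral_bonds[OF this] show ?thesis by (simp add: bond_energy_def bond_diff_def)
  qed
  also have "\<dots> = (\<integral>\<^sup>+ r. bond_energy 0 u r \<partial>lborel) + (\<Sum>j<M. \<integral>\<^sup>+ r. bond_energy (Suc j) u r \<partial>lborel)"
    by (rule sum.atMost_shift)
  also have "(\<Sum>j<M. \<integral>\<^sup>+ r. bond_energy (Suc j) u r \<partial>lborel) = (\<integral>\<^sup>+ r. (\<Sum>j<M. bond_energy (Suc j) u r) \<partial>lborel)"
    using bond_energy_measurable[OF u] by (intro nn_integral_sum[symmetric]) auto
  finally show ?thesis
    unfolding E_qnl_def
    using energy_across[of "scaled_kernel \<gamma> \<delta>1" u, OF k u] energy_right[of "scaled_kernel \<gamma> \<delta>1" u, OF k u]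
    by (simp only: half distrib_left)
qed

text \<open>Finite energy means membership in the form domain, where the energy is half the
  quadratic form; its derivative at u in direction v is then \<open>form u v\<close>, so the
  variational condition is the weak equation of \<open>op_graph\<close>.\<close>

lemma L_qnl_graph_eq:
  assumes k: "\<And>r. r > 0 \<Longrightarrow> scaled_kernel \<gamma> \<delta>1 (real M * r) = \<kappa> r / real M ^ 3"
  shows "L_qnl_graph \<gamma> \<delta>1 M = op_graph"
proof -
  have fin: "E_qnl \<gamma> \<delta>1 M u < \<infinity> \<longleftrightarrow> u \<in> form_dom" if "u \<in> L2" for u
  proof -
    define h where "h = ennreal (1 / 2)"
    have "h < top" unfolding h_def by (rule ennreal_less_top)
    moreover have "h \<noteq> 0" by (simp add: h_def)
    ultimately have "h * z < \<infinity> \<longleftrightarrow> z < \<infinity>" for z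
      by (auto simp: ennreal_mult_less_top)
    then have "ennreal (1 / 2) * z < \<infinity> \<longleftrightarrow> z < \<infinity>" for z unfolding h_def .
    then show ?thesis
      using that square_integrable_nn_integral[OF D_measurable[OF L2_measurable[OF that]]]
      by (simp only: E_qnl_eq[OF k L2_measurable[OF that]] form_dom_def mem_Collect_eq simp_thms)
  qed
  have val: "enn2real (E_qnl \<gamma> \<delta>1 M u) = 1 / 2 * form u u" if "u \<in> form_dom" for u
  proof -
    have "(\<integral>\<^sup>+ \<omega>. ennreal ((bond_diff u \<omega>)\<^sup>2) \<partial>bonds) = ennreal (form u u)"
      unfolding form_def power2_eq_square[symmetric]
      using form_domD(2)[OF that] by (intro nn_integral_eq_integral) (auto simp: square_integrable_def)
    then have "E_qnl \<gamma> \<delta>1 M u = ennreal (1 / 2 * form u u)"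
      by (simp only: E_qnl_eq[OF k L2_measurable[OF form_domD(1)[OF that]]] ennreal_mult'' form_nonneg)
    then show ?thesis using form_nonneg by simp
  qed
  have deriv: "((\<lambda>t. enn2real (E_qnl \<gamma> \<delta>1 M (\<lambda>x. u x + t * v x))) has_real_derivative form u v) (at 0)"
    if "u \<in> form_dom" "v \<in> form_dom" for u v
  proof -
    have "form (\<lambda>x. u x + t * v x) (\<lambda>x. u x + t * v x) = form u u + 2 * t * form u v + t\<^sup>2 * form v v" for t
    proof -
      define w where "w = (\<lambda>x. u x + t * v x)"
      have w: "w \<in> form_dom" unfolding w_def using that by (rule form_dom_lin)
      have "form w w = form w u + t * form w v"
        using form_lin[OF that w, of t] by (simp only: w_def[symmetric] form_sym[of u w] form_sym[of v w])
      also have "\<dots> = form u u + 2 * t * form u v + t\<^sup>2 * form v v"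
        unfolding w_def using form_lin[OF that that(1), of t] form_lin[OF that that(2), of t] form_sym[of v u]
        by (simp add: power2_eq_square algebra_simps)
      finally show ?thesis by (simp add: w_def)
    qed
    then have eq: "(\<lambda>t. enn2real (E_qnl \<gamma> \<delta>1 M (\<lambda>x. u x + t * v x)))
        = (\<lambda>t. 1 / 2 * (form u u + 2 * t * form u v + t\<^sup>2 * form v v))"
      using that by (simp add: val form_dom_lin)
    show ?thesis unfolding eq by (auto intro!: derivative_eq_intros)
  qed
  show ?thesis
  proof (intro equalityI subrelI)
    fix u f assume "(u, f) \<in> L_qnl_graph \<gamma> \<delta>1 M"
    then have uf: "u \<in> L2" "f \<in> L2" "u \<in> form_dom"
      "\<And>v. v \<in> L2 \<Longrightarrow> v \<in> form_dom \<Longrightarrow> ((\<lambda>t. enn2real (E_qnl \<gamma> \<delta>1 M (\<lambda>x. u x + t * v x)))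
           has_real_derivative - l2_inner f v) (at 0)"
      unfolding L_qnl_graph_def using fin by auto
    then have "form u v = - l2_inner f v" if "v \<in> form_dom" for v
      using DERIV_unique[OF deriv[OF uf(3) that] uf(4)] that form_domD by blast
    then show "(u, f) \<in> op_graph" using uf by (simp add: op_graph_def)
  next
    fix u f assume "(u, f) \<in> op_graph"
    then have uf: "u \<in> form_dom" "f \<in> L2" "\<And>v. v \<in> form_dom \<Longrightarrow> form u v = - l2_inner f v"
      by (auto simp: op_graph_def)
    show "(u, f) \<in> L_qnl_graph \<gamma> \<delta>1 M"
      unfolding L_qnl_graph_def using uf form_domD(1)[OF uf(1)] fin deriv[OF uf(1)] by auto
  qed
qed

end

text \<open>The first clause concerns the operator given by the energy; the second and third
  identify it with the integral formula, everywhere for smooth u and almost everywhere on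
  \<open>L2\<close> when the kernel is integrable. The last two are symmetry of the formula itself
  and consistency.\<close>

theorem lemma3p1:
  fixes \<gamma> :: "real \<Rightarrow> real" and \<delta>1 \<delta>2 :: real and M :: nat
  assumes gamma_nonneg: "\<And>s. s \<ge> 0 \<Longrightarrow> \<gamma> s \<ge> 0"
    and gamma_supp: "\<And>s. s \<ge> 1 \<Longrightarrow> \<gamma> s = 0"
    and gamma_moment: "set_integrable lborel {0..} (\<lambda>s. s\<^sup>2 * \<gamma> s)"
    and delta1_pos: "\<delta>1 > 0" and delta2_pos: "\<delta>2 > 0"
    and M_pos: "M \<ge> 1" and delta_rel: "\<delta>1 = real M * \<delta>2"
  shows "self_adjoint_L2 (L_qnl_graph \<gamma> \<delta>1 M)
    \<and> (\<forall>u\<in>C2_compact. (\<forall>x. L_qnl_defined \<gamma> \<delta>1 \<delta>2 M u x)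
          \<and> (u, L_qnl \<gamma> \<delta>1 \<delta>2 M u) \<in> L_qnl_graph \<gamma> \<delta>1 M)
    \<and> (set_integrable lborel {0..} \<gamma> \<longrightarrow>
        (\<forall>u\<in>L2. \<exists>f. (u, f) \<in> L_qnl_graph \<gamma> \<delta>1 M \<and>
          (AE x in lborel. L_qnl_defined \<gamma> \<delta>1 \<delta>2 M u x \<and> f x = L_qnl \<gamma> \<delta>1 \<delta>2 M u x)))
    \<and> (\<forall>u\<in>C2_compact. \<forall>v\<in>C2_compact.
          l2_inner (L_qnl \<gamma> \<delta>1 \<delta>2 M u) v = l2_inner u (L_qnl \<gamma> \<delta>1 \<delta>2 M v))
    \<and> (\<forall>F u0 x. L_qnl_defined \<gamma> \<delta>1 \<delta>2 M (\<lambda>z. F * z + u0) x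
          \<and> L_qnl \<gamma> \<delta>1 \<delta>2 M (\<lambda>z. F * z + u0) x = 0)"
proof -
  have M0: "real M > 0" using M_pos by simp
  \<comment> \<open>Values of \<gamma> at negative arguments are unspecified, so the kernel is set
    to 0 there; r = 0 joins them, which changes only a null set.\<close>
  define \<kappa> where "\<kappa> r = (if 0 < r then scaled_kernel \<gamma> \<delta>2 r else 0)" for r
  define f where "f s = indicator {0..} s * (s\<^sup>2 * \<gamma> s)" for s
  have f: "integrable lborel f"
    using gamma_moment by (simp add: set_integrable_def f_def[abs_def])
  have moment_eq: "(\<lambda>r. r\<^sup>2 * \<kappa> r) = (\<lambda>r. 1 / \<delta>2 * f (0 + 1 / \<delta>2 * r))"
  proof
    fix r
    show "r\<^sup>2 * \<kappa> r = 1 / \<delta>2 * f (0 + 1 / \<delta>2 * r)"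
      using delta2_pos
      by (auto simp: \<kappa>_def f_def scaled_kernel_def indicator_def power_divide power2_eq_square power3_eq_cube zero_le_divide_iff)
  qed
  have moment: "integrable lborel (\<lambda>r. r\<^sup>2 * \<kappa> r)"
    unfolding moment_eq using delta2_pos by (intro integrable_mult_right lborel_integrable_real_affine f) auto
  have meas: "\<kappa> \<in> borel_measurable borel"
  proof -
    \<comment> \<open>Measurability of \<gamma> is not a hypothesis; it enters through the moment
      and is recovered by dividing by r^2. At r = 0 the quotient is 0 by convention, the value of
      \<kappa> there.\<close>
    have "(\<lambda>r. (r\<^sup>2 * \<kappa> r) / r\<^sup>2) \<in> borel_measurable borel"
      using borel_measurable_integrable[OF moment] by measurable
    also have "(\<lambda>r. (r\<^sup>2 * \<kappa> r) / r\<^sup>2) = \<kappa>" by (auto simp: \<kappa>_def)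
    finally show ?thesis .
  qed
  interpret K: qnl_kernel \<kappa> M \<delta>2
  proof
    show "\<kappa> r \<ge> 0" for r using gamma_nonneg delta2_pos by (simp add: \<kappa>_def scaled_kernel_def)
    show "\<kappa> r = 0" if "r \<ge> \<delta>2" for r
      using that gamma_supp[of "r / \<delta>2"] delta2_pos by (simp add: \<kappa>_def scaled_kernel_def)
  qed (use meas moment M_pos in \<open>auto simp: \<kappa>_def\<close>)
  have k: "scaled_kernel \<gamma> \<delta>1 (real M * r) = \<kappa> r / real M ^ 3" if "r > 0" for r
    using that M0 by (simp add: \<kappa>_def scaled_kernel_def delta_rel power_mult_distrib)
  have graph: "L_qnl_graph \<gamma> \<delta>1 M = K.op_graph" by (rule K.L_qnl_graph_eq) (rule k)
  have d1: "diff_term \<gamma> \<delta>1 u x = (\<lambda>y. (u y - u x) * (\<kappa> (\<bar>y - x\<bar> / real M) / real M ^ 3))" for u x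
  proof
    fix y
    show "diff_term \<gamma> \<delta>1 u x y = (u y - u x) * (\<kappa> (\<bar>y - x\<bar> / real M) / real M ^ 3)"
      using k[of "\<bar>y - x\<bar> / real M"] M0 by (cases "y = x") (auto simp: diff_term_def)
  qed
  have d2: "diff_term \<gamma> \<delta>2 u x = (\<lambda>y. (u y - u x) * (\<kappa> (\<bar>y - x\<bar> / 1) / 1 ^ 3))" for u x
    by (auto simp: diff_term_def \<kappa>_def)
  have pv: "L_qnl_defined \<gamma> \<delta>1 \<delta>2 M u x \<and> L_qnl \<gamma> \<delta>1 \<delta>2 M u x = K.qnl_op u x"
    if "K.pv_regular u x" for u x
    using that delta2_pos delta_rel d1 d2 by (rule K.qnl_op_pv)
  have C2: "(\<forall>x. L_qnl_defined \<gamma> \<delta>1 \<delta>2 M u x) \<and> L_qnl \<gamma> \<delta>1 \<delta>2 M u = K.qnl_op u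
      \<and> (u, K.qnl_op u) \<in> K.op_graph" if "u \<in> C2_compact" for u
    using pv[OF K.pv_regular_C2[OF that]] K.C2_compact_in_graph[OF that] by auto
  have int: "\<exists>f. (u, f) \<in> L_qnl_graph \<gamma> \<delta>1 M \<and>
          (AE x in lborel. L_qnl_defined \<gamma> \<delta>1 \<delta>2 M u x \<and> f x = L_qnl \<gamma> \<delta>1 \<delta>2 M u x)"
    if \<gamma>: "set_integrable lborel {0..} \<gamma>" and u: "u \<in> L2" for u
  proof -
    have "integrable lborel (\<lambda>s. indicator {0..} s * \<gamma> s)" using \<gamma> by (simp add: set_integrable_def)
    then have "integrable lborel (\<lambda>r. 1 / \<delta>2 ^ 3 * (indicator {0..} (0 + 1 / \<delta>2 * r) * \<gamma> (0 + 1 / \<delta>2 * r)))"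
      using delta2_pos by (intro integrable_mult_right lborel_integrable_real_affine) auto
    \<comment> \<open>The rescaled \<gamma> and \<kappa> differ at most at r = 0, where \<kappa> was
      set to 0.\<close>
    moreover have "AE r in lborel. 1 / \<delta>2 ^ 3 * (indicator {0..} (0 + 1 / \<delta>2 * r) * \<gamma> (0 + 1 / \<delta>2 * r)) = \<kappa> r"
      using AE_lborel_singleton[of 0]
      by eventually_elim (use delta2_pos in \<open>auto simp: \<kappa>_def scaled_kernel_def indicator_def zero_le_divide_iff\<close>)
    ultimately have \<kappa>: "integrable lborel \<kappa>"
      using meas by (subst integrable_cong_AE[symmetric]) auto
    have "AE x in lborel. L_qnl_defined \<gamma> \<delta>1 \<delta>2 M u x \<and> K.qnl_op u x = L_qnl \<gamma> \<delta>1 \<delta>2 M u x"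
      using K.pv_regular_kernel_integrable[OF \<kappa> u] by eventually_elim (use pv in auto)
    then show ?thesis
      unfolding graph by (intro exI[of _ "K.qnl_op u"] conjI K.kernel_integrable_op[OF \<kappa> u])
  qed
  show ?thesis
  proof (intro conjI)
    show "self_adjoint_L2 (L_qnl_graph \<gamma> \<delta>1 M)" unfolding graph by (rule K.op_graph_self_adjoint)
    show "\<forall>u\<in>C2_compact. (\<forall>x. L_qnl_defined \<gamma> \<delta>1 \<delta>2 M u x)
          \<and> (u, L_qnl \<gamma> \<delta>1 \<delta>2 M u) \<in> L_qnl_graph \<gamma> \<delta>1 M"
      unfolding graph using C2 by simp
    show "set_integrable lborel {0..} \<gamma> \<longrightarrow>
        (\<forall>u\<in>L2. \<exists>f. (u, f) \<in> L_qnl_graph \<gamma> \<delta>1 M \<and>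
          (AE x in lborel. L_qnl_defined \<gamma> \<delta>1 \<delta>2 M u x \<and> f x = L_qnl \<gamma> \<delta>1 \<delta>2 M u x))"
      using int by blast
    show "\<forall>u\<in>C2_compact. \<forall>v\<in>C2_compact.
          l2_inner (L_qnl \<gamma> \<delta>1 \<delta>2 M u) v = l2_inner u (L_qnl \<gamma> \<delta>1 \<delta>2 M v)"
      using C2 K.op_graph_symmetric by auto
    show "\<forall>F u0 x. L_qnl_defined \<gamma> \<delta>1 \<delta>2 M (\<lambda>z. F * z + u0) x
          \<and> L_qnl \<gamma> \<delta>1 \<delta>2 M (\<lambda>z. F * z + u0) x = 0"
      using pv[OF K.pv_regular_affine] by (simp add: K.qnl_op_affine)
  qed
qed

end
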